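(* Let $\mathcal{G}$ be the set of points $s\in\mathbb{C}$ with $|s-1|>2\pi e$ and $$\frac{\pi}{2}\le\arg(s-1)\le\frac{\pi}{2}+2\arctan\sqrt{\log\frac{|s-1|}{2\pi}}.$$ Then $$\mathcal{R}(s)=\chi(s)\Bigl(\zeta(1-s)-\sum_{n=1}^{m}n^{s-1}+O(1)\Bigr),\qquad s\in\mathcal{G},\ s\to\infty,$$ where $m$ and $\chi$ are as in the context.
   Context: Riemann's auxiliary function is the entire function $$\mathcal{R}(s)=\int_{0\swarrow1}\frac{x^{-s}e^{\pi i x^2}}{e^{\pi i x}-e^{-\pi i x}}\,dx,$$ where the path is a straight line of direction $e^{-3\pi i/4}$ (running from the upper right to the lower left) crossing the real axis at a point strictly between $0$ and $1$, and $x^{-s}=\exp(-s\log x)$ with the principal logarithm. $\zeta$ is the Riemann zeta function and $\chi(s)=\pi^{s-\frac12}\Gamma(\frac{1-s}{2})/\Gamma(\frac{s}{2})$, so that $\zeta(s)=\chi(s)\zeta(1-s)$. Here $\arg(s-1)$ is taken in $(0,2\pi)$. Put $\eta=\sqrt{(s-1)/(2\pi i)}$ with $-\frac{\pi}{4}<\arg\eta<\frac{3\pi}{4}$, $\eta_1=\operatorname{Re}\eta$, $\eta_2=\operatorname{Im}\eta$, and $m=\lfloor\eta_1+\eta_2\rfloor$. *)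

theory Defs
  imports "HOL-Complex_Analysis.Complex_Analysis" "HOL-Library.Landau_Symbols"
begin

(* The condition f 1 = 0 only fixes the value at the pole, so that the meromorphic
   continuation is a unique total function. *)
definition zeta :: "complex \<Rightarrow> complex" where
  "zeta = (THE f. f holomorphic_on - {1} \<and> f 1 = 0 \<and>
             (\<forall>s. Re s > 1 \<longrightarrow> (\<lambda>n. of_nat (Suc n) powr (- s)) sums f s))"

(* Since Gamma is 0 at its poles and x / 0 = 0, this yields the correct value 0 at the
   zeros s = 0, -2, -4, ... of chi.  Only the poles s = 1, 3, 5, ... get a junk value. *)
definition chi :: "complex \<Rightarrow> complex" where
  "chi s = of_real pi powr (s - 1/2) * Gamma ((1 - s) / 2) / Gamma (s / 2)"

definition R_integrand :: "complex \<Rightarrow> complex \<Rightarrow> complex" where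
  "R_integrand s x = exp (- s * Ln x) * exp (pi * \<i> * x\<^sup>2) / (exp (pi * \<i> * x) - exp (- pi * \<i> * x))"

(* The line is x = c + t * cis (- 3 * pi / 4), with t running from -oo to oo and 0 < c < 1;
   the factor cis (- 3 * pi / 4) is dx/dt.  The value does not depend on c in this range. *)
definition riemann_R :: "real \<Rightarrow> complex \<Rightarrow> complex" where
  "riemann_R c s =
     (LINT t|lborel. R_integrand s (of_real c + of_real t * cis (- 3 * pi / 4)) * cis (- 3 * pi / 4))"

(* Uniquely determined whenever s - 1 is not a positive real. *)
definition eta :: "complex \<Rightarrow> complex" where
  "eta s = (THE w. w\<^sup>2 = (s - 1) / (2 * pi * \<i>) \<and> - pi / 4 < Arg w \<and> Arg w < 3 * pi / 4)"

definition m_index :: "complex \<Rightarrow> int" where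
  "m_index s = \<lfloor>Re (eta s) + Im (eta s)\<rfloor>"

definition G_region :: "complex set" where
  "G_region = {s. cmod (s - 1) > 2 * pi * exp 1 \<and>
     pi / 2 \<le> Arg2pi (s - 1) \<and>
     Arg2pi (s - 1) \<le> pi / 2 + 2 * arctan (sqrt (ln (cmod (s - 1) / (2 * pi))))}"

end

theory Submission
  imports Defs "HOL-Probability.Probability" "HOL-Real_Asymp.Real_Asymp"
begin

text \<open>
  Write \<open>w = 1 - s\<close> and let \<open>R\<^sup>*(w)\<close> be the complex conjugate of \<open>R\<close> at the conjugate of \<open>w\<close>.
  Inserting \<open>\<Gamma>(w) x\<^sup>-\<^sup>w = \<integral> r\<^sup>w\<^sup>-\<^sup>1 e\<^sup>-\<^sup>r\<^sup>x dr\<close> into \<open>R\<^sup>*(w)\<close> and evaluating the inner integral, a Mordell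
  integral with a closed form, gives Riemann's identity \<open>R(s) = \<chi>(s) (\<zeta>(1 - s) - R\<^sup>*(1 - s))\<close> together
  with the continuation of \<open>\<zeta>\<close>. It remains to see that \<open>R\<^sup>*(w) = \<Sum>\<^bsub>n\<le>m\<^esub> n\<^sup>-\<^sup>w + O(1)\<close>.
  The sum collects the residues when the line of integration is moved to the saddle point \<open>\<eta>\<close>
  of \<open>x\<^sup>-\<^sup>w e\<^bsup>-\<pi>ix\<^sup>2\<^esup>\<close>. On the moved line the integrand decays like a Gaussian, and its size at
  the saddle point is at most 1 precisely because of the bound on \<open>arg(s - 1)\<close> that defines the region.
\<close>

section \<open>Residues in a strip and holomorphic parameter integrals\<close>

text \<open>The definite description \<open>zeta\<close> gives nothing until a continuation has been
  produced, so the functional equation cannot be quoted; it falls out of the construction. The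
  second term of the Mordell closed form leaves an integral over a ray from 0 that converges for Re
  w > 1. For 1 < Re w < 2 this ray integral is again an R*: the line of R*(1 - conj w) can be pushed
  onto the origin, where it splits into two opposite rays carrying the same integral up to phases,
  and the phases add up to a cosine that the gamma factors in \<open>chi\<close> absorb. Hence
  zeta(w) = R*(w) + chi(w) conj(R*(1 - conj w)) in the strip, and the right-hand side continues zeta
  to the left because R* is entire. In the estimate the obstacle is that the saddle point may
  coincide with a pole. The line through it is therefore displaced by a bounded amount, so that it
  crosses the real axis at distance at least 1/4 from the integers; this costs only a constant
  factor. The bound that defines the region enters as tan(theta/2)^2 <= log(|s - 1|/(2 pi)), where
  theta = arg(s - 1) - pi/2.\<close>

lemma lborel_integral_symmetric_limit:
  fixes f :: "real \<Rightarrow> complex"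
  assumes "integrable lborel f"
  shows "(\<lambda>n. integral {-real n..real n} f) \<longlonglongrightarrow> (\<integral>t. f t \<partial>lborel)"
proof -
  have "(\<lambda>n. \<integral>t. indicator {-real n..real n} t *\<^sub>R f t \<partial>lborel) \<longlonglongrightarrow> (\<integral>t. f t \<partial>lborel)"
  proof (rule integral_dominated_convergence[where w = "\<lambda>t. norm (f t)"])
    show "AE x in lborel. (\<lambda>n. indicator {- real n..real n} x *\<^sub>R f x) \<longlonglongrightarrow> f x"
    proof (rule AE_I2, rule tendsto_eventually)
      fix x :: real
      obtain N where "\<bar>x\<bar> \<le> real N"
        using real_arch_simple by blast
      then show "eventually (\<lambda>n. indicator {- real n..real n} x *\<^sub>R f x = f x) sequentially"
        by (intro eventually_sequentiallyI[of N]) (auto simp: indicator_def)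
    qed
  qed (use assms in \<open>auto simp: indicator_def\<close>)
  moreover have "(\<integral>t. indicator {-real n..real n} t *\<^sub>R f t \<partial>lborel) = integral {-real n..real n} f" for n
  proof -
    have "set_integrable lborel {-real n..real n} f"
      unfolding set_integrable_def using assms by (rule integrable_mult_indicator[rotated]) auto
    from set_borel_integral_eq_integral(2)[OF this] show ?thesis
      by (simp add: set_lebesgue_integral_def)
  qed
  ultimately show ?thesis by simp
qed

text \<open>Residue theorem on rectangles of height 2n. The horizontal sides vanish in the limit,
  and each vertical side is \<open>\<i>\<close> times an integral over t, which cancels the
  \<open>\<i>\<close> of 2 pi i.\<close>

lemma strip_residue:
  fixes f :: "complex \<Rightarrow> complex"
  assumes S: "open S" "connected S" "{z. a \<le> Re z \<and> Re z \<le> b} \<subseteq> S"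
    and pts: "finite pts" "\<And>p. p \<in> pts \<Longrightarrow> a < Re p \<and> Re p < b"
    and f: "f holomorphic_on S - pts" and "a < b"
    and int: "integrable lborel (\<lambda>t. f (Complex a t))" "integrable lborel (\<lambda>t. f (Complex b t))"
    and decay: "\<And>e. e > 0 \<Longrightarrow> \<exists>T. \<forall>x t. T \<le> \<bar>t\<bar> \<longrightarrow> a \<le> x \<longrightarrow> x \<le> b \<longrightarrow> norm (f (Complex x t)) \<le> e"
  shows "(\<integral>t. f (Complex b t) \<partial>lborel) - (\<integral>t. f (Complex a t) \<partial>lborel)
           = 2 * pi * (\<Sum>p\<in>pts. residue f p)"
proof -
  define V where "V = (\<lambda>n. integral {-real n..real n} (\<lambda>t. f (Complex b t))
                          - integral {-real n..real n} (\<lambda>t. f (Complex a t)))"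
  define L where "L = 2 * pi * (\<Sum>p\<in>pts. residue f p)"
  have "V \<longlonglongrightarrow> (\<integral>t. f (Complex b t) \<partial>lborel) - (\<integral>t. f (Complex a t) \<partial>lborel)"
    unfolding V_def by (intro tendsto_diff lborel_integral_symmetric_limit int)
  moreover have "V \<longlonglongrightarrow> L"
  proof (rule metric_LIMSEQ_I)
    fix r :: real assume "r > 0"
    \<comment> \<open>Both horizontal sides have length \<open>b - a\<close>, so together they
      contribute at most r/2.\<close>
    define e where "e = r / 4 / (b - a)"
    have "e > 0" using \<open>r > 0\<close> \<open>a < b\<close> by (simp add: e_def)
    from decay[OF this] obtain T where
      T: "\<And>x t. T \<le> \<bar>t\<bar> \<Longrightarrow> a \<le> x \<Longrightarrow> x \<le> b \<Longrightarrow> norm (f (Complex x t)) \<le> e" by blast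
    obtain N where N: "max T (1 + (\<Sum>p\<in>pts. \<bar>Im p\<bar>)) \<le> real N"
      using real_arch_simple by blast
    show "\<exists>no. \<forall>n\<ge>no. dist (V n) L < r"
    proof (intro exI allI impI)
      fix n assume "n \<ge> N"
      then have n: "T \<le> real n" "1 + (\<Sum>p\<in>pts. \<bar>Im p\<bar>) \<le> real n" using N by auto
      have Im: "\<bar>Im p\<bar> < real n" if "p \<in> pts" for p
      proof -
        have "\<bar>Im p\<bar> \<le> (\<Sum>p\<in>pts. \<bar>Im p\<bar>)" using that pts(1) by (intro member_le_sum) auto
        then show ?thesis using n by linarith
      qed
      have n0: "0 < real n"
      proof -
        have "0 \<le> (\<Sum>p\<in>pts. \<bar>Im p\<bar>)" by (intro sum_nonneg) auto
        then show ?thesis using n by linarith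
      qed
      define c1 c2 c3 c4 where "c1 = Complex a (-real n)" and "c2 = Complex b (-real n)"
        and "c3 = Complex b (real n)" and "c4 = Complex a (real n)"
      have sub: "path_image (rectpath c1 c3) \<subseteq> S - pts"
      proof
        fix z assume "z \<in> path_image (rectpath c1 c3)"
        then have z: "z \<in> {z. Re z \<in> {a, b} \<and> Im z \<in> {-real n..real n}} \<union>
           {z. Im z \<in> {-real n, real n} \<and> Re z \<in> {a..b}}"
          using n0 \<open>a < b\<close> by (subst (asm) path_image_rectpath) (auto simp: c1_def c3_def)
        have "z \<notin> pts" using z Im[of z] pts(2)[of z] by auto
        moreover have "z \<in> S" using z S(3) \<open>a < b\<close> by (auto simp: subset_iff)
        ultimately show "z \<in> S - pts" by blast
      qed
      have "contour_integral (rectpath c1 c3) f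
              = 2 * pi * \<i> * (\<Sum>p\<in>pts. winding_number (rectpath c1 c3) p * residue f p)"
      proof (rule Residue_theorem[OF S(1,2) pts(1) f])
        show "\<forall>z. z \<notin> S \<longrightarrow> winding_number (rectpath c1 c3) z = 0"
        proof (intro allI impI)
          fix z assume "z \<notin> S"
          then have "z \<notin> cbox c1 c3" using S(3)
            by (auto simp: in_cbox_complex_iff c1_def c3_def subset_iff)
          then show "winding_number (rectpath c1 c3) z = 0"
            by (rule winding_number_rectpath_outside[rotated 2])
               (use \<open>a < b\<close> n0 in \<open>auto simp: c1_def c3_def\<close>)
        qed
      qed (use sub in auto)
      also have "(\<Sum>p\<in>pts. winding_number (rectpath c1 c3) p * residue f p) = (\<Sum>p\<in>pts. residue f p)"
      proof (intro sum.cong refl)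
        fix p assume "p \<in> pts"
        then have "p \<in> box c1 c3" using pts(2)[of p] Im[of p]
          by (auto simp: in_box_complex_iff c1_def c3_def)
        then show "winding_number (rectpath c1 c3) p * residue f p = residue f p"
          by (simp add: winding_number_rectpath)
      qed
      finally have 1: "contour_integral (rectpath c1 c3) f = \<i> * L" by (simp add: L_def)
      have rp: "rectpath c1 c3 = linepath c1 c2 +++ linepath c2 c3 +++ linepath c3 c4 +++ linepath c4 c1"
        by (simp add: rectpath_def c1_def c2_def c3_def c4_def Let_def)
      have con: "continuous_on (path_image (rectpath c1 c3)) f"
        using f sub holomorphic_on_imp_continuous_on holomorphic_on_subset by blast
      have pim: "path_image (rectpath c1 c3) = closed_segment c1 c2 \<union> closed_segment c2 c3
                 \<union> closed_segment c3 c4 \<union> closed_segment c4 c1"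
        unfolding rp by (simp add: path_image_join Un_assoc)
      have ci: "f contour_integrable_on linepath c1 c2" "f contour_integrable_on linepath c2 c3"
               "f contour_integrable_on linepath c3 c4" "f contour_integrable_on linepath c4 c1"
        using con unfolding pim
        by (auto intro!: contour_integrable_continuous_linepath elim: continuous_on_subset)
      have 2: "contour_integral (rectpath c1 c3) f = contour_integral (linepath c1 c2) f
         + contour_integral (linepath c2 c3) f + contour_integral (linepath c3 c4) f
         + contour_integral (linepath c4 c1) f"
        unfolding rp using ci by (simp add: contour_integrable_joinI valid_path_join)
      have 3: "contour_integral (linepath c2 c3) f = \<i> * integral {-real n..real n} (\<lambda>t. f (Complex b t))"
        by (rule contour_integral_linepath_same_Re) (use n0 in \<open>auto simp: c2_def c3_def\<close>)
      have "contour_integral (linepath c4 c1) f = - contour_integral (linepath c1 c4) f"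
        by (metis contour_integral_reversepath reversepath_linepath valid_path_linepath)
      also have "contour_integral (linepath c1 c4) f = \<i> * integral {-real n..real n} (\<lambda>t. f (Complex a t))"
        by (rule contour_integral_linepath_same_Re) (use n0 in \<open>auto simp: c1_def c4_def\<close>)
      finally have 4: "contour_integral (linepath c4 c1) f = - \<i> * integral {-real n..real n} (\<lambda>t. f (Complex a t))"
        by simp
      have 5: "norm (contour_integral (linepath c1 c2) f) \<le> e * norm (c2 - c1)"
      proof (rule contour_integral_bound_linepath[OF ci(1)])
        fix z assume "z \<in> closed_segment c1 c2"
        then have "Im z = - real n" "Re z \<in> {a..b}"
          using \<open>a < b\<close> by (auto simp: c1_def c2_def closed_segment_same_Im closed_segment_eq_real_ivl)
        then have "norm (f (Complex (Re z) (Im z))) \<le> e" using n by (intro T) auto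
        then show "norm (f z) \<le> e" by simp
      qed (use \<open>e > 0\<close> in auto)
      have 6: "norm (contour_integral (linepath c3 c4) f) \<le> e * norm (c4 - c3)"
      proof (rule contour_integral_bound_linepath[OF ci(3)])
        fix z assume "z \<in> closed_segment c3 c4"
        then have "Im z = real n" "Re z \<in> {a..b}"
          using \<open>a < b\<close> by (auto simp: c3_def c4_def closed_segment_same_Im closed_segment_eq_real_ivl)
        then have "norm (f (Complex (Re z) (Im z))) \<le> e" using n by (intro T) auto
        then show "norm (f z) \<le> e" by simp
      qed (use \<open>e > 0\<close> in auto)
      have 7: "norm (c2 - c1) = b - a" "norm (c4 - c3) = b - a"
        using \<open>a < b\<close> by (auto simp: c1_def c2_def c3_def c4_def cmod_def)
      have "\<i> * (V n - L) = - (contour_integral (linepath c1 c2) f + contour_integral (linepath c3 c4) f)"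
        using 1 2 3 4 by (simp add: V_def algebra_simps)
      then have "norm (V n - L) = norm (contour_integral (linepath c1 c2) f + contour_integral (linepath c3 c4) f)"
        by (metis norm_minus_cancel norm_mult norm_ii mult_1)
      also have "\<dots> \<le> e * (b - a) + e * (b - a)"
        using 5 6 7 norm_triangle_ineq[of "contour_integral (linepath c1 c2) f"] by (smt (verit))
      also have "e * (b - a) = r / 4" unfolding e_def by (rule nonzero_eq_divide_eq[THEN iffD1]) (use \<open>a < b\<close> in auto)
      also have "r / 4 + r / 4 < r" using \<open>r > 0\<close> by simp
      finally show "dist (V n) L < r" by (simp add: dist_norm)
    qed
  qed
  ultimately show ?thesis using LIMSEQ_unique unfolding L_def by blast
qed

text \<open>Dominating the integrand itself is enough: Cauchy's inequality turns a local bound on f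
  into one on its derivative, hence on the difference quotients, to which dominated convergence
  applies.\<close>

lemma holomorphic_on_lebesgue_integral:
  fixes f :: "complex \<Rightarrow> 'a \<Rightarrow> complex"
  assumes "open S"
    and meas: "\<And>z. z \<in> S \<Longrightarrow> f z \<in> borel_measurable M"
    and hol: "\<And>t. t \<in> space M \<Longrightarrow> (\<lambda>z. f z t) holomorphic_on S"
    and dom: "\<And>z. z \<in> S \<Longrightarrow> \<exists>r>0. \<exists>g. integrable M g \<and> (\<forall>z'\<in>ball z r \<inter> S. \<forall>t\<in>space M. norm (f z' t) \<le> g t)"
  shows "(\<lambda>z. \<integral>t. f z t \<partial>M) holomorphic_on S"
proof (subst holomorphic_on_open[OF \<open>open S\<close>], intro ballI)
  fix z assume "z \<in> S"
  then obtain r0 g where r0: "r0 > 0" and g: "integrable M g"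
    and le0: "\<And>z' t. z' \<in> ball z r0 \<inter> S \<Longrightarrow> t \<in> space M \<Longrightarrow> norm (f z' t) \<le> g t"
    using dom by meson
  obtain r1 where r1: "r1 > 0" "ball z r1 \<subseteq> S" using \<open>open S\<close> \<open>z \<in> S\<close> openE by blast
  define r where "r = min r0 r1"
  have r: "r > 0" "ball z r \<subseteq> S" using r0 r1 by (auto simp: r_def)
  have le: "norm (f z' t) \<le> g t" if "z' \<in> ball z r" "t \<in> space M" for z' t
    using le0 that r by (auto simp: r_def)
  \<comment> \<open>Circles of radius \<open>\<rho>\<close> around points of
    \<open>ball z \<rho>\<close> stay inside \<open>ball z r\<close>, where the bound g
    holds.\<close>
  define \<rho> where "\<rho> = r / 3"
  have \<rho>: "\<rho> > 0" using r by (simp add: \<rho>_def)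
  have int: "integrable M (f z')" if "z' \<in> ball z r" for z'
    by (rule Bochner_Integration.integrable_bound[OF g]) (use that le r meas in \<open>force+\<close>)
  have lip: "norm (f z' t - f z t) \<le> g t / \<rho> * norm (z' - z)" if z': "z' \<in> ball z \<rho>" and t: "t \<in> space M" for z' t
  proof (rule field_differentiable_bound[of "ball z \<rho>"])
    fix y assume y: "y \<in> ball z \<rho>"
    have sub: "cball y \<rho> \<subseteq> ball z r"
    proof
      fix u assume "u \<in> cball y \<rho>"
      then have "dist z u \<le> dist z y + dist y u" "dist y u \<le> \<rho>" by (auto intro: dist_triangle)
      then show "u \<in> ball z r" using y \<rho> by (simp add: \<rho>_def)
    qed
    have h: "(\<lambda>z. f z t) holomorphic_on cball y \<rho>"
      using hol[OF t] sub r by (meson holomorphic_on_subset subset_trans)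
    have "y \<in> ball z r" using y \<rho> by (simp add: \<rho>_def)
    then show "((\<lambda>z. f z t) has_field_derivative deriv (\<lambda>z. f z t) y) (at y within ball z \<rho>)"
      using hol[OF t] r \<open>open S\<close> by (metis holomorphic_derivI has_field_derivative_at_within subsetD)
    have "norm ((deriv ^^ 1) (\<lambda>z. f z t) y) \<le> fact 1 * g t / \<rho> ^ 1"
    proof (rule Cauchy_inequality)
      show "norm (f x t) \<le> g t" if "norm (y - x) = \<rho>" for x
        by (rule le) (use that sub t in \<open>auto simp: subset_iff dist_norm\<close>)
    qed (use h \<rho> holomorphic_on_imp_continuous_on in \<open>auto intro: holomorphic_on_subset\<close>)
    then show "norm (deriv (\<lambda>z. f z t) y) \<le> g t / \<rho>" by simp
  qed (use z' \<rho> in auto)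
  define G where "G = (\<lambda>z'. \<lambda>t. (f z' t - f z t) / (z' - z))"
  have "((\<lambda>z'. ((\<integral>t. f z' t \<partial>M) - (\<integral>t. f z t \<partial>M)) / (z' - z)) \<longlongrightarrow> (\<integral>t. deriv (\<lambda>z. f z t) z \<partial>M)) (at z within ball z \<rho>)"
    unfolding tendsto_at_iff_sequentially
  proof (intro allI impI)
    fix X assume X: "\<forall>i. X i \<in> ball z \<rho> - {z}" "X \<longlonglongrightarrow> z"
    have Xr: "X i \<in> ball z r" for i proof -
      have "X i \<in> ball z \<rho>" using X(1) by blast
      then show ?thesis using \<rho> by (simp add: \<rho>_def)
    qed
    have "(\<lambda>i. \<integral>t. G (X i) t \<partial>M) \<longlonglongrightarrow> (\<integral>t. deriv (\<lambda>z. f z t) z \<partial>M)"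
    proof (rule integral_dominated_convergence[where w = "\<lambda>t. g t / \<rho>"])
      show m: "G (X i) \<in> borel_measurable M" for i
        unfolding G_def using int[OF Xr[of i]] int[of z] r by (auto)
      have lim: "(\<lambda>i. G (X i) t) \<longlonglongrightarrow> deriv (\<lambda>z. f z t) z" if "t \<in> space M" for t
      proof -
        have "((\<lambda>z. f z t) has_field_derivative deriv (\<lambda>z. f z t) z) (at z)"
          by (rule holomorphic_derivI[OF hol[OF that] \<open>open S\<close> \<open>z \<in> S\<close>])
        then have "((\<lambda>y. (f y t - f z t) / (y - z)) \<longlongrightarrow> deriv (\<lambda>z. f z t) z) (at z)"
          by (simp add: has_field_derivative_iff)
        then show ?thesis using X unfolding tendsto_at_iff_sequentially
          by (auto simp: comp_def G_def)
      qed
      then show "AE t in M. (\<lambda>i. G (X i) t) \<longlonglongrightarrow> deriv (\<lambda>z. f z t) z" by simp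
      show "(\<lambda>t. deriv (\<lambda>z. f z t) z) \<in> borel_measurable M"
        by (rule borel_measurable_LIMSEQ_metric[OF m lim])
      show "AE t in M. norm (G (X i) t) \<le> g t / \<rho>" for i
      proof (rule AE_I2)
        fix t assume t: "t \<in> space M"
        have "norm (X i - z) > 0" using X by auto
        with lip[of "X i" t] X(1) t show "norm (G (X i) t) \<le> g t / \<rho>"
          by (simp add: G_def norm_divide pos_divide_le_eq)
      qed
    qed (use g in auto)
    moreover have "(\<integral>t. G (X i) t \<partial>M) = ((\<integral>t. f (X i) t \<partial>M) - (\<integral>t. f z t \<partial>M)) / (X i - z)" for i
      unfolding G_def using int[OF Xr[of i]] int[of z] r by simp
    ultimately show "((\<lambda>z'. ((\<integral>t. f z' t \<partial>M) - (\<integral>t. f z t \<partial>M)) / (z' - z)) \<circ> X) \<longlonglongrightarrow> (\<integral>t. deriv (\<lambda>z. f z t) z \<partial>M)"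
      by (simp add: comp_def)
  qed
  then have "((\<lambda>z'. \<integral>t. f z' t \<partial>M) has_field_derivative (\<integral>t. deriv (\<lambda>z. f z t) z \<partial>M)) (at z within ball z \<rho>)"
    by (simp add: has_field_derivative_iff)
  moreover have "at z within ball z \<rho> = at z" using \<rho> by (intro at_within_open) auto
  ultimately show "\<exists>f'. ((\<lambda>z. \<integral>t. f z t \<partial>M) has_field_derivative f') (at z)" by auto
qed

section \<open>Contour shifts for the Riemann--Siegel kernel\<close>

text \<open>
  The substitution \<open>x = kap z\<close> turns the lines of direction \<open>e\<^bsup>3\<pi>i/4\<^esup>\<close> into vertical lines and
  \<open>e\<^bsup>-\<pi>ix\<^sup>2\<^esup>\<close> into \<open>e\<^bsup>\<pi>z\<^sup>2\<^esup>\<close>. The vertical line \<open>Re z = a\<close> corresponds to the line in the \<open>x\<close>-plane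
  that crosses the real axis at \<open>sqrt 2 * a\<close>.
\<close>

definition kap :: complex where "kap = cis (pi / 4)"

text \<open>The denominator that conjugating \<open>R_integrand\<close> produces; its simple zeros
  at the integers are the source of all residues.\<close>

definition kern :: "complex \<Rightarrow> complex" where
  "kern x = exp (- (pi * \<i> * x)) - exp (pi * \<i> * x)"

text \<open>A contour integral in the x-plane, pulled back to the vertical line in the z-plane;
  \<open>kap * \<i>\<close> is dx/dt.\<close>

definition kint :: "(complex \<Rightarrow> complex) \<Rightarrow> real \<Rightarrow> complex" where
  "kint g a = (\<integral>t. g (Complex a t) / kern (kap * Complex a t) * (kap * \<i>) \<partial>lborel)"

lemma kap_eq: "kap = Complex (sqrt 2 / 2) (sqrt 2 / 2)"
  by (simp add: kap_def complex_eq_iff cos_45 sin_45)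

lemma kap_square: "kap\<^sup>2 = \<i>"
  by (simp add: kap_eq power2_eq_square complex_eq_iff)

lemma norm_kap [simp]: "norm kap = 1" by (simp add: kap_def)

lemma kap_nonzero [simp]: "kap \<noteq> 0" by (simp add: kap_def)

lemma Re_kap_mult: "Re (kap * z) = (Re z - Im z) / sqrt 2"
  and Im_kap_mult: "Im (kap * z) = (Re z + Im z) / sqrt 2"
  by (simp_all add: kap_eq field_simps)

lemma kap_mult_not_nonpos: "Re z > 0 \<Longrightarrow> kap * z \<notin> \<real>\<^sub>\<le>\<^sub>0"
  unfolding complex_nonpos_Reals_iff Re_kap_mult Im_kap_mult by (auto simp: field_simps)

section \<open>Zeros of the kernel and lower bounds for it\<close>

lemma kern_sin: "kern x = - 2 * \<i> * sin (of_real pi * x)"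
  by (simp add: kern_def sin_exp_eq field_simps)

lemma kern_eq_0_iff: "kern x = 0 \<longleftrightarrow> x \<in> \<int>"
proof -
  have "kern x = 0 \<longleftrightarrow> (\<exists>n::int. of_real pi * x = of_real (n * pi))"
    by (simp add: kern_sin sin_eq_0)
  also have "\<dots> \<longleftrightarrow> (\<exists>n::int. x = of_int n)"
    by (intro ex_cong1) auto
  also have "\<dots> \<longleftrightarrow> x \<in> \<int>" by (auto simp: Ints_def)
  finally show ?thesis .
qed

lemma kern_holomorphic [holomorphic_intros]:
  "f holomorphic_on A \<Longrightarrow> (\<lambda>z. kern (f z)) holomorphic_on A"
  unfolding kern_def by (intro holomorphic_intros)

lemma kern_measurable [measurable]: "kern \<in> borel_measurable borel"
  unfolding kern_def by measurable

lemma norm_kern_square: "(norm (kern x))\<^sup>2 = 4 * ((sin (pi * Re x))\<^sup>2 + (sinh (pi * Im x))\<^sup>2)"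
proof -
  have "(norm (kern x))\<^sup>2 = 4 * (norm (sin (of_real pi * x)))\<^sup>2"
    by (simp add: kern_sin norm_mult power_mult_distrib)
  also have "\<dots> = exp (2 * (pi * Im x)) + inverse (exp (2 * (pi * Im x))) - 2 * cos (2 * (pi * Re x))"
    by (simp add: norm_sin_squared)
  also have "\<dots> = 4 * ((sin (pi * Re x))\<^sup>2 + (sinh (pi * Im x))\<^sup>2)"
    unfolding cos_double_sin sinh_def
    by (simp add: power2_eq_square exp_minus field_simps exp_add[symmetric])
  finally show ?thesis .
qed

lemma abs_le_abs_sinh: "\<bar>x\<bar> \<le> \<bar>sinh x\<bar>" for x :: real
  using real_le_abs_sinh[of x] by (simp add: sinh_field_def exp_minus)

lemma norm_kern_ge_Im: "norm (kern x) \<ge> 2 * pi * \<bar>Im x\<bar>"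
proof -
  have "(2 * pi * \<bar>Im x\<bar>)\<^sup>2 \<le> (norm (kern x))\<^sup>2"
  proof -
    have "(pi * Im x)\<^sup>2 \<le> (sinh (pi * Im x))\<^sup>2"
      using abs_le_abs_sinh[of "pi * Im x"] by (simp add: abs_le_square_iff)
    moreover have "0 \<le> (sin (pi * Re x))\<^sup>2" by simp
    ultimately have "4 * (pi * Im x)\<^sup>2 \<le> 4 * ((sin (pi * Re x))\<^sup>2 + (sinh (pi * Im x))\<^sup>2)"
      by (intro mult_left_mono add_increasing) auto
    then show ?thesis unfolding norm_kern_square by (simp add: power_mult_distrib)
  qed
  then show ?thesis by (rule power2_le_imp_le) simp
qed

text \<open>Re x + Im x is constant along the lines of integration, so this bound is uniform on such
  a line. It comes from |sin(u + v)| <= |sin u| + |sinh v| and (p + q)^2 <= 2(p^2 + q^2).\<close>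

lemma norm_kern_ge_sin: "norm (kern x) \<ge> sqrt 2 * \<bar>sin (pi * (Re x + Im x))\<bar>"
proof -
  define p where "p = \<bar>sin (pi * Re x)\<bar>"
  define q where "q = \<bar>sinh (pi * Im x)\<bar>"
  have "\<bar>sin (pi * (Re x + Im x))\<bar> \<le> \<bar>sin (pi * Re x) * cos (pi * Im x)\<bar> + \<bar>cos (pi * Re x) * sin (pi * Im x)\<bar>"
    unfolding distrib_left sin_add by (rule abs_triangle_ineq)
  also have "\<dots> \<le> p * 1 + 1 * q"
    unfolding abs_mult p_def q_def
    using abs_sin_x_le_abs_x[of "pi * Im x"] abs_le_abs_sinh[of "pi * Im x"]
    by (intro add_mono mult_mono) auto
  finally have le: "\<bar>sin (pi * (Re x + Im x))\<bar> \<le> p + q" by simp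
  have "(sqrt 2 * \<bar>sin (pi * (Re x + Im x))\<bar>)\<^sup>2 \<le> 2 * (p + q)\<^sup>2"
    using le by (simp add: power_mult_distrib abs_le_square_iff[symmetric] del: power2_abs)
  also have "\<dots> \<le> 4 * (p\<^sup>2 + q\<^sup>2)"
    using sum_squares_ge_zero[of "p - q" 0] by (simp add: power2_eq_square algebra_simps)
  also have "\<dots> = (norm (kern x))\<^sup>2" by (simp add: norm_kern_square p_def q_def)
  finally show ?thesis by (rule power2_le_imp_le) simp
qed

lemma norm_kern_line: "norm (kern (kap * Complex a t)) \<ge> sqrt 2 * \<bar>sin (pi * (sqrt 2 * a))\<bar>"
proof -
  have "Re (kap * Complex a t) + Im (kap * Complex a t) = 2 * a / sqrt 2"
    by (simp only: Re_kap_mult Im_kap_mult) (simp add: field_simps)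
  also have "\<dots> = sqrt 2 * a" by (simp add: field_simps)
  finally show ?thesis using norm_kern_ge_sin[of "kap * Complex a t"] by simp
qed

lemma sin_pi_eq_0_iff: "sin (pi * x) = 0 \<longleftrightarrow> x \<in> \<int>" for x :: real
  using sin_times_pi_eq_0[of x] by (simp add: mult.commute)

lemma between_0_1_not_Ints:
  fixes x :: real
  assumes "0 < x" "x < 1" shows "x \<notin> \<int>"
proof
  assume "x \<in> \<int>"
  then obtain k :: int where "x = of_int k" by (rule Ints_cases)
  then show False using assms by simp
qed

section \<open>Gaussian domination on strips\<close>

lemma integrable_gaussian_abs:
  assumes "c > 0"
  shows "integrable lborel (\<lambda>t::real. exp (b * \<bar>t\<bar> - c * t\<^sup>2))"
proof (rule Bochner_Integration.integrable_bound)
  \<comment> \<open>With this variance the normal density is a multiple of exp(-c t^2/2): half of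
    the quadratic term is spent on absorbing the linear one by completing the square.\<close>
  define \<sigma> where "\<sigma> = 1 / sqrt c"
  have \<sigma>: "\<sigma> > 0" "\<sigma>\<^sup>2 = 1 / c" using assms by (auto simp: \<sigma>_def power_divide)
  show "integrable lborel (\<lambda>t. (exp (b\<^sup>2 / (2 * c)) * sqrt (2 * pi * \<sigma>\<^sup>2)) * normal_density 0 \<sigma> t)"
    using \<sigma> by (intro integrable_mult_right integrable_normal_density)
  show "AE t in lborel. norm (exp (b * \<bar>t\<bar> - c * t\<^sup>2))
          \<le> norm ((exp (b\<^sup>2 / (2 * c)) * sqrt (2 * pi * \<sigma>\<^sup>2)) * normal_density 0 \<sigma> t)"
  proof (rule AE_I2)
    fix t :: real
    have "0 \<le> (b - c * \<bar>t\<bar>)\<^sup>2" by simp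
    then have "2 * b * c * \<bar>t\<bar> \<le> b\<^sup>2 + c\<^sup>2 * t\<^sup>2" by (simp add: power2_eq_square algebra_simps)
    then have "b * \<bar>t\<bar> - c * t\<^sup>2 \<le> b\<^sup>2 / (2 * c) + - (t\<^sup>2 * c / 2)"
      using assms by (simp add: field_simps power2_eq_square)
    then have "exp (b * \<bar>t\<bar> - c * t\<^sup>2) \<le> exp (b\<^sup>2 / (2 * c)) * exp (- (t\<^sup>2 * c / 2))"
      by (simp flip: exp_add)
    also have "exp (b\<^sup>2 / (2 * c)) * exp (- (t\<^sup>2 * c / 2)) =
       (exp (b\<^sup>2 / (2 * c)) * sqrt (2 * pi * \<sigma>\<^sup>2)) * normal_density 0 \<sigma> t"
      using assms \<sigma> by (simp add: normal_density_def)
    finally show "norm (exp (b * \<bar>t\<bar> - c * t\<^sup>2))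
          \<le> norm ((exp (b\<^sup>2 / (2 * c)) * sqrt (2 * pi * \<sigma>\<^sup>2)) * normal_density 0 \<sigma> t)"
      by simp
  qed
qed measurable

text \<open>The integrands decay like exp(-pi t^2); the coefficient 1 is weaker and simpler. The
  term \<open>B * \<bar>t\<bar>\<close> accommodates linear exponentials as well as the power
  x^(-w).\<close>

definition gaussian_on :: "(complex \<Rightarrow> complex) \<Rightarrow> real \<Rightarrow> real \<Rightarrow> bool" where
  "gaussian_on g a b \<longleftrightarrow> (\<exists>C B. \<forall>x t. a \<le> x \<longrightarrow> x \<le> b \<longrightarrow> norm (g (Complex x t)) \<le> C * exp (B * \<bar>t\<bar> - t\<^sup>2))"

lemma gaussian_on_subinterval:
  "gaussian_on g a b \<Longrightarrow> a \<le> a' \<Longrightarrow> b' \<le> b \<Longrightarrow> gaussian_on g a' b'"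
  unfolding gaussian_on_def by (meson order_trans)

lemma gaussian_tail:
  fixes B C e :: real
  assumes "e > 0"
  obtains T where "\<And>t. T \<le> \<bar>t\<bar> \<Longrightarrow> C * exp (B * \<bar>t\<bar> - t\<^sup>2) \<le> e"
proof
  fix t :: real
  assume T: "max (B + 1) (\<bar>C\<bar> / e) \<le> \<bar>t\<bar>"
  have "(B + 1) * \<bar>t\<bar> \<le> \<bar>t\<bar> * \<bar>t\<bar>" using T by (intro mult_right_mono) auto
  then have "B * \<bar>t\<bar> - t\<^sup>2 \<le> - \<bar>t\<bar>" by (simp add: power2_eq_square algebra_simps)
  then have "C * exp (B * \<bar>t\<bar> - t\<^sup>2) \<le> \<bar>C\<bar> * exp (- \<bar>t\<bar>)"
    by (intro mult_mono) auto
  also have "\<bar>C\<bar> * exp (- \<bar>t\<bar>) \<le> (e * exp \<bar>t\<bar>) * exp (- \<bar>t\<bar>)"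
  proof (rule mult_right_mono)
    have "\<bar>C\<bar> \<le> e * \<bar>t\<bar>" using T assms by (simp add: pos_divide_le_eq mult.commute)
    also have "e * \<bar>t\<bar> \<le> e * exp \<bar>t\<bar>"
      using assms exp_ge_add_one_self[of "\<bar>t\<bar>"] by (intro mult_left_mono) linarith+
    finally show "\<bar>C\<bar> \<le> e * exp \<bar>t\<bar>" .
  qed simp
  also have "\<dots> = e" by (simp add: mult.assoc flip: exp_add)
  finally show "C * exp (B * \<bar>t\<bar> - t\<^sup>2) \<le> e" .
qed

lemma continuous_Complex_right [continuous_intros]: "continuous_on A (\<lambda>t. Complex x t)"
  by (simp add: Complex_eq) (intro continuous_intros)

lemma Complex_measurable [measurable]: "(\<lambda>t. Complex x t) \<in> borel_measurable borel"
  by (intro borel_measurable_continuous_onI continuous_intros)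

lemma gaussian_on_integrable:
  fixes h :: "complex \<Rightarrow> complex"
  assumes "gaussian_on g a a" "(\<lambda>t. h (Complex a t)) \<in> borel_measurable borel"
    and "\<And>t. norm (h (Complex a t)) \<le> K * norm (g (Complex a t))" "K \<ge> 0"
  shows "integrable lborel (\<lambda>t. h (Complex a t))"
proof -
  obtain C B where CB: "\<And>t. norm (g (Complex a t)) \<le> C * exp (B * \<bar>t\<bar> - t\<^sup>2)"
    using assms(1) unfolding gaussian_on_def by blast
  show ?thesis
  proof (rule Bochner_Integration.integrable_bound)
    show "integrable lborel (\<lambda>t. K * (C * exp (B * \<bar>t\<bar> - 1 * t\<^sup>2)))"
      by (intro integrable_mult_right integrable_gaussian_abs) auto
    show "AE t in lborel. norm (h (Complex a t)) \<le> norm (K * (C * exp (B * \<bar>t\<bar> - 1 * t\<^sup>2)))"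
    proof (rule AE_I2)
      fix t
      have "norm (h (Complex a t)) \<le> K * norm (g (Complex a t))" by (rule assms)
      also have "\<dots> \<le> K * (C * exp (B * \<bar>t\<bar> - t\<^sup>2))" using assms by (intro mult_left_mono CB) auto
      finally show "norm (h (Complex a t)) \<le> norm (K * (C * exp (B * \<bar>t\<bar> - 1 * t\<^sup>2)))" by simp
    qed
  qed (use assms(2) in simp)
qed

text \<open>Since f may have poles inside the strip, it is compared with the pole-free g only on the
  two edges and for large |t|.\<close>

lemma gaussian_strip_residue:
  assumes S: "open S" "connected S" "{z. a \<le> Re z \<and> Re z \<le> b} \<subseteq> S"
    and pts: "finite pts" "\<And>p. p \<in> pts \<Longrightarrow> a < Re p \<and> Re p < b"
    and f: "f holomorphic_on S - pts" and "a < b"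
    and gauss: "gaussian_on g a b"
    and bound: "\<And>t. norm (f (Complex a t)) \<le> K * norm (g (Complex a t))"
      "\<And>t. norm (f (Complex b t)) \<le> K * norm (g (Complex b t))"
      "\<And>x t. a \<le> x \<Longrightarrow> x \<le> b \<Longrightarrow> T \<le> \<bar>t\<bar> \<Longrightarrow> norm (f (Complex x t)) \<le> K * norm (g (Complex x t))"
    and "K \<ge> 0"
  shows "(\<integral>t. f (Complex b t) \<partial>lborel) - (\<integral>t. f (Complex a t) \<partial>lborel)
           = 2 * pi * (\<Sum>p\<in>pts. residue f p)"
proof (rule strip_residue[OF S pts f \<open>a < b\<close>])
  have cont: "continuous_on UNIV (\<lambda>t. f (Complex x t))" if "x = a \<or> x = b" for x
  proof -
    have "Complex x t \<in> S - pts" for t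
      using that S(3) \<open>a < b\<close> pts(2)[of "Complex x t"] by (auto simp: subset_iff)
    then show ?thesis
      by (intro continuous_on_compose2[OF holomorphic_on_imp_continuous_on[OF f]] continuous_intros) auto
  qed
  then have meas: "(\<lambda>t. f (Complex x t)) \<in> borel_measurable borel" if "x = a \<or> x = b" for x
    using that by (intro borel_measurable_continuous_onI) auto
  show "integrable lborel (\<lambda>t. f (Complex a t))"
    by (rule gaussian_on_integrable[where g = g and K = K])
       (use gauss \<open>a < b\<close> meas bound \<open>K \<ge> 0\<close> in \<open>auto intro: gaussian_on_subinterval\<close>)
  show "integrable lborel (\<lambda>t. f (Complex b t))"
    by (rule gaussian_on_integrable[where g = g and K = K])
       (use gauss \<open>a < b\<close> meas bound \<open>K \<ge> 0\<close> in \<open>auto intro: gaussian_on_subinterval\<close>)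
  fix e :: real assume "e > 0"
  obtain C B where CB: "\<And>x t. a \<le> x \<Longrightarrow> x \<le> b \<Longrightarrow> norm (g (Complex x t)) \<le> C * exp (B * \<bar>t\<bar> - t\<^sup>2)"
    using gauss unfolding gaussian_on_def by blast
  obtain T' where T': "\<And>t. T' \<le> \<bar>t\<bar> \<Longrightarrow> (K * C) * exp (B * \<bar>t\<bar> - t\<^sup>2) \<le> e"
    using gaussian_tail[OF \<open>e > 0\<close>] by metis
  show "\<exists>T. \<forall>x t. T \<le> \<bar>t\<bar> \<longrightarrow> a \<le> x \<longrightarrow> x \<le> b \<longrightarrow> norm (f (Complex x t)) \<le> e"
  proof (intro exI allI impI)
    fix x t assume t: "max T T' \<le> \<bar>t\<bar>" and x: "a \<le> x" "x \<le> b"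
    have "norm (f (Complex x t)) \<le> K * norm (g (Complex x t))" using bound(3) t x by auto
    also have "\<dots> \<le> K * (C * exp (B * \<bar>t\<bar> - t\<^sup>2))" using CB x \<open>K \<ge> 0\<close> by (intro mult_left_mono) auto
    also have "\<dots> \<le> e" using T'[of t] t by (simp add: mult.assoc)
    finally show "norm (f (Complex x t)) \<le> e" .
  qed
qed

text \<open>The pole is simple, and \<open>kern (kap * z)\<close> has derivative -2 pi i kap (-1)^n
  there. The factor \<open>kap * \<i>\<close> cancels against it, leaving -1/(2 pi), which in turn
  cancels the 2 pi of the strip formula.\<close>

lemma residue_div_kern:
  assumes "open S" "of_nat n / kap \<in> S" "g holomorphic_on S"
    and "\<And>z. z \<in> S \<Longrightarrow> kap * z \<in> \<int> \<Longrightarrow> z = of_nat n / kap"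
  shows "residue (\<lambda>z. g z / kern (kap * z) * (kap * \<i>)) (of_nat n / kap)
           = - ((-1) ^ n * g (of_nat n / kap)) / (2 * pi)"
proof (rule residue_simple'[OF assms(1,2)])
  define p where "p = of_nat n / kap"
  show "(\<lambda>z. g z / kern (kap * z) * (kap * \<i>)) holomorphic_on S - {of_nat n / kap}"
    using assms(3,4) by (intro holomorphic_intros) (auto simp: kern_eq_0_iff intro: holomorphic_on_subset)
  have kp: "kap * p = of_nat n" by (simp add: p_def)
  have e: "exp (\<i> * (of_real pi * of_nat n)) = (-1) ^ n" "exp (- (\<i> * (of_real pi * of_nat n))) = (-1) ^ n"
  proof -
    have "exp (\<i> * (of_real pi * of_nat n)) = exp (\<i> * of_real pi) ^ n"
      using exp_of_nat_mult[of n "\<i> * of_real pi"] by (simp add: mult_ac)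
    then show 1: "exp (\<i> * (of_real pi * of_nat n)) = (-1) ^ n" by simp
    then show "exp (- (\<i> * (of_real pi * of_nat n))) = (-1) ^ n" by (simp add: exp_minus flip: power_inverse)
  qed
  have "((\<lambda>z. kern (kap * z)) has_field_derivative
      (exp (- (pi * \<i> * (kap * p))) * (- (pi * \<i> * kap)) - exp (pi * \<i> * (kap * p)) * (pi * \<i> * kap))) (at p)"
    unfolding kern_def by (auto intro!: derivative_eq_intros)
  also have "exp (- (pi * \<i> * (kap * p))) * (- (pi * \<i> * kap)) - exp (pi * \<i> * (kap * p)) * (pi * \<i> * kap)
       = - 2 * pi * \<i> * kap * (-1) ^ n" unfolding kp using e by (simp add: algebra_simps)
  finally have "((\<lambda>z. (kern (kap * z) - kern (kap * p)) / (z - p)) \<longlongrightarrow> - 2 * pi * \<i> * kap * (-1) ^ n) (at p)"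
    by (simp add: has_field_derivative_iff)
  moreover have "kern (kap * p) = 0" by (simp add: kp kern_eq_0_iff)
  ultimately have "((\<lambda>z. kern (kap * z) / (z - p)) \<longlongrightarrow> - 2 * pi * \<i> * kap * (-1) ^ n) (at p)" by simp
  moreover have "(g \<longlongrightarrow> g p) (at p)"
    using assms(1-3) continuous_on_eq_continuous_at holomorphic_on_imp_continuous_on isContD p_def by blast
  ultimately have "((\<lambda>z. g z * (kap * \<i>) / (kern (kap * z) / (z - p))) \<longlongrightarrow>
       g p * (kap * \<i>) / (- 2 * pi * \<i> * kap * (-1) ^ n)) (at p)"
    by (intro tendsto_intros) auto
  also have "g p * (kap * \<i>) / (- 2 * pi * \<i> * kap * (-1) ^ n) = - ((-1) ^ n * g p) / (2 * pi)"
    by (simp add: field_simps minus_one_mult_self)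
  finally show "((\<lambda>w. g w / kern (kap * w) * (kap * \<i>) * (w - of_nat n / kap)) \<longlongrightarrow>
     - ((-1) ^ n * g (of_nat n / kap)) / (2 * pi)) (at (of_nat n / kap))"
    by (simp add: p_def mult_ac)
qed

lemma kern_line_nonzero:
  assumes "sqrt 2 * a \<notin> \<int>" shows "\<bar>sin (pi * (sqrt 2 * a))\<bar> > 0"
  using assms by (simp add: sin_pi_eq_0_iff)

lemma kern_line_bound:
  assumes "sqrt 2 * a \<notin> \<int>"
  shows "norm (u / kern (kap * Complex a t) * (kap * \<i>)) \<le> 1 / \<bar>sin (pi * (sqrt 2 * a))\<bar> * norm u"
proof -
  have 0: "\<bar>sin (pi * (sqrt 2 * a))\<bar> > 0" using kern_line_nonzero[OF assms] .
  have "1 * \<bar>sin (pi * (sqrt 2 * a))\<bar> \<le> sqrt 2 * \<bar>sin (pi * (sqrt 2 * a))\<bar>"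
    by (intro mult_right_mono) auto
  then have le: "\<bar>sin (pi * (sqrt 2 * a))\<bar> \<le> norm (kern (kap * Complex a t))"
    using norm_kern_line[of a t] by simp
  have "norm (u / kern (kap * Complex a t) * (kap * \<i>)) = norm u / norm (kern (kap * Complex a t))"
    by (simp add: norm_mult norm_divide)
  also have "\<dots> \<le> norm u / \<bar>sin (pi * (sqrt 2 * a))\<bar>" using 0 le by (intro divide_left_mono mult_pos_pos) (rule norm_ge_zero | linarith)+
  finally show ?thesis by simp
qed

lemma kint_integrable:
  assumes "0 < a" "sqrt 2 * a \<notin> \<int>" "g holomorphic_on {z. Re z > 0}" "gaussian_on g a a"
  shows "integrable lborel (\<lambda>t. g (Complex a t) / kern (kap * Complex a t) * (kap * \<i>))"
proof (rule gaussian_on_integrable[OF assms(4)])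
  have "continuous_on UNIV (\<lambda>t. g (Complex a t))"
    by (rule continuous_on_compose2[OF holomorphic_on_imp_continuous_on[OF assms(3)]])
       (use assms(1) in \<open>auto intro!: continuous_intros\<close>)
  then have [measurable]: "(\<lambda>t. g (Complex a t)) \<in> borel_measurable borel"
    by (intro borel_measurable_continuous_onI)
  show "(\<lambda>t. g (Complex a t) / kern (kap * Complex a t) * (kap * \<i>)) \<in> borel_measurable borel"
    by measurable
  show "norm (g (Complex a t) / kern (kap * Complex a t) * (kap * \<i>))
      \<le> 1 / \<bar>sin (pi * (sqrt 2 * a))\<bar> * norm (g (Complex a t))" for t
    by (rule kern_line_bound[OF assms(2)])
qed simp

lemma kint_shift:
  assumes ab: "0 < a" "a < b" and nonint: "sqrt 2 * a \<notin> \<int>" "sqrt 2 * b \<notin> \<int>"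
    and g: "g holomorphic_on {z. Re z > 0}" and gauss: "gaussian_on g a b"
  shows "kint g b - kint g a = - (\<Sum>n | sqrt 2 * a < real n \<and> real n < sqrt 2 * b. (-1) ^ n * g (of_nat n / kap))"
proof -
  define N where "N = {n. sqrt 2 * a < real n \<and> real n < sqrt 2 * b}"
  define f where "f z = g z / kern (kap * z) * (kap * \<i>)" for z
  \<comment> \<open>The strip is widened up to the next integers on both sides: an open
    neighbourhood that gains no pole and, the floor being nonnegative, stays in the right
    half-plane.\<close>
  define S where "S = {z. Re z > of_int \<lfloor>sqrt 2 * a\<rfloor> / sqrt 2} \<inter> {z. Re z < of_int \<lceil>sqrt 2 * b\<rceil> / sqrt 2}"
  define pts where "pts = (\<lambda>n. of_nat n / kap) ` N"
  have "finite N"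
  proof (rule finite_subset)
    show "N \<subseteq> {..nat \<lceil>sqrt 2 * b\<rceil>}" unfolding N_def by (auto simp: le_nat_iff) linarith
  qed auto
  then have "finite pts" by (simp add: pts_def)
  have Re_pole: "Re (of_int n / kap) = of_int n / sqrt 2" for n
    by (simp add: kap_eq Re_divide power2_eq_square field_simps)
  have "open S" unfolding S_def by (intro open_Int open_halfspace_Re_gt open_halfspace_Re_lt)
  have "connected S" unfolding S_def
    by (intro convex_connected convex_Int convex_halfspace_Re_gt convex_halfspace_Re_lt)
  have Spos: "Re z > 0" if "z \<in> S" for z
  proof -
    have "of_int \<lfloor>sqrt 2 * a\<rfloor> / sqrt 2 \<ge> (0::real)" using ab by auto
    then show ?thesis using that unfolding S_def by (auto simp del: zero_le_divide_iff)
  qed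
  have stripS: "{z. a \<le> Re z \<and> Re z \<le> b} \<subseteq> S"
  proof -
    have "of_int \<lfloor>sqrt 2 * a\<rfloor> < sqrt 2 * a"
      using nonint(1) by (metis Ints_of_int less_eq_real_def of_int_floor_le)
    moreover have "sqrt 2 * b < of_int \<lceil>sqrt 2 * b\<rceil>"
      using nonint(2) by (metis Ints_of_int less_eq_real_def le_of_int_ceiling)
    ultimately have "of_int \<lfloor>sqrt 2 * a\<rfloor> / sqrt 2 < a" "b < of_int \<lceil>sqrt 2 * b\<rceil> / sqrt 2"
      by (auto simp: field_simps)
    then show ?thesis unfolding S_def by auto
  qed
  have poles: "z \<in> pts" if z: "z \<in> S" "kap * z \<in> \<int>" for z
  proof -
    obtain k where k: "kap * z = of_int k" using z(2) by (auto elim: Ints_cases)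
    then have zk: "z = of_int k / kap" by (simp add: field_simps)
    then have "of_int \<lfloor>sqrt 2 * a\<rfloor> < (of_int k :: real)" "(of_int k :: real) < of_int \<lceil>sqrt 2 * b\<rceil>"
      using z(1) Re_pole[of k, folded zk] by (auto simp: S_def field_simps)
    then have k2: "sqrt 2 * a < k" "k < sqrt 2 * b" by (auto simp: floor_less_iff less_ceiling_iff)
    moreover have "k > 0"
    proof -
      have "0 < sqrt 2 * a" using ab by simp
      then have "0 < real_of_int k" using k2 by linarith
      then show ?thesis by simp
    qed
    ultimately have "nat k \<in> N" by (auto simp: N_def)
    then have "of_nat (nat k) / kap \<in> pts" by (auto simp: pts_def)
    then show ?thesis using zk \<open>k > 0\<close> by simp
  qed
  have pole_in: "of_nat n / kap \<in> S" "a < Re (of_nat n / kap)" "Re (of_nat n / kap) < b" if "n \<in> N" for n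
  proof -
    have Re: "Re (of_nat n / kap) = real n / sqrt 2" using Re_pole[of "int n"] by simp
    show 1: "a < Re (of_nat n / kap)" "Re (of_nat n / kap) < b"
      unfolding Re using that by (auto simp: N_def field_simps)
    then show "of_nat n / kap \<in> S" using stripS by (auto simp: subset_iff)
  qed
  \<comment> \<open>One constant for all three bounds: the summands serve the far part of the strip,
    the left edge and the right edge.\<close>
  define M where "M = 1 + 1 / \<bar>sin (pi * (sqrt 2 * a))\<bar> + 1 / \<bar>sin (pi * (sqrt 2 * b))\<bar>"
  have "kint g b - kint g a = 2 * pi * (\<Sum>p\<in>pts. residue f p)"
    unfolding kint_def f_def[symmetric]
  proof -
    have fb: "norm (f (Complex x t)) \<le> M * norm (g (Complex x t))" if "x = a \<or> x = b" for x t
    proof -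
      have "norm (f (Complex x t)) \<le> 1 / \<bar>sin (pi * (sqrt 2 * x))\<bar> * norm (g (Complex x t))"
        unfolding f_def using that nonint by (intro kern_line_bound) auto
      also have "\<dots> \<le> M * norm (g (Complex x t))"
        using that by (intro mult_right_mono) (auto simp: M_def)
      finally show ?thesis .
    qed
    have "(\<integral>t. f (Complex b t) \<partial>lborel) - (\<integral>t. f (Complex a t) \<partial>lborel) = 2 * pi * (\<Sum>p\<in>pts. residue f p)"
    proof (rule gaussian_strip_residue[OF \<open>open S\<close> \<open>connected S\<close> stripS \<open>finite pts\<close> _ _ \<open>a < b\<close> gauss, where K = M and T = "b + 1"])
      show "f holomorphic_on S - pts" unfolding f_def
        using g poles Spos by (intro holomorphic_intros) (auto simp: kern_eq_0_iff intro: holomorphic_on_subset)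
      fix x t assume x: "a \<le> x" "x \<le> b" and t: "b + 1 \<le> \<bar>t\<bar>"
      \<comment> \<open>The threshold \<open>b + 1\<close> keeps the imaginary part of
        \<open>kap * Complex x t\<close> at least 1/sqrt 2 in absolute value, far enough from the
        real axis for the kernel to exceed 1.\<close>
      have "1 \<le> \<bar>x + t\<bar>" using x t ab by linarith
      have "1 \<le> 2 * pi * (1 / sqrt 2)" using pi_ge_two real_sqrt_le_mono[of 2 4] by (simp add: field_simps)
      also have "\<dots> \<le> 2 * pi * (\<bar>x + t\<bar> / sqrt 2)"
        using \<open>1 \<le> \<bar>x + t\<bar>\<close> by (intro mult_left_mono divide_right_mono) auto
      also have "\<dots> = 2 * pi * \<bar>Im (kap * Complex x t)\<bar>"
        by (simp only: Im_kap_mult) simp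
      also have "\<dots> \<le> norm (kern (kap * Complex x t))" by (rule norm_kern_ge_Im)
      finally have "1 \<le> norm (kern (kap * Complex x t))" .
      then have "norm (f (Complex x t)) \<le> 1 * norm (g (Complex x t))"
        unfolding f_def by (simp add: norm_mult norm_divide) (simp add: divide_le_eq mult_le_cancel_left1 mult_le_cancel_left2)
      also have "\<dots> \<le> M * norm (g (Complex x t))" by (intro mult_right_mono) (auto simp: M_def)
      finally show "norm (f (Complex x t)) \<le> M * norm (g (Complex x t))" .
    qed (use fb pole_in in \<open>auto simp: pts_def M_def\<close>)
    then show "(\<integral>t. f (Complex b t) \<partial>lborel) - (\<integral>t. f (Complex a t) \<partial>lborel) = 2 * pi * (\<Sum>p\<in>pts. residue f p)" .
  qed
  also have "(\<Sum>p\<in>pts. residue f p) = (\<Sum>n\<in>N. residue f (of_nat n / kap))"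
    unfolding pts_def by (subst sum.reindex) (auto simp: inj_on_def)
  also have "\<dots> = (\<Sum>n\<in>N. - ((-1) ^ n * g (of_nat n / kap)) / (2 * pi))"
  proof (intro sum.cong refl)
    fix n assume n: "n \<in> N"
    define p where "p = of_nat n / kap"
    show "residue f (of_nat n / kap) = - ((-1) ^ n * g (of_nat n / kap)) / (2 * pi)"
      unfolding f_def
    \<comment> \<open>Deleting the other poles isolates p in an open set.\<close>
    proof (rule residue_div_kern[where S = "S - (pts - {p})"])
      show "open (S - (pts - {p}))"
        using \<open>open S\<close> \<open>finite pts\<close> by (intro open_Diff finite_imp_closed) auto
      show "g holomorphic_on S - (pts - {p})" using g Spos by (auto intro: holomorphic_on_subset)
    qed (use n pole_in poles in \<open>auto simp: p_def\<close>)
  qed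
  also have "2 * pi * \<dots> = - (\<Sum>n\<in>N. (-1) ^ n * g (of_nat n / kap))"
    by (simp add: sum_negf flip: sum_divide_distrib)
  finally show ?thesis by (simp add: N_def)
qed

lemma kern_line_neq_0:
  assumes "sqrt 2 * a \<notin> \<int>" shows "kern (kap * Complex a t) \<noteq> 0"
proof -
  have "0 < sqrt 2 * \<bar>sin (pi * (sqrt 2 * a))\<bar>" using kern_line_nonzero[OF assms] by simp
  then have "0 < norm (kern (kap * Complex a t))" using norm_kern_line[of a t] by linarith
  then show ?thesis by simp
qed

section \<open>The Mordell integral\<close>

lemma norm_exp_gauss: "norm (exp (pi * (Complex x t)\<^sup>2)) = exp (pi * (x\<^sup>2 - t\<^sup>2))"
  by (simp add: norm_exp_eq_Re power2_eq_square algebra_simps)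

text \<open>There are no poles, so the line can be moved to the imaginary axis, where the integrand
  is the normal density of variance 1/(2 pi).\<close>

lemma gaussian_line_integral: "(\<integral>t. exp (pi * (Complex a t)\<^sup>2) \<partial>lborel) = 1"
proof -
  define F where "F = (\<lambda>a. \<integral>t. exp (pi * (Complex a t)\<^sup>2) \<partial>lborel)"
  have step: "F y - F x = 0" if "x < y" for x y
  proof -
    have "F y - F x = 2 * pi * (\<Sum>p\<in>{}. residue (\<lambda>z. exp (of_real pi * z\<^sup>2)) p)"
      unfolding F_def
    proof (rule gaussian_strip_residue[where S = UNIV and g = "\<lambda>z. exp (of_real pi * z\<^sup>2)" and K = 1])
      show "gaussian_on (\<lambda>z. exp (of_real pi * z\<^sup>2)) x y" unfolding gaussian_on_def
      proof (intro exI allI impI)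
        fix u t assume u: "x \<le> u" "u \<le> y"
        have "u\<^sup>2 \<le> (\<bar>x\<bar> + \<bar>y\<bar>)\<^sup>2" using u by (intro abs_le_square_iff[THEN iffD1]) auto
        moreover have "t\<^sup>2 \<le> pi * t\<^sup>2" using pi_ge_two by (simp add: mult_le_cancel_right1)
        ultimately have "pi * u\<^sup>2 \<le> pi * (\<bar>x\<bar> + \<bar>y\<bar>)\<^sup>2" "t\<^sup>2 \<le> pi * t\<^sup>2"
          by (auto intro: mult_left_mono)
        then have "pi * (u\<^sup>2 - t\<^sup>2) \<le> pi * (\<bar>x\<bar> + \<bar>y\<bar>)\<^sup>2 + (0 * \<bar>t\<bar> - t\<^sup>2)"
          unfolding right_diff_distrib by linarith
        then show "norm (exp (pi * (Complex u t)\<^sup>2)) \<le> exp (pi * (\<bar>x\<bar> + \<bar>y\<bar>)\<^sup>2) * exp (0 * \<bar>t\<bar> - t\<^sup>2)"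
          unfolding norm_exp_gauss exp_add[symmetric] by simp
      qed
    qed (use that in \<open>auto intro!: holomorphic_intros\<close>)
    then show ?thesis by simp
  qed
  have "F a = F 0" using step[of a 0] step[of 0 a] by (cases a "0::real" rule: linorder_cases) auto
  also have "F 0 = (\<integral>t. of_real (normal_density 0 (1 / sqrt (2 * pi)) t) \<partial>lborel)"
    unfolding F_def
  proof (intro Bochner_Integration.integral_cong refl)
    fix t :: real
    have "pi * (Complex 0 t)\<^sup>2 = of_real (- pi * t\<^sup>2)" by (simp add: complex_eq_iff power2_eq_square)
    then have "exp (pi * (Complex 0 t)\<^sup>2) = of_real (exp (- pi * t\<^sup>2))"
      by (simp only: exp_of_real)
    also have "exp (- pi * t\<^sup>2) = normal_density 0 (1 / sqrt (2 * pi)) t"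
      by (simp add: normal_density_def power_divide)
    finally show "exp (pi * (Complex 0 t)\<^sup>2) = of_real (normal_density 0 (1 / sqrt (2 * pi)) t)" .
  qed
  also have "\<dots> = of_real (\<integral>t. normal_density 0 (1 / sqrt (2 * pi)) t \<partial>lborel)"
    by (rule integral_complex_of_real)
  also have "(\<integral>t. normal_density 0 (1 / sqrt (2 * pi)) t \<partial>lborel) = 1"
    by (rule integral_normal_density) simp
  finally show ?thesis by (simp add: F_def)
qed

text \<open>Completing the square translates z by \<open>\<beta> / (2 * pi)\<close>: the real part
  of the translation changes the line, which does not affect the value, and the imaginary part is a
  substitution in t.\<close>

lemma gaussian_fourier_integral:
  fixes \<beta> :: complex
  shows
  "(\<integral>t. exp (pi * (Complex a t)\<^sup>2 + \<beta> * Complex a t) \<partial>lborel) = exp (- \<beta>\<^sup>2 / (4 * pi))"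
proof -
  define d where "d = \<beta> / (2 * pi)"
  have eq: "exp (pi * (Complex a (- Im d + 1 * t))\<^sup>2 + \<beta> * Complex a (- Im d + 1 * t))
     = exp (- \<beta>\<^sup>2 / (4 * pi)) * exp (pi * (Complex (a + Re d) t)\<^sup>2)" for t
  proof -
    have "Complex a (- Im d + 1 * t) = Complex (a + Re d) t - d" by (simp add: complex_eq_iff)
    moreover have "pi * (v - d)\<^sup>2 + \<beta> * (v - d) = - \<beta>\<^sup>2 / (4 * pi) + pi * v\<^sup>2" for v :: complex
    proof -
      have "\<beta> = 2 * pi * d" by (simp add: d_def)
      then show ?thesis by (simp add: power2_eq_square field_simps)
    qed
    ultimately show ?thesis by (simp flip: exp_add)
  qed
  have "(\<integral>t. exp (pi * (Complex a t)\<^sup>2 + \<beta> * Complex a t) \<partial>lborel)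
      = \<bar>1\<bar> *\<^sub>R (\<integral>t. exp (pi * (Complex a (- Im d + 1 * t))\<^sup>2 + \<beta> * Complex a (- Im d + 1 * t)) \<partial>lborel)"
    by (rule lborel_integral_real_affine) simp
  also have "\<dots> = exp (- \<beta>\<^sup>2 / (4 * pi))"
    unfolding eq by (simp add: gaussian_line_integral)
  finally show ?thesis .
qed

lemma inverse_kap: "inverse kap = - \<i> * kap"
proof (rule inverse_unique)
  have "kap * (- \<i> * kap) = - \<i> * kap\<^sup>2" by (simp add: power2_eq_square)
  then show "kap * (- \<i> * kap) = 1" by (simp add: kap_square)
qed

lemma inverse_kap_square: "1 / kap\<^sup>2 = - \<i>"
  by (simp add: kap_square field_simps)

lemma gaussian_on_exp:
  fixes \<beta> :: complex
  shows "gaussian_on (\<lambda>z. exp (of_real pi * z\<^sup>2 + \<beta> * z)) a b"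
  unfolding gaussian_on_def
proof (intro exI allI impI)
  fix x t assume x: "a \<le> x" "x \<le> b"
  have "x\<^sup>2 \<le> (\<bar>a\<bar> + \<bar>b\<bar>)\<^sup>2" using x by (intro abs_le_square_iff[THEN iffD1]) auto
  moreover have "t\<^sup>2 \<le> pi * t\<^sup>2" using pi_ge_two by (simp add: mult_le_cancel_right1)
  ultimately have "pi * x\<^sup>2 \<le> pi * (\<bar>a\<bar> + \<bar>b\<bar>)\<^sup>2" "t\<^sup>2 \<le> pi * t\<^sup>2"
    by (auto intro: mult_left_mono)
  then have 1: "pi * (x\<^sup>2 - t\<^sup>2) \<le> pi * (\<bar>a\<bar> + \<bar>b\<bar>)\<^sup>2 - t\<^sup>2"
    unfolding right_diff_distrib by linarith
  have "Re (\<beta> * Complex x t) \<le> norm \<beta> * norm (Complex x t)"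
    by (metis complex_Re_le_cmod norm_mult)
  also have "norm (Complex x t) \<le> \<bar>x\<bar> + \<bar>t\<bar>" using cmod_le[of "Complex x t"] by simp
  also have "\<bar>x\<bar> + \<bar>t\<bar> \<le> \<bar>a\<bar> + \<bar>b\<bar> + \<bar>t\<bar>" using x by auto
  finally have 2: "Re (\<beta> * Complex x t) \<le> norm \<beta> * (\<bar>a\<bar> + \<bar>b\<bar> + \<bar>t\<bar>)"
    by (simp add: mult_left_mono)
  have "norm (exp (pi * (Complex x t)\<^sup>2 + \<beta> * Complex x t)) = exp (pi * (x\<^sup>2 - t\<^sup>2)) * exp (Re (\<beta> * Complex x t))"
    unfolding exp_add norm_mult norm_exp_gauss by (simp add: norm_exp_eq_Re)
  also have "\<dots> \<le> exp (pi * (\<bar>a\<bar> + \<bar>b\<bar>)\<^sup>2 - t\<^sup>2) * exp (norm \<beta> * (\<bar>a\<bar> + \<bar>b\<bar> + \<bar>t\<bar>))"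
    using 1 2 by (intro mult_mono) auto
  also have "\<dots> = exp (pi * (\<bar>a\<bar> + \<bar>b\<bar>)\<^sup>2 + norm \<beta> * (\<bar>a\<bar> + \<bar>b\<bar>)) * exp (norm \<beta> * \<bar>t\<bar> - t\<^sup>2)"
    by (simp add: algebra_simps flip: exp_add)
  finally show "norm (exp (pi * (Complex x t)\<^sup>2 + \<beta> * Complex x t)) \<le>
     exp (pi * (\<bar>a\<bar> + \<bar>b\<bar>)\<^sup>2 + norm \<beta> * (\<bar>a\<bar> + \<bar>b\<bar>)) * exp (norm \<beta> * \<bar>t\<bar> - t\<^sup>2)" .
qed

lemma integrable_gaussian_exp:
  fixes \<beta> :: complex
  shows "integrable lborel (\<lambda>t. exp (pi * (Complex a t)\<^sup>2 + \<beta> * Complex a t))"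
proof (rule gaussian_on_integrable[OF gaussian_on_exp[of \<beta> a a]])
  show "(\<lambda>t. exp (pi * (Complex a t)\<^sup>2 + \<beta> * Complex a t)) \<in> borel_measurable borel"
    by (intro borel_measurable_continuous_onI continuous_intros)
  show "norm (exp (pi * (Complex a t)\<^sup>2 + \<beta> * Complex a t))
     \<le> 1 * norm (exp (pi * (Complex a t)\<^sup>2 + \<beta> * Complex a t))" for t by simp
qed simp

text \<open>
  With \<open>F\<close> the integrand in the variable \<open>z\<close>, \<open>e\<^bsup>-2\<pi>iy\<^esup> F(z + 1/kap) - F(z)\<close> is a Gaussian, while shifting
  the line by \<open>1/kap\<close> costs only the residue at \<open>x = 1\<close>. This determines the integral.
\<close>

lemma mordell_integral:
  fixes y :: complex
  assumes a: "0 < a" "sqrt 2 * a < 1"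
  shows "kint (\<lambda>z. exp (of_real pi * z\<^sup>2 + (2 * pi * \<i> * y * kap) * z)) a * (exp (- (2 * pi * \<i> * y)) - 1)
           = 1 - exp (pi * \<i> * (y\<^sup>2 - y))"
proof -
  define g where "g = (\<lambda>z. exp (of_real pi * z\<^sup>2 + (2 * pi * \<i> * y * kap) * z))"
  define F where "F z = g z / kern (kap * z) * (kap * \<i>)" for z
  define E where "E = exp (- (2 * pi * \<i> * y))"
  have E: "E \<noteq> 0" "exp (2 * pi * \<i> * y) = 1 / E" by (auto simp: E_def exp_minus field_simps)
  \<comment> \<open>\<open>1 / kap\<close> is (1 - i)/sqrt 2, so translation by it moves the line
    from \<open>a\<close> to \<open>b\<close> and replaces t by t - 1/sqrt 2.\<close>
  define b where "b = a + 1 / sqrt 2"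
  have sb: "sqrt 2 * b = sqrt 2 * a + 1" by (simp add: b_def distrib_left)
  have nonint: "sqrt 2 * a \<notin> \<int>" using a by (intro between_0_1_not_Ints) auto
  have nonint': "sqrt 2 * b \<notin> \<int>" unfolding sb using nonint
    by (metis Ints_1 Ints_diff add_diff_cancel_right')
  have gh: "g holomorphic_on A" for A unfolding g_def by (intro holomorphic_intros)
  have b: "0 < b" "a < b" using a by (auto simp: b_def add_pos_pos)
  have "kint g b - kint g a = - (\<Sum>n | sqrt 2 * a < real n \<and> real n < sqrt 2 * b. (-1) ^ n * g (of_nat n / kap))"
    by (rule kint_shift) (use a b nonint nonint' gh gaussian_on_exp in \<open>auto simp: g_def\<close>)
  also have "{n. sqrt 2 * a < real n \<and> real n < sqrt 2 * b} = {1}"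
    unfolding sb using a by (auto simp: mult_pos_pos intro!: less_antisym) (smt (verit) of_nat_0_less_iff real_sqrt_gt_0_iff mult_pos_pos less_one linorder_neqE_nat of_nat_less_iff of_nat_1 nat_less_real_le)+
  also have "- (\<Sum>n\<in>{1}. (-1) ^ n * g (of_nat n / kap)) = g (1 / kap)" by simp
  also have "g (1 / kap) = exp (- (pi * \<i>)) * exp (2 * pi * \<i> * y)"
    unfolding g_def power_divide exp_add[symmetric]
    by (simp add: inverse_kap_square[simplified] kap_square field_simps)
  also have "\<dots> = - 1 / E" unfolding E by (simp add: exp_minus)
  finally have 1: "kint g b = kint g a - 1 / E" by (simp add: algebra_simps)

  have int: "integrable lborel (\<lambda>t. F (Complex a t))"
    unfolding F_def by (rule kint_integrable) (use a nonint gh gaussian_on_exp in \<open>auto simp: g_def\<close>)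
  have shift: "F (Complex b (- 1 / sqrt 2 + 1 * t)) = exp (- (2 * pi * \<i> * kap * Complex a t)) / E * F (Complex a t)" for t
  proof -
    define z where "z = Complex a t"
    have z1: "Complex b (- 1 / sqrt 2 + 1 * t) = z + 1 / kap"
      by (simp add: z_def b_def complex_eq_iff kap_eq Re_divide Im_divide power2_eq_square field_simps)
    have "kap * (z + 1 / kap) = kap * z + 1" by (simp add: distrib_left)
    then have 2: "kern (kap * (z + 1 / kap)) = - kern (kap * z)"
      by (simp add: kern_def distrib_left exp_add exp_diff exp_minus)
    have "pi * (z + 1 / kap)\<^sup>2 + (2 * pi * \<i> * y * kap) * (z + 1 / kap)
       = (of_real pi * z\<^sup>2 + (2 * pi * \<i> * y * kap) * z) + 2 * pi * z / kap + 2 * pi * \<i> * y + pi * (1 / kap\<^sup>2)"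
      by (simp add: power2_eq_square algebra_simps)
    also have "2 * pi * z / kap = - (2 * pi * \<i> * kap * z)"
      unfolding divide_inverse inverse_kap by simp
    finally have exponent: "pi * (z + 1 / kap)\<^sup>2 + (2 * pi * \<i> * y * kap) * (z + 1 / kap)
       = (of_real pi * z\<^sup>2 + (2 * pi * \<i> * y * kap) * z) + - (2 * pi * \<i> * kap * z) + 2 * pi * \<i> * y + pi * (1 / kap\<^sup>2)" .
    have "g (z + 1 / kap) = g z * exp (- (2 * pi * \<i> * kap * z)) * exp (2 * pi * \<i> * y) * exp (- (pi * \<i>))"
      unfolding g_def exponent inverse_kap_square by (simp only: exp_add) simp
    then have 3: "g (z + 1 / kap) = - g z * exp (- (2 * pi * \<i> * kap * z)) / E"
      using E(2) by (simp add: exp_minus)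
    show ?thesis unfolding z1 F_def z_def[symmetric] 2 3 by simp
  qed
  have "kint g b = \<bar>1\<bar> *\<^sub>R (\<integral>t. F (Complex b (- 1 / sqrt 2 + 1 * t)) \<partial>lborel)"
    unfolding kint_def F_def[symmetric] by (rule lborel_integral_real_affine) simp
  then have "E * kint g b = (\<integral>t. exp (- (2 * pi * \<i> * kap * Complex a t)) * F (Complex a t) \<partial>lborel)"
    unfolding shift using E by (simp add: field_simps)
  also have "\<dots> = (\<integral>t. F (Complex a t) + kap * \<i> * exp (pi * (Complex a t)\<^sup>2 + (2 * pi * \<i> * y * kap - pi * \<i> * kap) * Complex a t) \<partial>lborel)"
  proof (intro Bochner_Integration.integral_cong refl)
    fix t
    define z where "z = Complex a t"
    have nz: "kern (kap * z) \<noteq> 0"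
      unfolding z_def by (rule kern_line_neq_0[OF nonint])
    \<comment> \<open>This factorisation cancels the denominator of \<open>F\<close> and leaves the
      pure Gaussian.\<close>
    have k: "exp (- (2 * pi * \<i> * kap * z)) - 1 = exp (- (pi * \<i> * kap * z)) * kern (kap * z)"
      unfolding kern_def by (simp add: algebra_simps exp_minus_inverse flip: exp_add)
    have "exp (- (2 * pi * \<i> * kap * z)) * F z = F z + (exp (- (2 * pi * \<i> * kap * z)) - 1) * F z"
      by (simp add: algebra_simps)
    also have "(exp (- (2 * pi * \<i> * kap * z)) - 1) * F z = kap * \<i> * (g z * exp (- (pi * \<i> * kap * z)))"
      unfolding k F_def using nz by simp
    also have "g z * exp (- (pi * \<i> * kap * z)) = exp (of_real pi * z\<^sup>2 + (2 * pi * \<i> * y * kap - pi * \<i> * kap) * z)"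
      unfolding g_def exp_add[symmetric] by (simp add: algebra_simps)
    finally show "exp (- (2 * pi * \<i> * kap * Complex a t)) * F (Complex a t) =
       F (Complex a t) + kap * \<i> * exp (pi * (Complex a t)\<^sup>2 + (2 * pi * \<i> * y * kap - pi * \<i> * kap) * Complex a t)"
      by (simp add: z_def)
  qed
  also have "\<dots> = kint g a + kap * \<i> * exp (- (2 * pi * \<i> * y * kap - pi * \<i> * kap)\<^sup>2 / (4 * pi))"
    unfolding gaussian_fourier_integral[of a, symmetric] kint_def F_def[symmetric]
    by (subst Bochner_Integration.integral_add)
       (use int integrable_gaussian_exp in \<open>auto intro!: integrable_mult_right\<close>)
  also have "- (2 * pi * \<i> * y * kap - pi * \<i> * kap)\<^sup>2 / (4 * pi) = pi * \<i> * (y\<^sup>2 - y) + pi * \<i> / 4"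
  proof -
    have "(2 * pi * \<i> * y * kap - pi * \<i> * kap)\<^sup>2 = - (pi\<^sup>2 * kap\<^sup>2 * (2 * y - 1)\<^sup>2)"
      by (simp add: power2_eq_square algebra_simps)
    also have "\<dots> = - (pi\<^sup>2 * \<i> * (2 * y - 1)\<^sup>2)" by (simp only: kap_square)
    finally have sq: "(2 * pi * \<i> * y * kap - pi * \<i> * kap)\<^sup>2 = - (pi\<^sup>2 * \<i> * (2 * y - 1)\<^sup>2)" .
    show ?thesis unfolding sq by (simp add: power2_eq_square field_simps)
  qed
  also have "kap * \<i> * exp (pi * \<i> * (y\<^sup>2 - y) + pi * \<i> / 4) = - exp (pi * \<i> * (y\<^sup>2 - y))"
  proof -
    have "exp (pi * \<i> / 4) = kap" by (simp add: kap_def cis_conv_exp mult.commute)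
    then have "kap * \<i> * exp (pi * \<i> * (y\<^sup>2 - y) + pi * \<i> / 4) = \<i> * kap\<^sup>2 * exp (pi * \<i> * (y\<^sup>2 - y))"
      by (simp add: exp_add power2_eq_square)
    then show ?thesis by (simp add: kap_square)
  qed
  finally have "E * (kint g a - 1 / E) = kint g a - exp (pi * \<i> * (y\<^sup>2 - y))" by (simp add: 1)
  moreover have "E * (kint g a - 1 / E) = E * kint g a - 1" using E(1) by (simp add: right_diff_distrib)
  ultimately have "kint g a * (E - 1) = 1 - exp (pi * \<i> * (y\<^sup>2 - y))"
    by (simp add: algebra_simps)
  then show ?thesis by (simp add: g_def E_def)
qed

section \<open>The function R* and its Mellin representation\<close>

text \<open>This is \<open>x\<^sup>-\<^sup>w e\<^bsup>-\<pi>ix\<^sup>2\<^esup>\<close> at \<open>x = kap z\<close>.\<close>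

definition pker :: "complex \<Rightarrow> complex \<Rightarrow> complex" where
  "pker w z = exp (- w * Ln (kap * z) + of_real pi * z\<^sup>2)"

lemma norm_Ln_kap_le:
  assumes "Re z > 0"
  shows "norm (Ln (kap * z)) \<le> norm z + 1 / Re z + pi"
proof -
  have z: "z \<noteq> 0" "norm z > 0" using assms by auto
  have "\<bar>ln (norm z)\<bar> \<le> norm z + 1 / norm z"
  proof -
    have "ln (norm z) \<le> norm z" using ln_less_self[OF z(2)] by simp
    moreover have "ln (1 / norm z) \<le> 1 / norm z" by (rule ln_bound) (use z in simp)
    then have "- ln (norm z) \<le> 1 / norm z" using z by (simp add: ln_div)
    moreover have "0 < 1 / norm z" using z by simp
    ultimately show ?thesis using z(2) by linarith
  qed
  also have "1 / norm z \<le> 1 / Re z" using assms complex_Re_le_cmod[of z] by (simp add: frac_le)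
  finally have 1: "\<bar>Re (Ln (kap * z))\<bar> \<le> norm z + 1 / Re z" using z by (simp add: norm_mult)
  have "kap * z \<noteq> 0" using z by simp
  then have 2: "\<bar>Im (Ln (kap * z))\<bar> \<le> pi" using mpi_less_Im_Ln[of "kap * z"] Im_Ln_le_pi[of "kap * z"] by linarith
  show ?thesis using cmod_le[of "Ln (kap * z)"] 1 2 by linarith
qed

text \<open>Depends on w only through a bound for its norm, so that it also dominates on discs in w,
  as holomorphy in w requires.\<close>

lemma norm_pker_le:
  assumes "0 < a" "a \<le> x" "x \<le> b" "norm w \<le> W"
  shows "norm (pker w (Complex x t)) \<le> exp (W * (b + 1 / a + pi) + pi * b\<^sup>2) * exp (W * \<bar>t\<bar> - t\<^sup>2)"
proof -
  have W: "0 \<le> W" using assms(4) norm_ge_zero order_trans by blast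
  have "x\<^sup>2 \<le> b\<^sup>2" using assms by (intro power_mono) auto
  then have "pi * x\<^sup>2 \<le> pi * b\<^sup>2" by simp
  moreover have "t\<^sup>2 \<le> pi * t\<^sup>2" using pi_ge_two by (simp add: mult_le_cancel_right1)
  ultimately have 1: "pi * (x\<^sup>2 - t\<^sup>2) \<le> pi * b\<^sup>2 - t\<^sup>2"
    unfolding right_diff_distrib by linarith
  have "norm (Ln (kap * Complex x t)) \<le> norm (Complex x t) + 1 / x + pi"
    using norm_Ln_kap_le[of "Complex x t"] assms by simp
  also have "norm (Complex x t) \<le> b + \<bar>t\<bar>" using cmod_le[of "Complex x t"] assms by simp
  also have "1 / x \<le> 1 / a" using assms by (simp add: frac_le)
  finally have L: "norm (Ln (kap * Complex x t)) \<le> b + \<bar>t\<bar> + 1 / a + pi" by simp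
  have "Re (- w * Ln (kap * Complex x t)) \<le> norm w * norm (Ln (kap * Complex x t))"
    by (metis complex_Re_le_cmod norm_minus_cancel norm_mult)
  also have "\<dots> \<le> W * (b + \<bar>t\<bar> + 1 / a + pi)" using assms L W by (intro mult_mono) auto
  finally have 2: "Re (- w * Ln (kap * Complex x t)) \<le> W * (b + \<bar>t\<bar> + 1 / a + pi)" .
  have "norm (pker w (Complex x t)) = exp (Re (- w * Ln (kap * Complex x t))) * exp (pi * (x\<^sup>2 - t\<^sup>2))"
    unfolding pker_def exp_add norm_mult norm_exp_gauss[symmetric] by (simp add: norm_exp_eq_Re)
  also have "\<dots> \<le> exp (W * (b + \<bar>t\<bar> + 1 / a + pi)) * exp (pi * b\<^sup>2 - t\<^sup>2)"
    using 1 2 by (intro mult_mono) auto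
  also have "\<dots> = exp (W * (b + 1 / a + pi) + pi * b\<^sup>2) * exp (W * \<bar>t\<bar> - t\<^sup>2)"
    by (simp add: algebra_simps flip: exp_add)
  finally show ?thesis .
qed

lemma pker_gaussian_on:
  assumes "0 < a" shows "gaussian_on (pker w) a b"
  unfolding gaussian_on_def using norm_pker_le[OF assms] by blast

lemma pker_holomorphic: "pker w holomorphic_on {z. Re z > 0}"
  unfolding pker_def by (intro holomorphic_intros) (auto simp: kap_mult_not_nonpos)

lemma pker_holomorphic_param: "(\<lambda>w. pker w z) holomorphic_on A"
  unfolding pker_def by (intro holomorphic_intros)

text \<open>At x = n the Gaussian factor is exp(-pi i n^2) = (-1)^n, which cancels the sign of the
  residue and leaves a term of the zeta series.\<close>

lemma pker_at_pole:
  assumes "n > 0"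
  shows "(-1) ^ n * pker w (of_nat n / kap) = of_nat n powr (- w)"
proof -
  have "exp (pi * (of_nat n / kap)\<^sup>2) = exp (- (pi * \<i> * of_nat n ^ 2))"
  proof -
    have "pi * (of_nat n / kap)\<^sup>2 = pi * of_nat n ^ 2 * (1 / kap\<^sup>2)" by (simp add: power_divide)
    then show ?thesis unfolding inverse_kap_square by (simp add: mult_ac)
  qed
  also have "pi * \<i> * of_nat n ^ 2 = of_nat (n ^ 2) * (pi * \<i>)" by simp
  also have "exp (- (of_nat (n ^ 2) * (pi * \<i>))) = inverse (exp (pi * \<i>) ^ (n ^ 2))"
    unfolding exp_minus exp_of_nat_mult ..
  also have "\<dots> = (-1) ^ (n ^ 2)" by (simp flip: power_inverse)
  also have "\<dots> = (-1) ^ n" by (cases "even n") auto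
  finally have "(-1) ^ n * pker w (of_nat n / kap) = exp (- w * Ln (of_nat n))"
    unfolding pker_def exp_add by simp
  then show ?thesis using assms by (simp add: powr_def)
qed

lemma kint_pker_shift:
  assumes ab: "0 < a" "a < b" and nonint: "sqrt 2 * a \<notin> \<int>" "sqrt 2 * b \<notin> \<int>"
  shows "kint (pker w) a = (\<Sum>n | sqrt 2 * a < real n \<and> real n < sqrt 2 * b. of_nat n powr (- w)) + kint (pker w) b"
proof -
  have "0 < sqrt 2 * a" using ab by simp
  then have pos: "n > 0" if "sqrt 2 * a < real n" for n using that by (cases n) auto
  have "kint (pker w) b - kint (pker w) a
     = - (\<Sum>n | sqrt 2 * a < real n \<and> real n < sqrt 2 * b. (-1) ^ n * pker w (of_nat n / kap))"
    by (rule kint_shift[OF assms pker_holomorphic pker_gaussian_on[OF ab(1)]])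
  also have "(\<Sum>n | sqrt 2 * a < real n \<and> real n < sqrt 2 * b. (-1) ^ n * pker w (of_nat n / kap))
      = (\<Sum>n | sqrt 2 * a < real n \<and> real n < sqrt 2 * b. of_nat n powr (- w))"
    by (intro sum.cong refl pker_at_pole) (auto intro: pos)
  finally show ?thesis by (simp add: algebra_simps)
qed

lemma kint_pker_entire:
  assumes "0 < a" "sqrt 2 * a \<notin> \<int>"
  shows "(\<lambda>w. kint (pker w) a) holomorphic_on UNIV"
  unfolding kint_def
proof (rule holomorphic_on_lebesgue_integral)
  fix w :: complex
  note int = kint_integrable[OF assms pker_holomorphic pker_gaussian_on[OF assms(1)]]
  show "(\<lambda>t. pker w (Complex a t) / kern (kap * Complex a t) * (kap * \<i>)) \<in> borel_measurable lborel"
    by (rule borel_measurable_integrable[OF int])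
  define M where "M = 1 / \<bar>sin (pi * (sqrt 2 * a))\<bar>"
  define W where "W = norm w + 1"
  show "\<exists>r>0. \<exists>g. integrable lborel g \<and> (\<forall>w'\<in>ball w r \<inter> UNIV. \<forall>t\<in>space lborel.
      norm (pker w' (Complex a t) / kern (kap * Complex a t) * (kap * \<i>)) \<le> g t)"
  proof (intro exI[of _ 1] exI conjI ballI)
    show "integrable lborel (\<lambda>t. M * (exp (W * (a + 1 / a + pi) + pi * a\<^sup>2) * exp (W * \<bar>t\<bar> - 1 * t\<^sup>2)))"
      by (intro integrable_mult_right integrable_gaussian_abs) auto
    fix w' t assume w': "w' \<in> ball w 1 \<inter> UNIV"
    have "norm w' \<le> W" using w' norm_triangle_ineq2[of w' w] by (simp add: W_def dist_norm norm_minus_commute)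
    then have "norm (pker w' (Complex a t)) \<le> exp (W * (a + 1 / a + pi) + pi * a\<^sup>2) * exp (W * \<bar>t\<bar> - t\<^sup>2)"
      using assms by (intro norm_pker_le) auto
    then show "norm (pker w' (Complex a t) / kern (kap * Complex a t) * (kap * \<i>))
        \<le> M * (exp (W * (a + 1 / a + pi) + pi * a\<^sup>2) * exp (W * \<bar>t\<bar> - 1 * t\<^sup>2))"
      using kern_line_bound[OF assms(2), of "pker w' (Complex a t)" t]
      by (simp add: M_def mult.commute) (smt (verit) divide_right_mono abs_ge_zero)
  qed auto
next
  fix t :: real
  show "(\<lambda>w. pker w (Complex a t) / kern (kap * Complex a t) * (kap * \<i>)) holomorphic_on UNIV"
    using kern_line_neq_0[OF assms(2)]
    by (intro holomorphic_intros pker_holomorphic_param) auto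
qed auto

section \<open>Euler's integral for \<open>Gamma w\<close> times z^(-w) in the right
  half-plane\<close>

definition gint :: "complex \<Rightarrow> complex \<Rightarrow> complex" where
  "gint w z = (\<integral>r. indicator {0<..} r *\<^sub>R (of_real r powr (w - 1) * exp (- z * of_real r)) \<partial>lborel)"

lemma powr_of_real_measurable [measurable]: "(\<lambda>r. of_real r powr w) \<in> borel_measurable (borel :: real measure)"
  for w :: complex
  unfolding powr_def by measurable

lemma gint_integrable_real:
  fixes \<sigma> x :: real
  assumes "\<sigma> > 0" "x > 0"
  shows "integrable lborel (\<lambda>r. indicator {0<..} r *\<^sub>R (r powr (\<sigma> - 1) * exp (- x * r)))"
proof -
  have "(\<lambda>t. complex_of_real t powr (of_real \<sigma> - 1) / of_real (exp (x * t))) absolutely_integrable_on {0<..}"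
    using assms by (intro absolutely_integrable_Gamma_integral) auto
  then have "integrable lborel (\<lambda>t. indicator {0<..} t *\<^sub>R (complex_of_real t powr (of_real \<sigma> - 1) / of_real (exp (x * t))))"
    unfolding set_integrable_def by (subst (asm) integrable_completion) measurable
  then have "integrable lborel (\<lambda>t. norm (indicator {0<..} t *\<^sub>R (complex_of_real t powr (of_real \<sigma> - 1) / of_real (exp (x * t)))))"
    by (rule integrable_norm)
  moreover have "norm (indicator {0<..} t *\<^sub>R (complex_of_real t powr (of_real \<sigma> - 1) / of_real (exp (x * t))))
     = indicator {0<..} t *\<^sub>R (t powr (\<sigma> - 1) * exp (- x * t))" for t
    by (auto simp: indicator_def norm_mult norm_inverse norm_powr_real_powr exp_minus divide_inverse)
  ultimately show ?thesis by (simp only:)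
qed

lemma gint_norm:
  "norm (indicator {0<..} r *\<^sub>R (of_real r powr (w - 1) * exp (- z * of_real r)))
     = indicator {0<..} r *\<^sub>R (r powr (Re w - 1) * exp (- Re z * r))"
  by (auto simp: indicator_def norm_mult norm_powr_real_powr)

lemma gint_measurable [measurable]:
  "(\<lambda>r. indicator {0<..} r *\<^sub>R (of_real r powr (w - 1) * exp (- z * of_real r))) \<in> borel_measurable lborel"
  for w z :: complex
  by measurable

lemma gint_integrable:
  assumes "Re w > 0" "Re z > 0"
  shows "integrable lborel (\<lambda>r. indicator {0<..} r *\<^sub>R (of_real r powr (w - 1) * exp (- z * of_real r)))"
  using gint_integrable_real[OF assms]
  by (rule Bochner_Integration.integrable_bound[OF _ gint_measurable])
     (unfold gint_norm, auto simp: indicator_def)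

lemma gint_of_real:
  assumes "Re w > 0" "x > 0"
  shows "gint w (of_real x) = Gamma w * exp (- w * Ln (of_real x))"
proof -
  define F where "F r = indicator {0<..} r *\<^sub>R (of_real r powr (w - 1) * exp (- 1 * of_real r))" for r :: real
  have "set_integrable lborel {0<..} (\<lambda>r. of_real r powr (w - 1) * exp (- 1 * of_real r))"
    unfolding set_integrable_def using gint_integrable[of w 1] assms by simp
  from set_borel_integral_eq_integral[OF this]
  have "((\<lambda>r. of_real r powr (w - 1) * exp (- 1 * of_real r)) has_integral (\<integral>r. F r \<partial>lborel)) {0<..}"
    by (simp add: set_lebesgue_integral_def F_def[abs_def] has_integral_iff)
  moreover have "((\<lambda>r. of_real r powr (w - 1) * exp (- 1 * of_real r)) has_integral Gamma w) {0<..}"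
    using Gamma_integral_complex'[OF assms(1)] by (simp add: exp_minus exp_of_real divide_inverse)
  ultimately have "Gamma w = (\<integral>r. F r \<partial>lborel)" by (rule has_integral_unique[symmetric])
  also have "\<dots> = \<bar>x\<bar> *\<^sub>R (\<integral>r. F (0 + x * r) \<partial>lborel)" by (rule lborel_integral_real_affine) (use assms in auto)
  also have "(\<integral>r. F (0 + x * r) \<partial>lborel) = (\<integral>r. of_real x powr (w - 1) * (indicator {0<..} r *\<^sub>R (of_real r powr (w - 1) * exp (- of_real x * of_real r))) \<partial>lborel)"
    using assms by (intro Bochner_Integration.integral_cong refl)
      (auto simp: F_def indicator_def zero_less_mult_iff powr_times_real)
  also have "\<dots> = of_real x powr (w - 1) * gint w (of_real x)"
    unfolding gint_def by (rule integral_mult_right_zero)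
  finally have "Gamma w = of_real x * of_real x powr (w - 1) * gint w (of_real x)"
    using assms by (simp add: scaleR_conv_of_real)
  also have "of_real x * of_real x powr (w - 1) = exp (w * Ln (of_real x))"
    using assms by (simp add: powr_def exp_diff left_diff_distrib exp_Ln)
  finally show ?thesis by (simp add: exp_minus field_simps)
qed

text \<open>Rescaling r proves this for positive real z. Both sides are holomorphic in z on the
  right half-plane, so the identity theorem extends it.\<close>

lemma gint_eq:
  assumes w: "Re w > 0" and z: "Re z > 0"
  shows "gint w z = Gamma w * exp (- w * Ln z)"
proof -
  define S where "S = {z. Re z > 0}"
  have "open S" "connected S" unfolding S_def
    by (auto intro: open_halfspace_Re_gt convex_connected convex_halfspace_Re_gt)
  have "(\<lambda>z. gint w z) holomorphic_on S"
    unfolding gint_def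
  proof (rule holomorphic_on_lebesgue_integral[OF \<open>open S\<close> gint_measurable])
    fix z0 assume "z0 \<in> S"
    then have z0: "Re z0 > 0" by (simp add: S_def)
    show "\<exists>r>0. \<exists>g. integrable lborel g \<and> (\<forall>z'\<in>ball z0 r \<inter> S. \<forall>t\<in>space lborel.
      norm (indicator {0<..} t *\<^sub>R (of_real t powr (w - 1) * exp (- z' * of_real t))) \<le> g t)"
    \<comment> \<open>This radius keeps the real part of z' above half that of \<open>z0\<close>,
      which gives one exponentially decaying majorant.\<close>
    proof (intro exI[of _ "Re z0 / 2"] exI conjI ballI)
      show "integrable lborel (\<lambda>r. indicator {0<..} r *\<^sub>R (r powr (Re w - 1) * exp (- (Re z0 / 2) * r)))"
        using w z0 by (intro gint_integrable_real) auto
      fix z' t assume z': "z' \<in> ball z0 (Re z0 / 2) \<inter> S"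
      then have "norm (z0 - z') < Re z0 / 2" by (simp add: dist_norm)
      then have "Re z0 / 2 \<le> Re z'" using complex_Re_le_cmod[of "z0 - z'"] by simp
      then show "norm (indicator {0<..} t *\<^sub>R (of_real t powr (w - 1) * exp (- z' * of_real t)))
        \<le> indicator {0<..} t *\<^sub>R (t powr (Re w - 1) * exp (- (Re z0 / 2) * t))"
        unfolding gint_norm by (auto simp: indicator_def intro!: mult_left_mono)
    qed (use z0 in auto)
  next
    fix t :: real
    show "(\<lambda>z. indicator {0<..} t *\<^sub>R (of_real t powr (w - 1) * exp (- z * of_real t))) holomorphic_on S"
      unfolding scaleR_conv_of_real by (intro holomorphic_intros)
  qed
  moreover have "(\<lambda>z. Gamma w * exp (- w * Ln z)) holomorphic_on S"
    by (intro holomorphic_intros) (auto simp: S_def complex_nonpos_Reals_iff)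
  ultimately have hol: "(\<lambda>z. gint w z - Gamma w * exp (- w * Ln z)) holomorphic_on S"
    by (rule holomorphic_on_diff)
  define U where "U = complex_of_real ` {0<..}"
  have "(1::complex) islimpt U"
  proof -
    have "(1::real) islimpt {0<..}" by (rule interior_limit_point) (auto simp: interior_open)
    then have "complex_of_real 1 islimpt U" unfolding U_def
      by (rule islimpt_isCont_image) (auto simp: eventually_at_filter)
    then show ?thesis by simp
  qed
  have "gint w z - Gamma w * exp (- w * Ln z) = 0"
    by (rule analytic_continuation[OF hol \<open>open S\<close> \<open>connected S\<close>, of U 1])
       (use \<open>1 islimpt U\<close> gint_of_real[OF w] z in \<open>auto simp: U_def S_def\<close>)
  then show ?thesis by simp
qed

text \<open>What the Gaussian term of \<open>mordell_on_ray\<close> contributes to the Mellin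
  integral after the substitution r = 2 pi t, up to a power of 2 pi. The zero of the kernel at t = 0
  costs one power of t, whence the range Re w > 1.\<close>

definition hker :: "complex \<Rightarrow> real \<Rightarrow> complex" where
  "hker w t = indicator {0<..} t *\<^sub>R (of_real t powr (w - 1) * exp (- (pi * t\<^sup>2)) / kern (kap * of_real t))"

lemma Re_inverse_kap: "Re (inverse kap) = 1 / sqrt 2"
  by (simp add: inverse_kap kap_eq) (simp add: field_simps)

lemma Re_divide_kap: "Re (of_real r / kap) = r / sqrt 2"
proof -
  have Re: "Re (of_real r / kap) = r * Re (inverse kap)" by (simp add: divide_inverse)
  show ?thesis unfolding Re Re_inverse_kap by simp
qed

lemma norm_exp_ray: "norm (exp (- (1 / kap) * of_real r)) = exp (- (r / sqrt 2))"
proof -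
  have "- (1 / kap) * of_real r = - (of_real r / kap)" by simp
  then show ?thesis by (simp only: norm_exp_eq_Re uminus_complex.sel Re_divide_kap)
qed

lemma hker_measurable [measurable]: "hker w \<in> borel_measurable borel"
  unfolding hker_def by measurable

lemma norm_kern_kap_real: "t > 0 \<Longrightarrow> norm (kern (kap * of_real t)) \<ge> t"
proof -
  assume t: "t > 0"
  have "1 * t \<le> 2 * pi / sqrt 2 * t"
    using t pi_ge_two real_sqrt_le_mono[of 2 4] by (intro mult_right_mono) (auto simp: field_simps)
  also have "\<dots> = 2 * pi * \<bar>Im (kap * of_real t)\<bar>" using t by (simp only: Im_kap_mult) simp
  also have "\<dots> \<le> norm (kern (kap * of_real t))" by (rule norm_kern_ge_Im)
  finally show ?thesis by simp
qed

lemma integrable_powr_gauss: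
  fixes \<sigma> :: real
  assumes "\<sigma> > 0"
  shows "integrable lborel (\<lambda>t. indicator {0<..} t *\<^sub>R (t powr (\<sigma> - 1) * exp (- (pi * t\<^sup>2))))"
proof (rule Bochner_Integration.integrable_bound)
  show "integrable lborel (\<lambda>t. exp 1 * (indicator {0<..} t *\<^sub>R (t powr (\<sigma> - 1) * exp (- 1 * t))))"
    using assms by (intro integrable_mult_right gint_integrable_real) auto
  show "AE t in lborel. norm (indicator {0<..} t *\<^sub>R (t powr (\<sigma> - 1) * exp (- (pi * t\<^sup>2))))
     \<le> norm (exp 1 * (indicator {0<..} t *\<^sub>R (t powr (\<sigma> - 1) * exp (- 1 * t))))"
  proof (rule AE_I2)
    fix t :: real
    have "0 \<le> (t - 1)\<^sup>2" by simp
    then have "2 * t \<le> t\<^sup>2 + 1" by (simp add: power2_eq_square algebra_simps)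
    moreover have "2 * t\<^sup>2 \<le> pi * t\<^sup>2" using pi_ge_two by (intro mult_right_mono) auto
    moreover have "0 \<le> t\<^sup>2" by simp
    ultimately have "- (pi * t\<^sup>2) \<le> 1 + - 1 * t" by linarith
    then have "exp (- (pi * t\<^sup>2)) \<le> exp 1 * exp (- 1 * t)" by (simp flip: exp_add)
    then have "t powr (\<sigma> - 1) * exp (- (pi * t\<^sup>2)) \<le> t powr (\<sigma> - 1) * (exp 1 * exp (- 1 * t))"
      by (intro mult_left_mono) auto
    then show "norm (indicator {0<..} t *\<^sub>R (t powr (\<sigma> - 1) * exp (- (pi * t\<^sup>2))))
     \<le> norm (exp 1 * (indicator {0<..} t *\<^sub>R (t powr (\<sigma> - 1) * exp (- 1 * t))))"
      by (auto simp: indicator_def mult_ac)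
  qed
qed measurable

lemma hker_integrable:
  assumes "Re w > 1"
  shows "integrable lborel (hker w)"
proof (rule Bochner_Integration.integrable_bound)
  show "integrable lborel (\<lambda>t. indicator {0<..} t *\<^sub>R (t powr ((Re w - 1) - 1) * exp (- (pi * t\<^sup>2))))"
    using assms by (intro integrable_powr_gauss) auto
  show "AE t in lborel. norm (hker w t) \<le> norm (indicator {0<..} t *\<^sub>R (t powr ((Re w - 1) - 1) * exp (- (pi * t\<^sup>2))))"
  proof (rule AE_I2)
    fix t :: real
    show "norm (hker w t) \<le> norm (indicator {0<..} t *\<^sub>R (t powr ((Re w - 1) - 1) * exp (- (pi * t\<^sup>2))))"
    proof (cases "t > 0")
      case True
      have "norm (hker w t) = t powr (Re w - 1) * exp (- (pi * t\<^sup>2)) / norm (kern (kap * of_real t))"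
        using True by (simp add: hker_def norm_mult norm_divide norm_powr_real_powr)
      also have "\<dots> \<le> t powr (Re w - 1) * exp (- (pi * t\<^sup>2)) / t"
        using True norm_kern_kap_real[OF True] by (intro divide_left_mono mult_pos_pos) (auto intro: less_le_trans)
      also have "\<dots> = t powr ((Re w - 1) - 1) * exp (- (pi * t\<^sup>2))"
        using True by (simp add: powr_diff power2_eq_square)
      finally show ?thesis using True by simp
    qed (simp add: hker_def)
  qed
qed measurable

section \<open>The Mellin transform of the Mordell integral\<close>

lemma Ln_kap_mult:
  assumes "Re z > 0"
  shows "Ln (kap * z) = Ln z + pi / 4 * \<i>"
proof -
  have "Ln kap = pi / 4 * \<i>" unfolding kap_def by (subst Ln_cis) auto
  moreover have "Ln (kap * z) = Ln kap + Ln z"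
    using assms Re_Ln_pos_lt_imp[OF assms] pi_gt_zero unfolding abs_less_iff
    by (intro Ln_times_simple) (auto simp: calculation)
  ultimately show ?thesis by simp
qed

text \<open>Write x^(-w) as Euler's integral and exchange the order of integration. The phase
  appears because x = kap z while Euler's integral is taken at z.\<close>

lemma mellin_swap:
  fixes w :: complex
  assumes a: "0 < a" "sqrt 2 * a \<notin> \<int>" and w: "Re w > 0"
  defines "J \<equiv> \<lambda>r. kint (\<lambda>z. exp (of_real pi * z\<^sup>2 - of_real r * z)) a"
  shows "Gamma w * kint (pker w) a = exp (- w * (pi / 4 * \<i>)) *
           (\<integral>r. indicator {0<..} r *\<^sub>R (of_real r powr (w - 1) * J r) \<partial>lborel)"
    and "integrable lborel (\<lambda>r. indicator {0<..} r *\<^sub>R (of_real r powr (w - 1) * J r))"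
proof -
  define F where "F t = exp (of_real pi * (Complex a t)\<^sup>2) / kern (kap * Complex a t) * (kap * \<i>)" for t
  define P where "P t r = indicator {0<..} r *\<^sub>R (of_real r powr (w - 1) * exp (- Complex a t * of_real r)) * F t" for t r
  have F_int: "integrable lborel F"
  proof -
    have "(\<lambda>z. exp (of_real pi * z\<^sup>2)) holomorphic_on {z. Re z > 0}" by (intro holomorphic_intros)
    moreover have "gaussian_on (\<lambda>z. exp (of_real pi * z\<^sup>2)) a a" using gaussian_on_exp[of 0 a a] by simp
    ultimately show ?thesis unfolding F_def[abs_def] by (rule kint_integrable[OF a])
  qed
  then have [measurable]: "F \<in> borel_measurable borel" by auto
  have P_meas [measurable]: "(\<lambda>(t, r). P t r) \<in> borel_measurable (lborel \<Otimes>\<^sub>M lborel)"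
    unfolding P_def by measurable
  \<comment> \<open>The real part of z is constant on the line, so the norm factors into a function
    of t and one of r, and absolute integrability on the product is immediate.\<close>
  have norm_P: "norm (P t r) = norm (F t) * (indicator {0<..} r *\<^sub>R (r powr (Re w - 1) * exp (- a * r)))" for t r
    unfolding P_def norm_mult gint_norm by simp
  have int_t: "integrable lborel (P t)" for t
    unfolding P_def[abs_def] using a by (intro integrable_mult_left gint_integrable w) auto
  have P_int: "integrable (lborel \<Otimes>\<^sub>M lborel) (\<lambda>(t, r). P t r)"
  proof (rule lborel_pair.Fubini_integrable[OF P_meas])
    show "integrable lborel (\<lambda>t. \<integral>r. norm (case (t, r) of (t, r) \<Rightarrow> P t r) \<partial>lborel)"
      unfolding prod.case norm_P integral_mult_right_zero using F_int by (intro integrable_mult_left) auto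
  qed (use int_t in auto)
  have swap: "(\<integral>t. (\<integral>r. P t r \<partial>lborel) \<partial>lborel) = (\<integral>r. (\<integral>t. P t r \<partial>lborel) \<partial>lborel)"
    using lborel_pair.Fubini_integral[OF P_int] by simp
  have inner_r: "(\<integral>t. P t r \<partial>lborel) = indicator {0<..} r *\<^sub>R (of_real r powr (w - 1) * J r)" for r
  proof -
    have PE: "P t r = (indicator {0<..} r *\<^sub>R of_real r powr (w - 1)) *
       (exp (of_real pi * (Complex a t)\<^sup>2 - of_real r * Complex a t) / kern (kap * Complex a t) * (kap * \<i>))" for t
      unfolding P_def F_def by (simp add: exp_diff exp_minus scaleR_conv_of_real field_simps)
    show ?thesis unfolding PE J_def kint_def integral_mult_right_zero by simp
  qed
  show "integrable lborel (\<lambda>r. indicator {0<..} r *\<^sub>R (of_real r powr (w - 1) * J r))"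
    using lborel_pair.integrable_snd[OF P_int] by (simp add: inner_r)
  have inner_t: "exp (- w * (pi / 4 * \<i>)) * (\<integral>r. P t r \<partial>lborel) = Gamma w * (pker w (Complex a t) / kern (kap * Complex a t) * (kap * \<i>))" for t
  proof -
    have "(\<integral>r. P t r \<partial>lborel) = gint w (Complex a t) * F t"
      unfolding P_def gint_def by (rule integral_mult_left_zero)
    moreover have "pker w (Complex a t) = exp (- w * (pi / 4 * \<i>)) * exp (- w * Ln (Complex a t)) * exp (of_real pi * (Complex a t)\<^sup>2)"
      using Ln_kap_mult[of "Complex a t"] a unfolding pker_def exp_add[symmetric]
      by (simp add: algebra_simps)
    moreover have "gint w (Complex a t) = Gamma w * exp (- w * Ln (Complex a t))"
      by (rule gint_eq[OF w]) (use a in simp)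
    ultimately show ?thesis by (simp add: F_def mult_ac)
  qed
  have "Gamma w * kint (pker w) a = (\<integral>t. exp (- w * (pi / 4 * \<i>)) * (\<integral>r. P t r \<partial>lborel) \<partial>lborel)"
    unfolding inner_t kint_def by (rule integral_mult_right_zero[symmetric])
  also have "\<dots> = exp (- w * (pi / 4 * \<i>)) * (\<integral>t. (\<integral>r. P t r \<partial>lborel) \<partial>lborel)"
    by (rule integral_mult_right_zero)
  finally show "Gamma w * kint (pker w) a = exp (- w * (pi / 4 * \<i>)) *
           (\<integral>r. indicator {0<..} r *\<^sub>R (of_real r powr (w - 1) * J r) \<partial>lborel)"
    unfolding swap inner_r .
qed

text \<open>The closed form is split into the sum of a geometric series, which will produce zeta,
  and a Gaussian term, which will produce the ray integral.\<close>

lemma mordell_on_ray: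
  assumes a: "0 < a" "sqrt 2 * a < 1" and r: "r > 0"
  shows "kint (\<lambda>z. exp (of_real pi * z\<^sup>2 - of_real r * z)) a
     = 1 / (exp (of_real r / kap) - 1) - of_real (exp (- r\<^sup>2 / (4 * pi))) / kern (kap * of_real (r / (2 * pi)))"
proof -
  \<comment> \<open>Since \<open>kap\<close> squares to \<open>\<i>\<close>, this choice turns the
    linear exponent 2 pi i y kap of the Mordell integral into -r.\<close>
  define y where "y = kap * of_real (r / (2 * pi))"
  have iy: "2 * pi * \<i> * y = - (of_real r / kap)"
  proof -
    have "of_real r / kap = of_real r * (- \<i> * kap)" by (simp only: divide_inverse inverse_kap)
    then show ?thesis by (simp only: y_def) simp
  qed
  have "2 * pi * \<i> * y * kap = - of_real r" unfolding iy by simp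
  then have J: "kint (\<lambda>z. exp (of_real pi * z\<^sup>2 - of_real r * z)) a * (exp (of_real r / kap) - 1)
      = 1 - exp (pi * \<i> * (y\<^sup>2 - y))"
    using mordell_integral[OF a, of y] iy by simp
  have "Re (of_real r / kap) = r / sqrt 2" by (rule Re_divide_kap)
  then have "norm (exp (of_real r / kap)) > 1" using r by (simp add: norm_exp_eq_Re)
  then have ne: "exp (of_real r / kap) - 1 \<noteq> 0" by (metis eq_iff_diff_eq_0 norm_one less_irrefl)
  have yy: "pi * \<i> * y\<^sup>2 = of_real (- r\<^sup>2 / (4 * pi))"
    by (simp add: y_def power_mult_distrib kap_square power_divide) (simp add: power2_eq_square field_simps)
  have E: "exp (of_real r / kap) = exp (- (pi * \<i> * y)) * exp (- (pi * \<i> * y))"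
  proof -
    have "of_real r / kap = - (pi * \<i> * y) + - (pi * \<i> * y)" using arg_cong[OF iy, of uminus] by (simp add: algebra_simps)
    then show ?thesis by (simp only: exp_add)
  qed
  have "kern y = exp (pi * \<i> * y) * (exp (of_real r / kap) - 1)"
    unfolding E kern_def by (simp add: exp_minus field_simps)
  then have kern_y: "kern y = exp (pi * \<i> * y) * (exp (of_real r / kap) - 1)" .
  have q: "exp (pi * \<i> * (y\<^sup>2 - y)) / (exp (of_real r / kap) - 1) = of_real (exp (- r\<^sup>2 / (4 * pi))) / kern y"
    unfolding right_diff_distrib exp_diff yy exp_of_real by (simp only: kern_y divide_divide_eq_left)
  have "kint (\<lambda>z. exp (of_real pi * z\<^sup>2 - of_real r * z)) a
      = (1 - exp (pi * \<i> * (y\<^sup>2 - y))) / (exp (of_real r / kap) - 1)"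
    by (rule nonzero_eq_divide_eq[THEN iffD2, OF ne J])
  then show ?thesis unfolding diff_divide_distrib q unfolding y_def .
qed

text \<open>1/(exp(r/kap) - 1) is the sum of exp(-n r/kap) over n >= 1, and the Mellin transform of
  each term is \<open>Gamma w\<close> times (n/kap)^(-w). Summation gives the zeta series up to a
  factor; inserting the Mordell value instead gives the other side.\<close>

lemma zeta_mellin:
  fixes w :: complex
  assumes a: "0 < a" "sqrt 2 * a < 1" and w: "Re w > 1"
  shows "(\<lambda>n. of_nat (Suc n) powr (- w)) sums
     (kint (pker w) a + exp (- w * (pi / 4 * \<i>)) * (2 * pi) powr w / Gamma w * (\<integral>t. hker w t \<partial>lborel))"
proof -
  have nonint: "sqrt 2 * a \<notin> \<int>" using a by (intro between_0_1_not_Ints) auto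
  have w0: "Re w > 0" using w by simp
  have G0: "Gamma w \<noteq> 0" using w by (auto simp: Gamma_eq_zero_iff elim!: nonpos_Ints_cases)
  define J where "J = (\<lambda>r. kint (\<lambda>z. exp (of_real pi * z\<^sup>2 - of_real r * z)) a)"
  define c where "c = exp (- w * (pi / 4 * \<i>))"
  \<comment> \<open>\<open>A\<close> carries the Mordell integral, \<open>B\<close> its Gaussian
    term and \<open>D\<close> the geometric term, so that \<open>D r = A r + B r\<close>.\<close>
  define A where "A r = indicator {0<..} r *\<^sub>R (of_real r powr (w - 1) * J r)" for r :: real
  define B where "B r = indicator {0<..} r *\<^sub>R (of_real r powr (w - 1) * (of_real (exp (- r\<^sup>2 / (4 * pi))) / kern (kap * of_real (r / (2 * pi)))))" for r :: real
  define D where "D r = indicator {0<..} r *\<^sub>R (of_real r powr (w - 1) * (1 / (exp (of_real r / kap) - 1)))" for r :: real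
  have B_eq: "B (0 + (2 * pi) * t) = (2 * pi) powr (w - 1) * hker w t" for t
  proof -
    have "- (2 * pi * t)\<^sup>2 / (4 * pi) = - (pi * t\<^sup>2)" by (simp add: power2_eq_square)
    moreover have "of_real (2 * pi * t) powr (w - 1) = of_real (2 * pi) powr (w - 1) * of_real t powr (w - 1)" if "t > 0"
      using that powr_times_real[of "of_real (2 * pi)" "of_real t" "w - 1"] by simp
    ultimately show ?thesis
      by (auto simp: B_def hker_def indicator_def zero_less_mult_iff simp flip: exp_of_real)
  qed
  have B_int: "integrable lborel B"
  proof -
    have "integrable lborel (\<lambda>t. B (0 + (2 * pi) * t))" unfolding B_eq
      by (intro integrable_mult_right hker_integrable w)
    then show ?thesis by (subst (asm) lborel_integrable_real_affine_iff) auto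
  qed
  have "(\<integral>r. B r \<partial>lborel) = \<bar>2 * pi\<bar> *\<^sub>R (\<integral>t. B (0 + (2 * pi) * t) \<partial>lborel)"
    by (rule lborel_integral_real_affine) simp
  also have "\<dots> = (2 * pi) * (2 * pi) powr (w - 1) * (\<integral>t. hker w t \<partial>lborel)"
    unfolding B_eq integral_mult_right_zero by (simp add: scaleR_conv_of_real)
  also have "(2 * pi) * (2 * pi) powr (w - 1) = (2 * pi) powr w"
    by (simp add: powr_diff)
  finally have B_val: "(\<integral>r. B r \<partial>lborel) = (2 * pi) powr w * (\<integral>t. hker w t \<partial>lborel)" .
  have A_val: "Gamma w * kint (pker w) a = c * (\<integral>r. A r \<partial>lborel)"
    unfolding A_def J_def c_def by (rule mellin_swap(1)[OF a(1) nonint w0])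
  have A_int: "integrable lborel A" unfolding A_def[abs_def] J_def by (rule mellin_swap(2)[OF a(1) nonint w0])
  have D_eq: "D r = A r + B r" for r
  proof (cases "r > 0")
    case True
    have mord: "1 / (exp (of_real r / kap) - 1)
        = J r + of_real (exp (- r\<^sup>2 / (4 * pi))) / kern (kap * of_real (r / (2 * pi)))"
      using mordell_on_ray[OF a True] by (simp add: J_def)
    show ?thesis unfolding A_def B_def D_def mord distrib_left scaleR_add_right ..
  qed (simp add: A_def B_def D_def)
  define S where "S = (\<lambda>N r. indicator {0<..} r *\<^sub>R (of_real r powr (w - 1) * (\<Sum>n<N. exp (- (of_nat (Suc n) / kap) * of_real r))))"
  have S_val: "(\<integral>r. S N r \<partial>lborel) = (\<Sum>n<N. Gamma w * of_nat (Suc n) powr (- w) / c)" for N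
  proof -
    have Re_pos: "Re (of_nat (Suc n) / kap) > 0" for n
    proof -
      have Re: "Re (of_nat (Suc n) / kap) = real (Suc n) * Re (inverse kap)"
        by (simp add: divide_inverse del: of_nat_Suc)
      show ?thesis unfolding Re Re_inverse_kap by simp
    qed
    define T where "T n r = indicator {0<..} r *\<^sub>R (of_real r powr (w - 1) * exp (- (of_nat (Suc n) / kap) * of_real r))"
      for n and r :: real
    have T_int: "integrable lborel (T n)" for n
      unfolding T_def[abs_def] by (rule gint_integrable[OF w0 Re_pos])
    have "S N r = (\<Sum>n<N. T n r)" for r
      unfolding S_def T_def sum_distrib_left scaleR_sum_right ..
    then have "(\<integral>r. S N r \<partial>lborel) = (\<integral>r. (\<Sum>n<N. T n r) \<partial>lborel)" by (simp only:)
    also have "\<dots> = (\<Sum>n<N. \<integral>r. T n r \<partial>lborel)"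
      by (rule Bochner_Integration.integral_sum) (rule T_int)
    also have "\<dots> = (\<Sum>n<N. gint w (of_nat (Suc n) / kap))" unfolding T_def gint_def ..
    also have "\<dots> = (\<Sum>n<N. Gamma w * of_nat (Suc n) powr (- w) / c)"
    proof (intro sum.cong refl)
      fix n
      have "Ln (of_nat (Suc n)) = Ln (of_nat (Suc n) / kap) + pi / 4 * \<i>"
        using Ln_kap_mult[OF Re_pos[of n]] by simp
      then have "of_nat (Suc n) powr (- w) = exp (- w * Ln (of_nat (Suc n) / kap)) * c"
        by (simp add: powr_def c_def distrib_left exp_add[symmetric] del: of_nat_Suc)
      then show "gint w (of_nat (Suc n) / kap) = Gamma w * of_nat (Suc n) powr (- w) / c"
        unfolding gint_eq[OF w0 Re_pos] by (simp add: c_def)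
    qed
    finally show ?thesis .
  qed
  have geo: "norm (exp (- (1 / kap) * of_real r)) < 1" if "r > 0" for r
    using that unfolding norm_exp_ray by simp
  have geo_n: "exp (- (of_nat (Suc n) / kap) * of_real r) = exp (- (1 / kap) * of_real r) ^ Suc n" for n r
  proof -
    have "- (of_nat (Suc n) / kap) * of_real r = of_nat (Suc n) * (- (1 / kap) * of_real r)" by simp
    then show ?thesis by (simp only: exp_of_nat_mult)
  qed
  have "(\<lambda>N. \<integral>r. S N r \<partial>lborel) \<longlonglongrightarrow> (\<integral>r. D r \<partial>lborel)"
  proof (rule integral_dominated_convergence[where w = "\<lambda>r. sqrt 2 * (indicator {0<..} r *\<^sub>R (r powr ((Re w - 1) - 1) * exp (- (1 / (2 * sqrt 2)) * r)))"])
    show "integrable lborel (\<lambda>r. sqrt 2 * (indicator {0<..} r *\<^sub>R (r powr ((Re w - 1) - 1) * exp (- (1 / (2 * sqrt 2)) * r))))"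
      using w by (intro integrable_mult_right gint_integrable_real) auto
    show "S N \<in> borel_measurable lborel" for N unfolding S_def by measurable
    show "D \<in> borel_measurable lborel" unfolding D_def[abs_def] by measurable
    show "AE r in lborel. (\<lambda>N. S N r) \<longlonglongrightarrow> D r"
    proof (rule AE_I2)
      fix r :: real
      show "(\<lambda>N. S N r) \<longlonglongrightarrow> D r"
      proof (cases "r > 0")
        case True
        define q where "q = exp (- (1 / kap) * of_real r)"
        have "norm q < 1" using geo[OF True] by (simp add: q_def)
        then have "(\<lambda>n. q * q ^ n) sums (q * (1 / (1 - q)))"
          by (intro sums_mult geometric_sums)
        then have "(\<lambda>N. \<Sum>n<N. q ^ Suc n) \<longlonglongrightarrow> q / (1 - q)" by (simp add: sums_def)
        also have "q / (1 - q) = 1 / (exp (of_real r / kap) - 1)"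
          by (simp add: q_def exp_minus field_simps)
        finally have "(\<lambda>N. \<Sum>n<N. q ^ Suc n) \<longlonglongrightarrow> 1 / (exp (of_real r / kap) - 1)" .
        from tendsto_mult_left[OF this, of "of_real r powr (w - 1)"] show ?thesis
          unfolding S_def D_def geo_n q_def[symmetric] using True by simp
      qed (simp add: S_def D_def)
    qed
    show "AE r in lborel. norm (S N r) \<le> sqrt 2 * (indicator {0<..} r *\<^sub>R (r powr ((Re w - 1) - 1) * exp (- (1 / (2 * sqrt 2)) * r)))" for N
    proof (rule AE_I2)
      fix r :: real
      show "norm (S N r) \<le> sqrt 2 * (indicator {0<..} r *\<^sub>R (r powr ((Re w - 1) - 1) * exp (- (1 / (2 * sqrt 2)) * r)))"
      proof (cases "r > 0")
        case True
        define p where "p = r / sqrt 2"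
        have p: "p > 0" using True by (simp add: p_def)
        have nq: "norm (exp (- (1 / kap) * of_real r)) = exp (- p)"
          unfolding norm_exp_ray p_def ..
        have "norm (\<Sum>n<N. exp (- (1 / kap) * of_real r) ^ Suc n) \<le> (\<Sum>n<N. exp (- p) ^ Suc n)"
          by (rule sum_norm_le) (simp only: norm_power nq order_refl)
        also have "(\<Sum>n<N. exp (- p) ^ Suc n) \<le> exp (- p) / (1 - exp (- p))"
        proof -
          have "(\<lambda>n. exp (- p) * exp (- p) ^ n) sums (exp (- p) * (1 / (1 - exp (- p))))"
            by (intro sums_mult geometric_sums) (use p in simp)
          then have sums: "(\<lambda>n. exp (- p) ^ Suc n) sums (exp (- p) / (1 - exp (- p)))" by simp
          have "(\<Sum>n<N. exp (- p) ^ Suc n) \<le> (\<Sum>n. exp (- p) ^ Suc n)"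
            by (rule sum_le_suminf[OF sums_summable[OF sums]]) auto
          then show ?thesis using sums_unique[OF sums] by (simp only:)
        qed
        \<comment> \<open>A majorant independent of N: p <= 2 sinh(p/2) bounds 1 - exp(-p) below by
          p exp(-p/2). The factor 1/p costs one power of r, which is affordable for Re w >
          1.\<close>
        also have "\<dots> \<le> exp (- (p / 2)) / p"
        proof -
          have "p / 2 \<le> sinh (p / 2)" using abs_le_abs_sinh[of "p / 2"] p by simp
          then have "p \<le> 2 * sinh (p / 2)" by linarith
          also have "\<dots> = exp (p / 2) - exp (- (p / 2))" by (simp add: sinh_field_def)
          finally have "p \<le> exp (p / 2) - exp (- (p / 2))" .
          then have "p * exp (- (p / 2)) \<le> (exp (p / 2) - exp (- (p / 2))) * exp (- (p / 2))"
            by (intro mult_right_mono) auto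
          also have "\<dots> = 1 - exp (- p)" by (simp add: left_diff_distrib flip: exp_add)
          finally have "p * exp (- (p / 2)) \<le> 1 - exp (- p)" .
          then have "exp (- p) / (1 - exp (- p)) \<le> exp (- p) / (p * exp (- (p / 2)))"
            using p by (intro divide_left_mono mult_pos_pos) auto
          also have "exp (- p) / (p * exp (- (p / 2))) = exp (- (p / 2)) / p"
          proof -
            have "exp (- p) = exp (- (p / 2)) * exp (- (p / 2))" by (simp flip: exp_add)
            then show ?thesis by (simp only:) simp
          qed
          finally show ?thesis .
        qed
        finally have le: "norm (\<Sum>n<N. exp (- (1 / kap) * of_real r) ^ Suc n) \<le> exp (- (p / 2)) / p" .
        have "norm (S N r) = r powr (Re w - 1) * norm (\<Sum>n<N. exp (- (1 / kap) * of_real r) ^ Suc n)"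
          unfolding S_def geo_n using True by (simp add: norm_mult norm_powr_real_powr del: power_Suc)
        also have "\<dots> \<le> r powr (Re w - 1) * (exp (- (p / 2)) / p)"
          by (intro mult_left_mono le) auto
        also have "\<dots> = sqrt 2 * (r powr ((Re w - 1) - 1) * exp (- (1 / (2 * sqrt 2)) * r))"
          using True by (simp add: powr_diff p_def power2_eq_square mult_ac)
        finally show ?thesis using True by simp
      qed (simp add: S_def)
    qed
  qed
  then have "(\<lambda>N. (c / Gamma w) * (\<Sum>n<N. Gamma w * of_nat (Suc n) powr (- w) / c)) \<longlonglongrightarrow> (c / Gamma w) * (\<integral>r. D r \<partial>lborel)"
    unfolding S_val by (intro tendsto_intros)
  moreover have "(c / Gamma w) * (\<Sum>n<N. Gamma w * of_nat (Suc n) powr (- w) / c) = (\<Sum>n<N. of_nat (Suc n) powr (- w))" for N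
    using G0 by (simp add: sum_distrib_left c_def del: of_nat_Suc)
  moreover have "(c / Gamma w) * (\<integral>r. D r \<partial>lborel) = kint (pker w) a + c * (2 * pi) powr w / Gamma w * (\<integral>t. hker w t \<partial>lborel)"
  proof -
    have "(\<integral>r. D r \<partial>lborel) = (\<integral>r. A r \<partial>lborel) + (\<integral>r. B r \<partial>lborel)"
      unfolding D_eq by (rule Bochner_Integration.integral_add[OF A_int B_int])
    then have "c * (\<integral>r. D r \<partial>lborel) = Gamma w * kint (pker w) a + c * ((2 * pi) powr w * (\<integral>t. hker w t \<partial>lborel))"
      unfolding A_val B_val by (simp add: distrib_left)
    then show ?thesis using G0 by (simp add: field_simps)
  qed
  ultimately show ?thesis by (simp add: sums_def c_def)
qed

section \<open>Collapsing the line of integration onto the origin\<close>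

lemma sin_ge_linear:
  fixes x :: real
  assumes "0 \<le> x" "x \<le> 1" shows "5 / 6 * x \<le> sin x"
proof -
  have "\<bar>sin x - (\<Sum>m<3. sin_coeff m * x ^ m)\<bar> \<le> inverse (fact 3) * \<bar>x\<bar> ^ 3"
    by (rule Maclaurin_sin_bound)
  then have "\<bar>sin x - x\<bar> \<le> x ^ 3 / 6"
    using assms by (simp add: sin_coeff_def lessThan_Suc numeral_3_eq_3 eval_nat_numeral fact_numeral)
  moreover have "x ^ 3 \<le> x" using power_decreasing[of 1 3 x] assms by simp
  ultimately show ?thesis by linarith
qed

text \<open>The constant 3 does not depend on \<open>a\<close>, which is what domination needs as
  \<open>a\<close> tends to 0. The condition \<open>6 * a \<le> 1\<close> makes pi sqrt 2 a <= 1,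
  the range in which the sine is bounded below linearly.\<close>

lemma norm_le_kern_near_zero:
  assumes "0 < a" "6 * a \<le> 1"
  shows "norm (Complex a t) \<le> 3 * norm (kern (kap * Complex a t))"
proof -
  define K where "K = norm (kern (kap * Complex a t))"
  have s2: "sqrt 2 \<le> 3 / 2" by (rule real_le_lsqrt) (auto simp: power2_eq_square)
  have "sqrt 2 * a \<le> 3 / 2 * a" using s2 assms by (intro mult_right_mono) auto
  moreover have "pi * (sqrt 2 * a) \<le> 4 * (sqrt 2 * a)" using pi_less_4 assms by (intro mult_right_mono) auto
  ultimately have u: "0 \<le> pi * (sqrt 2 * a)" "pi * (sqrt 2 * a) \<le> 1" using assms by (simp, linarith)
  have s1: "1 \<le> sqrt 2" by simp
  have "1 * a \<le> sqrt 2 * a" using s1 assms by (intro mult_right_mono) auto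
  moreover have "2 * (sqrt 2 * a) \<le> pi * (sqrt 2 * a)" using pi_ge_two assms by (intro mult_right_mono) auto
  ultimately have "a \<le> 5 / 6 * (pi * (sqrt 2 * a))" using assms by linarith
  also have "\<dots> \<le> sin (pi * (sqrt 2 * a))" by (rule sin_ge_linear[OF u])
  also have "\<dots> \<le> \<bar>sin (pi * (sqrt 2 * a))\<bar>" by simp
  also have "\<dots> = 1 * \<bar>sin (pi * (sqrt 2 * a))\<bar>" by simp
  also have "\<dots> \<le> sqrt 2 * \<bar>sin (pi * (sqrt 2 * a))\<bar>" using s1 by (intro mult_right_mono) auto
  also have "\<dots> \<le> K" unfolding K_def by (rule norm_kern_line)
  finally have 1: "a \<le> K" .
  have "2 * \<bar>a + t\<bar> \<le> 2 * pi / sqrt 2 * \<bar>a + t\<bar>"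
    using pi_ge_two s2 by (intro mult_right_mono) (auto simp: field_simps)
  also have "\<dots> = 2 * pi * \<bar>Im (kap * Complex a t)\<bar>" by (simp only: Im_kap_mult) simp
  also have "\<dots> \<le> K" unfolding K_def by (rule norm_kern_ge_Im)
  finally have 2: "2 * \<bar>a + t\<bar> \<le> K" .
  have "norm (Complex a t) \<le> a + \<bar>t\<bar>" using cmod_le[of "Complex a t"] assms by simp
  also have "\<dots> \<le> 2 * a + \<bar>a + t\<bar>" using assms by linarith
  also have "\<dots> \<le> 2 * K + K / 2" using 1 2 by (intro add_mono) auto
  also have "\<dots> \<le> 3 * K" using 1 assms by simp
  finally show ?thesis by (simp add: K_def)
qed

text \<open>A majorant free of \<open>a\<close>. The strip is dictated here: Re v < 2 makes the
  exponent Re v - 2 negative, so |z| may be replaced by |t|, and Re v > 1 makes the resulting power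
  integrable at 0.\<close>

lemma pker_div_kern_near_zero:
  assumes v: "1 < Re v" "Re v < 2" and a: "0 < a" "6 * a \<le> 1" and "t \<noteq> 0"
  shows "norm (pker (1 - v) (Complex a t) / kern (kap * Complex a t) * (kap * \<i>))
     \<le> 3 * exp (pi * \<bar>Im v\<bar> + pi) * (\<bar>t\<bar> powr ((Re v - 1) - 1) * exp (- (pi * t\<^sup>2)))"
proof -
  define z where "z = Complex a t"
  define K where "K = norm (kern (kap * z))"
  have z: "norm z > 0" "z \<noteq> 0" using a by (auto simp: z_def complex_eq_iff)
  have K: "norm z \<le> 3 * K" using norm_le_kern_near_zero[OF a] by (simp add: z_def K_def)
  then have "K > 0" using z by linarith
  have "kap * z \<noteq> 0" using z by simp
  then have "\<bar>Im (Ln (kap * z))\<bar> \<le> pi" using mpi_less_Im_Ln[of "kap * z"] Im_Ln_le_pi[of "kap * z"] by linarith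
  then have "\<bar>Im v * Im (Ln (kap * z))\<bar> \<le> \<bar>Im v\<bar> * pi" unfolding abs_mult by (rule mult_left_mono) simp
  then have "- (Im v * Im (Ln (kap * z))) \<le> pi * \<bar>Im v\<bar>" by (simp add: abs_le_iff mult.commute)
  moreover have "Re (Ln (kap * z)) = ln (norm z)" using z by (simp add: norm_mult)
  then have "Re (- (1 - v) * Ln (kap * z)) = (Re v - 1) * ln (norm z) - Im v * Im (Ln (kap * z))"
    by (simp add: algebra_simps)
  ultimately have 1: "Re (- (1 - v) * Ln (kap * z)) \<le> (Re v - 1) * ln (norm z) + pi * \<bar>Im v\<bar>"
    by linarith
  have "a\<^sup>2 \<le> 1" using a by (simp add: power_le_one)
  then have "pi * a\<^sup>2 \<le> pi" by simp
  then have 2: "pi * (a\<^sup>2 - t\<^sup>2) \<le> pi - pi * t\<^sup>2" unfolding right_diff_distrib by simp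
  have "norm (pker (1 - v) z) = exp (Re (- (1 - v) * Ln (kap * z))) * exp (pi * (a\<^sup>2 - t\<^sup>2))"
    unfolding pker_def exp_add norm_mult z_def norm_exp_gauss[symmetric] by (simp add: norm_exp_eq_Re)
  also have "\<dots> \<le> exp ((Re v - 1) * ln (norm z) + pi * \<bar>Im v\<bar>) * exp (pi - pi * t\<^sup>2)"
    using 1 2 by (intro mult_mono) auto
  also have "\<dots> = norm z powr (Re v - 1) * (exp (pi * \<bar>Im v\<bar> + pi) * exp (- (pi * t\<^sup>2)))"
    using z by (simp add: powr_def flip: exp_add)
  finally have "norm (pker (1 - v) z) / K \<le> norm z powr (Re v - 1) * (exp (pi * \<bar>Im v\<bar> + pi) * exp (- (pi * t\<^sup>2))) / K"
    using \<open>K > 0\<close> by (intro divide_right_mono) auto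
  also have "\<dots> \<le> norm z powr (Re v - 1) * (exp (pi * \<bar>Im v\<bar> + pi) * exp (- (pi * t\<^sup>2))) / (norm z / 3)"
    using K z \<open>K > 0\<close> by (intro divide_left_mono mult_pos_pos) auto
  also have "\<dots> = 3 * exp (pi * \<bar>Im v\<bar> + pi) * (norm z powr ((Re v - 1) - 1) * exp (- (pi * t\<^sup>2)))"
  proof -
    have "norm z powr ((Re v - 1) - 1) = norm z powr (Re v - 1) / norm z"
      using z by (subst powr_diff) simp
    then show ?thesis by (simp only:) simp
  qed
  also have "\<dots> \<le> 3 * exp (pi * \<bar>Im v\<bar> + pi) * (\<bar>t\<bar> powr ((Re v - 1) - 1) * exp (- (pi * t\<^sup>2)))"
  proof (intro mult_left_mono mult_right_mono)
    have "\<bar>t\<bar> \<le> norm z" using abs_Im_le_cmod[of z] by (simp add: z_def)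
    then show "norm z powr ((Re v - 1) - 1) \<le> \<bar>t\<bar> powr ((Re v - 1) - 1)"
      using v \<open>t \<noteq> 0\<close> by (intro powr_mono2') auto
  qed auto
  finally show ?thesis by (simp add: norm_mult norm_divide z_def K_def)
qed

lemma kint_pker_const:
  assumes "0 < a" "sqrt 2 * a < 1" "0 < b" "sqrt 2 * b < 1"
  shows "kint (pker w) a = kint (pker w) b"
proof -
  have nonint: "sqrt 2 * x \<notin> \<int>" if "0 < x" "sqrt 2 * x < 1" for x
    using that by (intro between_0_1_not_Ints) auto
  have less: "kint (pker w) x = kint (pker w) y" if "0 < x" "x < y" "sqrt 2 * y < 1" for x y
  proof -
    have x: "0 < sqrt 2 * x" "sqrt 2 * x < sqrt 2 * y" using that by auto
    then have x1: "sqrt 2 * x < 1" using that by linarith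
    have "{n. sqrt 2 * x < real n \<and> real n < sqrt 2 * y} = {}"
    proof (intro equals0I, clarify)
      fix n assume "sqrt 2 * x < real n" "real n < sqrt 2 * y"
      then have "0 < real n" "real n < 1" using x that by linarith+
      then show False by simp
    qed
    moreover have "kint (pker w) x = (\<Sum>n | sqrt 2 * x < real n \<and> real n < sqrt 2 * y. of_nat n powr (- w)) + kint (pker w) y"
      using that x1 by (intro kint_pker_shift nonint) auto
    ultimately show ?thesis by (simp only: sum.empty add_0_left)
  qed
  consider "a < b" | "a = b" | "b < a" by linarith
  then show ?thesis
  proof cases
    case 1 then show ?thesis using assms by (intro less)
  next
    case 3 then show ?thesis using assms by (intro less[symmetric])
  qed simp
qed

lemma kern_minus: "kern (- x) = - kern x"
  by (simp add: kern_def)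

lemma cnj_kern: "cnj (kern x) = - kern (cnj x)"
  by (simp add: kern_def exp_cnj)

lemma cnj_kap: "cnj kap = - \<i> * kap"
  by (simp add: kap_eq complex_eq_iff)

text \<open>Conjugation sends the ray of direction \<open>kap\<close> to that of direction
  \<open>- \<i> * kap\<close>; oddness of \<open>kern\<close> reflects it to
  \<open>kap * \<i>\<close>, the upper half of the collapsed line.\<close>

lemma cnj_hker:
  assumes "t > 0"
  shows "cnj (hker (cnj v) t) = exp ((v - 1) * of_real (ln t)) * exp (- (pi * t\<^sup>2)) / kern (kap * \<i> * of_real t)"
proof -
  have "cnj (kern (kap * of_real t)) = - kern (- (kap * \<i> * of_real t))"
    unfolding cnj_kern by (simp add: cnj_kap mult_ac)
  then have "cnj (kern (kap * of_real t)) = kern (kap * \<i> * of_real t)" by (simp add: kern_minus)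
  moreover have "of_real t powr (cnj v - 1) = exp ((cnj v - 1) * of_real (ln t))"
    using assms by (simp add: powr_def Ln_of_real)
  ultimately show ?thesis using assms by (simp add: hker_def exp_cnj)
qed

text \<open>In the limit \<open>a\<close> to 0 the line becomes two opposite rays from 0, with
  arguments 3 pi/4 and -pi/4. Each carries the same integral, with a phase coming from its argument
  and a relative sign from the oddness of \<open>kern\<close>.\<close>

lemma kint_near_zero:
  assumes v: "1 < Re v" "Re v < 2" and a: "0 < a" "sqrt 2 * a < 1"
  shows "kint (pker (1 - v)) a = kap * \<i> * (exp ((v - 1) * (3 * pi / 4 * \<i>)) - exp (- (v - 1) * (pi / 4 * \<i>)))
            * cnj (\<integral>t. hker (cnj v) t \<partial>lborel)"
proof -
  define G where "G b t = pker (1 - v) (Complex b t) / kern (kap * Complex b t) * (kap * \<i>)" for b t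
  \<comment> \<open>Starting at 1/6 keeps every line in the range of the uniform bound.\<close>
  define X where "X n = 1 / (real n + 6)" for n
  define q where "q t = cnj (hker (cnj v) t)" for t
  define e1 where "e1 = exp ((v - 1) * (3 * pi / 4 * \<i>))"
  define e2 where "e2 = exp (- (v - 1) * (pi / 4 * \<i>))"
  define h where "h t = indicator {0<..} t *\<^sub>R (t powr ((Re v - 1) - 1) * exp (- (pi * t\<^sup>2)))" for t :: real
  have X: "0 < X n" "6 * X n \<le> 1" for n by (auto simp: X_def field_simps)
  have X0: "X \<longlonglongrightarrow> 0" unfolding X_def by real_asymp
  have Xs: "sqrt 2 * X n < 1" for n
  proof -
    have "sqrt 2 < 2" by (rule real_less_lsqrt) (auto simp: power2_eq_square)
    then have "sqrt 2 * X n < 2 * X n" using X by (intro mult_strict_right_mono) auto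
    then show ?thesis using X[of n] by linarith
  qed
  have h_int: "integrable lborel h" unfolding h_def[abs_def] using v by (intro integrable_powr_gauss) auto
  have h_int': "integrable lborel (\<lambda>t. h (- t))"
    using lborel_integrable_real_affine[OF h_int, of "-1" 0] by simp
  have "(\<lambda>n. \<integral>t. G (X n) t \<partial>lborel) \<longlonglongrightarrow> (\<integral>t. G 0 t \<partial>lborel)"
  proof (rule integral_dominated_convergence[where w = "\<lambda>t. 3 * exp (pi * \<bar>Im v\<bar> + pi) * (h t + h (- t))"])
    show "integrable lborel (\<lambda>t. 3 * exp (pi * \<bar>Im v\<bar> + pi) * (h t + h (- t)))"
      using h_int h_int' by (intro integrable_mult_right Bochner_Integration.integrable_add)
    show "G (X n) \<in> borel_measurable lborel" for n unfolding G_def[abs_def] pker_def by measurable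
    show "G 0 \<in> borel_measurable lborel" unfolding G_def[abs_def] pker_def by measurable
    have "AE t in lborel. t \<noteq> (0::real)" by (rule AE_lborel_singleton)
    then show "AE t in lborel. (\<lambda>n. G (X n) t) \<longlonglongrightarrow> G 0 t"
    proof eventually_elim
      fix t :: real assume t: "t \<noteq> 0"
      have Re_t: "Re (kap * Complex 0 t) = - t / sqrt 2" "Im (kap * Complex 0 t) = t / sqrt 2"
        by (simp_all only: Re_kap_mult Im_kap_mult) simp_all
      have 1: "kap * Complex 0 t \<notin> \<real>\<^sub>\<le>\<^sub>0" unfolding complex_nonpos_Reals_iff Re_t using t by simp
      have "kap * Complex 0 t \<notin> \<int>"
      proof
        assume "kap * Complex 0 t \<in> \<int>"
        then obtain k :: int where "kap * Complex 0 t = of_int k" by (rule Ints_cases)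
        then have "Im (kap * Complex 0 t) = 0" by (simp only: complex_Im_of_int)
        then show False unfolding Re_t using t by simp
      qed
      then have 2: "kern (kap * Complex 0 t) \<noteq> 0" by (simp add: kern_eq_0_iff)
      have 3: "(\<lambda>n. kern (kap * Complex (X n) t)) \<longlonglongrightarrow> kern (kap * Complex 0 t)"
        unfolding kern_def using X0 by (intro tendsto_intros)
      have 4: "(\<lambda>n. pker (1 - v) (Complex (X n) t)) \<longlonglongrightarrow> pker (1 - v) (Complex 0 t)"
        unfolding pker_def using X0 1 by (intro tendsto_intros)
      show "(\<lambda>n. G (X n) t) \<longlonglongrightarrow> G 0 t"
        unfolding G_def using 2 3 4 by (intro tendsto_intros)
    qed
    show "AE t in lborel. norm (G (X n) t) \<le> 3 * exp (pi * \<bar>Im v\<bar> + pi) * (h t + h (- t))" for n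
      using \<open>AE t in lborel. t \<noteq> (0::real)\<close>
    proof eventually_elim
      fix t :: real assume t: "t \<noteq> 0"
      have "h t + h (- t) = \<bar>t\<bar> powr ((Re v - 1) - 1) * exp (- (pi * t\<^sup>2))"
        using t by (cases "t > 0") (auto simp: h_def)
      then show "norm (G (X n) t) \<le> 3 * exp (pi * \<bar>Im v\<bar> + pi) * (h t + h (- t))"
        using pker_div_kern_near_zero[OF v X t, of n] by (simp add: G_def)
    qed
  qed
  moreover have "(\<integral>t. G (X n) t \<partial>lborel) = kint (pker (1 - v)) a" for n
    using kint_pker_const[OF X(1) Xs a] by (simp add: kint_def G_def)
  ultimately have "(\<lambda>n. kint (pker (1 - v)) a) \<longlonglongrightarrow> (\<integral>t. G 0 t \<partial>lborel)" by (simp only:)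
  then have lim: "kint (pker (1 - v)) a = (\<integral>t. G 0 t \<partial>lborel)" by (simp add: LIMSEQ_const_iff)
  have ln1: "Ln (kap * Complex 0 t) = of_real (ln t) + 3 * pi / 4 * \<i>" if "t > 0" for t
  proof -
    have "kap * Complex 0 t = of_real t * cis (3 * pi / 4)"
    proof -
      have "pi / 4 + pi / 2 = 3 * pi / 4" by simp
      then have "cis (3 * pi / 4) = cis (pi / 4) * cis (pi / 2)" by (simp only: cis_mult)
      then show ?thesis by (simp add: kap_def cis_pi_half Complex_eq mult_ac)
    qed
    also have "Ln \<dots> = of_real (ln t) + Ln (cis (3 * pi / 4))" using that by (simp add: Ln_times_of_real Ln_of_real)
    also have "Ln (cis (3 * pi / 4)) = 3 * pi / 4 * \<i>" by (subst Ln_cis) (auto simp: pi_gt_zero)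
    finally show ?thesis .
  qed
  have ln2: "Ln (kap * Complex 0 (- t)) = of_real (ln t) - pi / 4 * \<i>" if "t > 0" for t
  proof -
    have "kap * Complex 0 (- t) = of_real t * cis (- pi / 4)"
    proof -
      have "pi / 4 + - (pi / 2) = - pi / 4" by simp
      then have "cis (- pi / 4) = cis (pi / 4) * cis (- (pi / 2))" by (simp only: cis_mult)
      then show ?thesis by (simp add: kap_def Complex_eq mult_ac cis_pi_half flip: cis_cnj)
    qed
    also have "Ln \<dots> = of_real (ln t) + Ln (cis (- pi / 4))" using that by (simp add: Ln_times_of_real Ln_of_real)
    also have "Ln (cis (- pi / 4)) = - pi / 4 * \<i>" proof -
      have m: "- pi / 4 \<in> {-pi<..pi}" unfolding greaterThanAtMost_iff using pi_gt_zero by linarith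
      show ?thesis by (simp only: Ln_cis[OF m])
    qed
    finally show ?thesis by simp
  qed
  have gauss: "exp (of_real pi * (Complex 0 t)\<^sup>2) = of_real (exp (- (pi * t\<^sup>2)))" for t
  proof -
    have "of_real pi * (Complex 0 t)\<^sup>2 = complex_of_real (- (pi * t\<^sup>2))"
      by (simp add: complex_eq_iff power2_eq_square)
    then show ?thesis by (simp only: exp_of_real)
  qed
  have i1: "kap * Complex 0 t = kap * \<i> * of_real t" for t by (simp add: Complex_eq)
  have G0: "G 0 t = kap * \<i> * (e1 * q t - e2 * q (- t))" for t
  proof (cases t "0::real" rule: linorder_cases)
    case equal
    \<comment> \<open>At the origin both sides are 0, the left one because division by 0 gives
      0.\<close>
    have "kern 0 = 0" by (simp add: kern_def)
    then show ?thesis using equal by (simp add: G_def q_def hker_def Complex_eq)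
  next
    case greater
    have "q (- t) = 0" using greater by (simp add: q_def hker_def)
    moreover have "pker (1 - v) (Complex 0 t) = e1 * exp ((v - 1) * of_real (ln t)) * exp (- (pi * t\<^sup>2))"
    proof -
      have "- (1 - v) * (of_real (ln t) + 3 * pi / 4 * \<i>) = (v - 1) * (3 * pi / 4 * \<i>) + (v - 1) * of_real (ln t)"
        by (simp add: algebra_simps)
      then show ?thesis by (simp only: pker_def ln1[OF greater] exp_add gauss e1_def)
    qed
    ultimately show ?thesis using greater
      by (simp add: G_def q_def cnj_hker i1)
  next
    case less
    define u where "u = - t"
    have u: "u > 0" "t = - u" using less by (auto simp: u_def)
    have "q t = 0" using less by (simp add: q_def hker_def)
    moreover have "pker (1 - v) (Complex 0 (- u)) = e2 * exp ((v - 1) * of_real (ln u)) * exp (- (pi * u\<^sup>2))"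
    proof -
      have "- (1 - v) * (of_real (ln u) - pi / 4 * \<i>) = - (v - 1) * (pi / 4 * \<i>) + (v - 1) * of_real (ln u)"
        by (simp add: field_simps)
      then show ?thesis using gauss[of "- u"] by (simp only: pker_def ln2[OF u(1)] exp_add e2_def power2_minus)
    qed
    moreover have "kern (kap * Complex 0 (- u)) = - kern (kap * \<i> * of_real u)"
      unfolding i1 by (simp flip: kern_minus)
    ultimately show ?thesis using u
      by (simp add: G_def q_def cnj_hker)
  qed
  have hk: "integrable lborel (hker (cnj v))" using v by (intro hker_integrable) auto
  have q_int: "integrable lborel q" unfolding q_def[abs_def] using hk by simp
  have q_int': "integrable lborel (\<lambda>t. q (- t))"
    using lborel_integrable_real_affine[OF q_int, of "-1" 0] by simp
  have q_refl: "(\<integral>t. q (- t) \<partial>lborel) = (\<integral>t. q t \<partial>lborel)"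
    using lborel_integral_real_affine[of "-1" q 0] by simp
  have "(\<integral>t. G 0 t \<partial>lborel) = kap * \<i> * (e1 * (\<integral>t. q t \<partial>lborel) - e2 * (\<integral>t. q (- t) \<partial>lborel))"
    unfolding G0 using q_int q_int' by simp
  also have "\<dots> = kap * \<i> * (e1 - e2) * (\<integral>t. q t \<partial>lborel)" unfolding q_refl by (simp add: algebra_simps)
  also have "(\<integral>t. q t \<partial>lborel) = cnj (\<integral>t. hker (cnj v) t \<partial>lborel)" unfolding q_def by simp
  finally show ?thesis unfolding lim e1_def e2_def .
qed

text \<open>Relative to exp(-pi i w/4) the phases of the two rays are exp(-pi i w/2) and exp(pi i
  w/2), so they add up to a cosine.\<close>

lemma cnj_kint_near_zero:
  assumes w: "1 < Re w" "Re w < 2" and a: "0 < a" "sqrt 2 * a < 1"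
  shows "cnj (kint (pker (1 - cnj w)) a) = 2 * cos (of_real pi * w / 2) * exp (- w * (pi / 4 * \<i>)) * (\<integral>t. hker w t \<partial>lborel)"
proof -
  define c where "c = exp (pi / 4 * \<i>)"
  have ck: "c = kap" by (simp add: c_def kap_def cis_conv_exp mult.commute)
  have "cnj (kint (pker (1 - cnj w)) a) = cnj kap * (- \<i>) *
     (exp ((w - 1) * (- (3 * pi / 4 * \<i>))) - exp (- (w - 1) * (- (pi / 4 * \<i>)))) * (\<integral>t. hker w t \<partial>lborel)"
    using kint_near_zero[of "cnj w" a] w a by (simp add: exp_cnj)
  also have "cnj kap * (- \<i>) * (exp ((w - 1) * (- (3 * pi / 4 * \<i>))) - exp (- (w - 1) * (- (pi / 4 * \<i>))))
      = 2 * cos (of_real pi * w / 2) * exp (- w * (pi / 4 * \<i>))"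
  proof -
    have 1: "exp ((w - 1) * (- (3 * pi / 4 * \<i>))) = exp (- w * (pi / 4 * \<i>)) * exp (- (\<i> * (of_real pi * w / 2))) * (c * c * c)"
      unfolding c_def exp_add[symmetric] by (rule arg_cong[where f = exp]) (simp add: field_simps)
    have 2: "exp (- (w - 1) * (- (pi / 4 * \<i>))) = exp (- w * (pi / 4 * \<i>)) * exp (\<i> * (of_real pi * w / 2)) * inverse c"
      unfolding c_def exp_minus[symmetric] exp_add[symmetric]
      by (rule arg_cong[where f = exp]) (simp add: field_simps)
    have 3: "c * c * c = \<i> * kap" "inverse c = - \<i> * kap"
      unfolding ck inverse_kap using kap_square by (auto simp: power2_eq_square)
    have kk: "kap * (kap * x) = \<i> * x" for x
      using kap_square by (simp add: power2_eq_square flip: mult.assoc)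
    have 4: "cnj kap * (- \<i>) * (\<i> * kap) = 1" "cnj kap * (- \<i>) * (- \<i> * kap) = - 1"
      by (simp_all add: cnj_kap mult_ac kk kk[of 1, simplified])
    have 5: "cnj kap * (- \<i>) * (A * E1 * (\<i> * kap) - A * E2 * (- \<i> * kap))
        = A * E1 * (cnj kap * (- \<i>) * (\<i> * kap)) - A * E2 * (cnj kap * (- \<i>) * (- \<i> * kap))" for A E1 E2
      by (simp add: algebra_simps)
    show ?thesis unfolding 1 2 3 5 4 cos_exp_eq by (simp add: algebra_simps)
  qed
  finally show ?thesis .
qed

section \<open>Zeta and Riemann's identity\<close>

text \<open>The line crosses the real axis at sqrt 2/2; by \<open>kint_pker_const\<close> any
  crossing point strictly between 0 and 1 gives the same function.\<close>

definition Rstar :: "complex \<Rightarrow> complex" where "Rstar w = kint (pker w) (1/2)"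

lemma half_line: "0 < (1/2::real)" "sqrt 2 * (1/2) < (1::real)" "sqrt 2 * (1/2) \<notin> \<int>"
proof -
  have "sqrt 2 < 2" by (rule real_less_lsqrt) (auto simp: power2_eq_square)
  then show lt: "sqrt 2 * (1/2) < (1::real)" by simp
  then show "sqrt 2 * (1/2) \<notin> \<int>" by (intro between_0_1_not_Ints) auto
qed simp

lemma Rstar_holomorphic [holomorphic_intros]: "f holomorphic_on A \<Longrightarrow> (\<lambda>w. Rstar (f w)) holomorphic_on A"
  using holomorphic_on_compose_gen[OF _ kint_pker_entire[OF half_line(1,3)], of f A]
  by (simp add: Rstar_def comp_def)

lemma cnj_Rstar_holomorphic: "(\<lambda>w. cnj (Rstar (1 - cnj w))) holomorphic_on A"
proof -
  have "(cnj \<circ> (\<lambda>w. Rstar (1 - w)) \<circ> cnj) holomorphic_on UNIV"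
    by (intro holomorphic_on_compose_cnj_cnj holomorphic_intros) auto
  then show ?thesis by (auto simp: comp_def intro: holomorphic_on_subset)
qed

section \<open>The factor chi\<close>

lemma chi_rGamma: "chi s = of_real pi powr (s - 1/2) * Gamma ((1 - s) / 2) * rGamma (s / 2)"
  unfolding chi_def rGamma_inverse_Gamma by (rule divide_inverse)

text \<open>The poles of the Gamma factor in the numerator are at 1, 3, 5, ...; the denominator
  enters through the entire function \<open>rGamma\<close>.\<close>

lemma chi_holomorphic: "chi holomorphic_on {s. Re s < 3} - {1}"
proof -
  have "(1 - s) / 2 \<notin> \<int>\<^sub>\<le>\<^sub>0" if "Re s < 3" "s \<noteq> 1" for s :: complex
  proof
    assume "(1 - s) / 2 \<in> \<int>\<^sub>\<le>\<^sub>0"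
    then obtain n where n: "(1 - s) / 2 = - of_nat n" by (elim nonpos_Ints_cases')
    then have s: "s = 1 + 2 * of_nat n" by (simp add: field_simps)
    then have "2 * real n < 2" using that by simp
    then have "n = 0" by simp
    then show False using s that by simp
  qed
  then show ?thesis unfolding chi_rGamma by (intro holomorphic_intros) auto
qed

lemma chi_mult_reflect:
  assumes "1 < Re w" "Re w < 2"
  shows "chi w * chi (1 - w) = 1"
proof -
  have "Gamma z \<noteq> 0" if "z = w / 2 \<or> z = (1 - w) / 2" for z
  proof
    assume "Gamma z = 0"
    then have "z \<in> \<int>\<^sub>\<le>\<^sub>0" by (simp add: Gamma_eq_zero_iff)
    then obtain n where n: "z = - of_nat n" by (elim nonpos_Ints_cases')
    then have "Re z = - real n" by simp
    moreover have "Re z = Re w / 2 \<or> Re z = (1 - Re w) / 2"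
    proof -
      have "Re (w / 2) = Re w / 2" "Re ((1 - w) / 2) = (1 - Re w) / 2" by simp_all
      then show ?thesis using that by metis
    qed
    ultimately show False using assms by (cases n) auto
  qed
  then have g: "Gamma (w / 2) \<noteq> 0" "Gamma ((1 - w) / 2) \<noteq> 0" by auto
  have "chi w * chi (1 - w) = (of_real pi powr (w - 1/2) * of_real pi powr (1 - w - 1/2))
      * (Gamma ((1 - w) / 2) / Gamma ((1 - w) / 2)) * (Gamma (w / 2) / Gamma (w / 2))"
    by (simp add: chi_def)
  also have "\<dots> = of_real pi powr ((w - 1/2) + (1 - w - 1/2))"
    by (simp only: powr_add divide_self[OF g(1)] divide_self[OF g(2)] mult_1_right)
  finally show ?thesis by simp
qed

text \<open>Reflection at (w + 1)/2 supplies the cosine, Legendre duplication at w/2 supplies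
  \<open>Gamma w\<close>. The strip contains no odd integer, hence no zero of the cosine.\<close>

lemma chi_cos:
  assumes "1 < Re w" "Re w < 2"
  shows "chi w * (2 * cos (of_real pi * w / 2) * Gamma w) = (2 * of_real pi) powr w"
proof -
  have not_np: "z \<notin> \<int>\<^sub>\<le>\<^sub>0" if "Re z > 0" for z :: complex
    using that by (auto elim!: nonpos_Ints_cases')
  define c where "c = cos (of_real pi * w / 2)"
  define G where "G = Gamma (w / 2)"
  define G1 where "G1 = Gamma (w / 2 + 1 / 2)"
  have G: "G \<noteq> 0" "G1 \<noteq> 0" "Gamma w \<noteq> 0"
    unfolding G_def G1_def using not_np[of "w / 2"] not_np[of "w / 2 + 1 / 2"] not_np[of w] assms
    by (auto simp: Gamma_eq_zero_iff)
  have c0: "c \<noteq> 0"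
  proof
    assume "c = 0"
    then obtain n :: int where "of_real pi * w / 2 = of_real (real_of_int n * pi) + of_real pi / 2"
      unfolding c_def cos_eq_0 by blast
    then have "of_real pi * w = of_real pi * of_real (2 * real_of_int n + 1)" by (simp add: field_simps)
    then have "w = of_real (2 * real_of_int n + 1)" by simp
    then have "Re w = 2 * real_of_int n + 1" by simp
    then have "1 < 2 * n + 1" "2 * n + 1 < 2" using assms by linarith+
    then show False by linarith
  qed
  have refl: "G1 * Gamma ((1 - w) / 2) = of_real pi / c"
  proof -
    have "1 - (w / 2 + 1 / 2) = (1 - w) / 2" by (simp add: field_simps)
    moreover have "of_real pi * (w / 2 + 1 / 2) = of_real pi * w / 2 + of_real pi / 2"
      by (simp add: field_simps)
    then have "sin (of_real pi * (w / 2 + 1 / 2)) = c"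
      by (simp only: sin_add c_def) (simp flip: of_real_divide add: sin_of_real cos_of_real)
    ultimately show ?thesis using Gamma_reflection_complex[of "w / 2 + 1 / 2"] by (simp only: G1_def)
  qed
  have dup: "G * G1 = exp ((1 - w) * of_real (ln 2)) * of_real (sqrt pi) * Gamma w"
    using Gamma_legendre_duplication[of "w / 2"] not_np[of "w / 2"] not_np[of "w / 2 + 1 / 2"] assms
    by (simp add: G_def G1_def)
  have pw: "(2 * of_real pi) powr w = exp (w * of_real (ln 2)) * exp (w * of_real (ln pi))"
  proof -
    have "Ln (2 * of_real pi) = Ln (of_real (2 * pi))" by simp
    also have "\<dots> = of_real (ln 2) + of_real (ln pi)"
      by (subst Ln_of_real) (auto simp: ln_mult)
    finally show ?thesis by (simp add: powr_def distrib_left exp_add)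
  qed
  have pw1: "of_real pi powr (w - 1/2) = exp (w * of_real (ln pi)) / of_real (sqrt pi)"
  proof -
    have "exp (of_real (ln pi) / 2) = complex_of_real (exp (ln pi / 2))" by (simp flip: exp_of_real)
    also have "exp (ln pi / 2) = sqrt pi" by (simp add: ln_sqrt[symmetric])
    finally have "exp (of_real (ln pi) / 2) = complex_of_real (sqrt pi)" .
    then show ?thesis by (simp add: powr_def Ln_of_real left_diff_distrib exp_diff)
  qed
  have two: "exp ((1 - w) * of_real (ln 2)) = 2 / exp (w * of_real (ln 2))"
  proof -
    have "exp (of_real (ln 2)) = complex_of_real (exp (ln 2))" by (simp only: exp_of_real)
    then show ?thesis by (simp add: left_diff_distrib exp_diff)
  qed
  have sq: "of_real (sqrt pi) * of_real (sqrt pi) = complex_of_real pi" by (simp flip: of_real_mult)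
  have sq0: "complex_of_real (sqrt pi) \<noteq> 0" by simp
  have Gr: "Gamma ((1 - w) / 2) = of_real pi / (c * G1)" using refl G c0 by (simp add: field_simps)
  have "chi w * (2 * c * Gamma w) * (G * G1)
      = of_real pi powr (w - 1/2) * (of_real pi / (c * G1)) / G * (2 * c * Gamma w) * (G * G1)"
    unfolding chi_def Gr G_def[symmetric] ..
  also have "\<dots> = of_real pi powr (w - 1/2) * of_real pi * 2 * Gamma w"
    using G c0 by simp
  also have "\<dots> = exp (w * of_real (ln pi)) / of_real (sqrt pi) * (of_real (sqrt pi) * of_real (sqrt pi)) * 2 * Gamma w"
    unfolding pw1 sq ..
  also have "\<dots> = exp (w * of_real (ln pi)) * exp (w * of_real (ln 2)) * (exp ((1 - w) * of_real (ln 2)) * of_real (sqrt pi) * Gamma w)"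
    unfolding two using sq0 by simp
  also have "\<dots> = (2 * of_real pi) powr w * (G * G1)" unfolding pw dup by simp
  finally show ?thesis using G by (simp add: c_def)
qed

text \<open>By the collapse of the line the ray integral is itself a value of R*, and
  \<open>chi_cos\<close> turns the remaining factors into \<open>chi w\<close>.\<close>

lemma zeta_series_strip:
  fixes w :: complex
  assumes "1 < Re w" "Re w < 2"
  shows "Rstar w + exp (- w * (pi / 4 * \<i>)) * of_real (2 * pi) powr w * rGamma w * (\<integral>t. hker w t \<partial>lborel)
       = Rstar w + chi w * cnj (Rstar (1 - cnj w))"
proof -
  have "Gamma w \<noteq> 0" using assms by (auto simp: Gamma_eq_zero_iff elim!: nonpos_Ints_cases')
  have "chi w * cnj (Rstar (1 - cnj w))
     = chi w * (2 * cos (of_real pi * w / 2) * Gamma w) * rGamma w * exp (- w * (pi / 4 * \<i>)) * (\<integral>t. hker w t \<partial>lborel)"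
    using cnj_kint_near_zero[OF assms half_line(1,2)] \<open>Gamma w \<noteq> 0\<close>
    by (simp add: Rstar_def rGamma_inverse_Gamma)
  then show ?thesis unfolding chi_cos[OF assms] by simp
qed

section \<open>Continuation of zeta and the functional equation\<close>

lemma hker_integral_holomorphic: "(\<lambda>w. \<integral>t. hker w t \<partial>lborel) holomorphic_on {w. Re w > 1}"
proof (rule holomorphic_on_lebesgue_integral)
  show "open {w. 1 < Re w}" by (rule open_halfspace_Re_gt)
  fix t :: real
  show "(\<lambda>w. hker w t) holomorphic_on {w. Re w > 1}"
    unfolding hker_def scaleR_conv_of_real
    by (cases "t > 0"; cases "kern (kap * of_real t) = 0") (auto intro!: holomorphic_intros)
next
  fix w :: complex assume "w \<in> {w. Re w > 1}"
  then have w: "Re w > 1" by simp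
  define r where "r = (Re w - 1) / 2"
  have r: "r > 0" using w by (simp add: r_def)
  \<comment> \<open>The smaller exponent dominates for t <= 1, the larger one for t > 1; the choice
    of r keeps Re w - r above 1.\<close>
  define g where "g t = indicator {0<..} t *\<^sub>R (t powr ((Re w - r - 1) - 1) * exp (- (pi * t\<^sup>2)))
      + indicator {0<..} t *\<^sub>R (t powr ((Re w + r - 1) - 1) * exp (- (pi * t\<^sup>2)))" for t :: real
  show "\<exists>r>0. \<exists>g. integrable lborel g \<and> (\<forall>w'\<in>ball w r \<inter> {w. Re w > 1}. \<forall>t\<in>space lborel. norm (hker w' t) \<le> g t)"
  proof (intro exI[of _ r] exI[of _ g] conjI ballI)
    show "integrable lborel g" unfolding g_def[abs_def]
      using w r by (intro Bochner_Integration.integrable_add integrable_powr_gauss) (auto simp: r_def field_simps)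
    fix w' t assume w': "w' \<in> ball w r \<inter> {w. Re w > 1}"
    have "\<bar>Re w - Re w'\<bar> < r" using w' abs_Re_le_cmod[of "w - w'"] by (simp add: dist_norm)
    then have b: "Re w - r \<le> Re w'" "Re w' \<le> Re w + r" by linarith+
    show "norm (hker w' t) \<le> g t"
    proof (cases "t > 0")
      case True
      have "norm (hker w' t) = t powr (Re w' - 1) * exp (- (pi * t\<^sup>2)) / norm (kern (kap * of_real t))"
        using True by (simp add: hker_def norm_mult norm_divide norm_powr_real_powr)
      also have "\<dots> \<le> t powr (Re w' - 1) * exp (- (pi * t\<^sup>2)) / t"
        using True norm_kern_kap_real[OF True] by (intro divide_left_mono mult_pos_pos) (auto intro: less_le_trans)
      also have "\<dots> = t powr ((Re w' - 1) - 1) * exp (- (pi * t\<^sup>2))"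
      proof -
        have "t powr ((Re w' - 1) - 1) = t powr (Re w' - 1) / t" using True by (subst powr_diff) simp
        then show ?thesis by (simp only:) simp
      qed
      also have "\<dots> \<le> (t powr ((Re w - r - 1) - 1) + t powr ((Re w + r - 1) - 1)) * exp (- (pi * t\<^sup>2))"
      proof (rule mult_right_mono)
        show "t powr ((Re w' - 1) - 1) \<le> t powr ((Re w - r - 1) - 1) + t powr ((Re w + r - 1) - 1)"
        proof (cases "t \<le> 1")
          case le: True
          have "t powr ((Re w' - 1) - 1) \<le> t powr ((Re w - r - 1) - 1)"
            using le True b by (intro powr_mono') auto
          then show ?thesis by (simp add: add_increasing2)
        next
          case False
          then have "t powr ((Re w' - 1) - 1) \<le> t powr ((Re w + r - 1) - 1)"
            using b by (intro powr_mono) auto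
          then show ?thesis by (simp add: add_increasing)
        qed
      qed simp
      also have "\<dots> = g t" using True by (simp add: g_def distrib_right)
      finally show ?thesis .
    qed (simp add: hker_def g_def)
  qed (rule r)
qed simp

text \<open>Two formulas glued along the strip 1 < Re w < 2, where they agree: the first equals the
  series, the second reaches the left half-plane. The value at 1 follows the convention in
  \<open>zeta\<close>.\<close>

definition zeta_cont :: "complex \<Rightarrow> complex" where
  "zeta_cont w = (if w = 1 then 0 else if Re w > 1
     then Rstar w + exp (- w * (pi / 4 * \<i>)) * of_real (2 * pi) powr w * rGamma w * (\<integral>t. hker w t \<partial>lborel)
     else Rstar w + chi w * cnj (Rstar (1 - cnj w)))"

lemma zeta_cont_left:
  assumes "Re w < 2" "w \<noteq> 1"
  shows "zeta_cont w = Rstar w + chi w * cnj (Rstar (1 - cnj w))"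
  using assms zeta_series_strip[of w] by (simp add: zeta_cont_def)

lemma zeta_cont_holomorphic: "zeta_cont holomorphic_on - {1}"
proof -
  have 1: "zeta_cont holomorphic_on {w. Re w > 1}"
  proof (rule holomorphic_transform)
    show "(\<lambda>w. Rstar w + exp (- w * (pi / 4 * \<i>)) * of_real (2 * pi) powr w * rGamma w * (\<integral>t. hker w t \<partial>lborel))
        holomorphic_on {w. Re w > 1}"
      by (intro holomorphic_intros hker_integral_holomorphic)
  qed (auto simp: zeta_cont_def)
  have 2: "zeta_cont holomorphic_on {w. Re w < 2} - {1}"
  proof (rule holomorphic_transform)
    show "(\<lambda>w. Rstar w + chi w * cnj (Rstar (1 - cnj w))) holomorphic_on {w. Re w < 2} - {1}"
      by (intro holomorphic_intros cnj_Rstar_holomorphic holomorphic_on_subset[OF chi_holomorphic]) auto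
  qed (auto simp: zeta_cont_left)
  have "zeta_cont holomorphic_on {w. Re w > 1} \<union> ({w. Re w < 2} - {1})"
    by (rule holomorphic_on_Un[OF 1 2]) (auto intro: open_halfspace_Re_gt open_halfspace_Re_lt open_delete)
  moreover have "{w. Re w > 1} \<union> ({w. Re w < 2} - {1}) = - {1}" by (auto simp: not_less)
  ultimately show ?thesis by simp
qed

lemma zeta_cont_series:
  assumes "Re w > 1" shows "(\<lambda>n. of_nat (Suc n) powr (- w)) sums zeta_cont w"
proof -
  have "w \<noteq> 1" using assms by auto
  moreover have "x * rGamma w = x / Gamma w" for x by (simp only: rGamma_inverse_Gamma divide_inverse)
  ultimately have "zeta_cont w = kint (pker w) (1/2)
      + exp (- w * (pi / 4 * \<i>)) * of_real (2 * pi) powr w / Gamma w * (\<integral>t. hker w t \<partial>lborel)"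
    using assms by (simp only: zeta_cont_def Rstar_def if_True if_False)
  then show ?thesis using zeta_mellin[OF half_line(1,2) assms] by (simp only:)
qed

text \<open>\<open>zeta_cont\<close> provides the existence that the definite description
  presupposes; uniqueness is the identity theorem on the punctured plane, which is
  connected.\<close>

lemma zeta_eq_zeta_cont: "zeta = zeta_cont"
  unfolding zeta_def
proof (rule the_equality)
  fix f assume f: "f holomorphic_on - {1} \<and> f 1 = 0 \<and>
      (\<forall>s. Re s > 1 \<longrightarrow> (\<lambda>n. of_nat (Suc n) powr (- s)) sums f s)"
  show "f = zeta_cont"
  proof
    fix w show "f w = zeta_cont w"
    proof (cases "w = 1")
      case True then show ?thesis using f by (simp add: zeta_cont_def)
    next
      case False
      show ?thesis
      proof (rule analytic_continuation_open[where s = "{w. Re w > 1}" and s' = "- {1}" and f = f and g = zeta_cont and z = w])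
        show "open {w. 1 < Re w}" by (rule open_halfspace_Re_gt)
        have "2 \<in> {w. 1 < Re w}" by simp
        then show "{w. 1 < Re w} \<noteq> {}" by blast
        show "connected (- {1::complex})" by (rule connected_punctured_universe) simp
        show "f z = zeta_cont z" if "z \<in> {w. 1 < Re w}" for z
          using that f zeta_cont_series[of z] sums_unique2 by blast
      qed (use f False zeta_cont_holomorphic in auto)
    qed
  qed
qed (use zeta_cont_holomorphic zeta_cont_series in \<open>auto simp: zeta_cont_def\<close>)

text \<open>In the strip this is the formula for \<open>zeta_cont\<close>, solved for the conjugate
  term by chi(w) chi(1 - w) = 1. The bound -2 is where the next pole of chi(1 - w) lies; since w = 1
  - s will have nonnegative real part, this range suffices.\<close>

lemma functional_equation:
  assumes w: "Re w > -2" "w \<noteq> 0" "w \<noteq> 1"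
  shows "cnj (Rstar (1 - cnj w)) = chi (1 - w) * (zeta w - Rstar w)"
proof (rule analytic_continuation_open[where s = "{w. Re w > 1} \<inter> {w. Re w < 2}" and s' = "{w. Re w > -2} - {0, 1}"
    and f = "\<lambda>w. cnj (Rstar (1 - cnj w))" and g = "\<lambda>w. chi (1 - w) * (zeta w - Rstar w)" and z = w])
  show "open ({w. 1 < Re w} \<inter> {w. Re w < 2})"
    by (intro open_Int open_halfspace_Re_gt open_halfspace_Re_lt)
  show "open ({w. - 2 < Re w} - {0, 1})"
    by (intro open_Diff open_halfspace_Re_gt finite_imp_closed) auto
  have "3 / 2 \<in> {w. 1 < Re w} \<inter> {w. Re w < 2}" by simp
  then show "{w. 1 < Re w} \<inter> {w. Re w < 2} \<noteq> {}" by blast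
  show "connected ({w. - 2 < Re w} - {0, 1})"
    by (intro connected_open_delete_finite open_halfspace_Re_gt convex_connected convex_halfspace_Re_gt) auto
  show "(\<lambda>w. cnj (Rstar (1 - cnj w))) holomorphic_on {w. - 2 < Re w} - {0, 1}"
    by (rule cnj_Rstar_holomorphic)
  have "(chi \<circ> (\<lambda>w. 1 - w)) holomorphic_on {w. - 2 < Re w} - {0, 1}"
    by (rule holomorphic_on_compose_gen[OF _ chi_holomorphic]) (auto intro!: holomorphic_intros)
  then have "(\<lambda>w. chi (1 - w)) holomorphic_on {w. - 2 < Re w} - {0, 1}" by (simp add: comp_def)
  then show "(\<lambda>w. chi (1 - w) * (zeta w - Rstar w)) holomorphic_on {w. - 2 < Re w} - {0, 1}"
    unfolding zeta_eq_zeta_cont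
    by (intro holomorphic_intros holomorphic_on_subset[OF zeta_cont_holomorphic]) auto
  show "cnj (Rstar (1 - cnj z)) = chi (1 - z) * (zeta z - Rstar z)"
    if "z \<in> {w. 1 < Re w} \<inter> {w. Re w < 2}" for z
  proof -
    have z: "1 < Re z" "Re z < 2" using that by auto
    then have "z \<noteq> 1" by auto
    then have "chi (1 - z) * (zeta z - Rstar z) = chi z * chi (1 - z) * cnj (Rstar (1 - cnj z))"
      using zeta_cont_left[of z] z by (simp add: zeta_eq_zeta_cont)
    then show ?thesis by (simp add: chi_mult_reflect[OF z])
  qed
qed (use w in auto)

section \<open>The saddle point estimate\<close>

text \<open>y is a point between the saddle and the displaced line. What matters is that the lower
  bound stays above -1, so that 1 + z0/y has real part at least 2/5. It holds because the sector
  condition gives a bound -4/7, by p|g| <= (p^2 + g^2)/2.\<close>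

lemma saddle_quotient:
  assumes z0: "2 \<le> Re z0" "\<bar>Im z0\<bar> \<le> Re z0" and y: "7 / 8 * Re z0 \<le> Re y"
  shows "- (3 / 5) \<le> Re (z0 / y)" "norm (z0 / y) \<le> 3"
proof -
  define \<alpha> \<beta> p g where "\<alpha> = Re z0" and "\<beta> = Im z0" and "p = Re y" and "g = Im y"
  have p: "0 < p" "\<alpha> \<le> 8 / 7 * p" "0 < \<alpha>" using z0 y by (auto simp: \<alpha>_def p_def)
  define N where "N = p\<^sup>2 + g\<^sup>2"
  define X where "X = \<beta> * g"
  define Y where "Y = \<alpha> * p"
  have N: "N > 0" using p by (simp add: N_def sum_power2_gt_zero_iff)
  have "- X \<le> \<bar>\<beta>\<bar> * \<bar>g\<bar>" unfolding X_def by (metis abs_ge_minus_self abs_mult)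
  also have "\<dots> \<le> \<alpha> * \<bar>g\<bar>" using z0 by (intro mult_right_mono) (auto simp: \<alpha>_def \<beta>_def)
  also have "\<dots> \<le> 8 / 7 * p * \<bar>g\<bar>" using p by (intro mult_right_mono) auto
  also have "\<dots> \<le> 4 / 7 * N"
  proof -
    have "0 \<le> (p - \<bar>g\<bar>)\<^sup>2" by simp
    then show ?thesis by (simp add: N_def power2_eq_square algebra_simps)
  qed
  finally have "- X \<le> 4 / 7 * N" .
  moreover have "0 \<le> Y" using p by (simp add: Y_def)
  ultimately have "- (3 / 5) * N \<le> Y + X" using N by linarith
  then have "- (3 / 5) \<le> (Y + X) / N" using N by (simp add: pos_le_divide_eq)
  then show "- (3 / 5) \<le> Re (z0 / y)" by (simp add: Re_divide \<alpha>_def \<beta>_def p_def g_def N_def X_def Y_def)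
  have "norm z0 \<le> 2 * \<alpha>" using cmod_le[of z0] z0 by (simp add: \<alpha>_def)
  also have "\<dots> \<le> 3 * p" using p by linarith
  also have "\<dots> \<le> 3 * norm y" using complex_Re_le_cmod[of y] by (simp add: p_def)
  finally have "norm z0 \<le> 3 * norm y" .
  moreover have "norm y > 0" using p by (auto simp: p_def)
  ultimately show "norm (z0 / y) \<le> 3" by (simp add: norm_divide pos_divide_le_eq)
qed

text \<open>With q = z0/y the coefficient 2/5 is 1 - 3/5. The horizontal displacement d contributes
  only d^2 (1 + Re q) <= 1/4 and a cross term linear in \<open>\<tau>\<close>.\<close>

lemma saddle_quadratic:
  fixes q :: complex and d \<tau> :: real
  assumes "- (3 / 5) \<le> Re q" "norm q \<le> 3" "\<bar>d\<bar> \<le> 1 / 4"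
  shows "Re ((Complex d \<tau>)\<^sup>2 * (1 + q)) \<le> 1 / 4 + 3 / 2 * \<bar>\<tau>\<bar> - 2 / 5 * \<tau>\<^sup>2"
proof -
  have Re: "Re q \<le> 3" "\<bar>Im q\<bar> \<le> 3" using assms(2) complex_Re_le_cmod[of q] abs_Im_le_cmod[of q] by linarith+
  define A where "A = d\<^sup>2 * (1 + Re q)"
  define T where "T = \<tau>\<^sup>2 * (1 + Re q)"
  define I where "I = 2 * d * \<tau> * Im q"
  have "d\<^sup>2 \<le> (1 / 4)\<^sup>2" using assms(3) by (intro abs_le_square_iff[THEN iffD1]) auto
  then have "A \<le> (1 / 4)\<^sup>2 * 4" unfolding A_def using assms Re by (intro mult_mono) auto
  then have A: "A \<le> 1 / 4" by (simp add: power2_eq_square)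
  have "\<tau>\<^sup>2 * (2 / 5) \<le> T" unfolding T_def using assms by (intro mult_left_mono) auto
  then have T: "2 / 5 * \<tau>\<^sup>2 \<le> T" by simp
  have "- I \<le> \<bar>I\<bar>" by (rule abs_ge_minus_self)
  also have "\<dots> = (2 * \<bar>d\<bar> * \<bar>Im q\<bar>) * \<bar>\<tau>\<bar>" by (simp add: abs_mult I_def)
  also have "\<dots> \<le> (2 * (1 / 4) * 3) * \<bar>\<tau>\<bar>"
    using assms Re by (intro mult_right_mono mult_mono) auto
  finally have I: "- I \<le> 3 / 2 * \<bar>\<tau>\<bar>" by simp
  have "Re ((Complex d \<tau>)\<^sup>2 * (1 + q)) = A - T - I"
    by (simp add: A_def T_def I_def power2_eq_square algebra_simps)
  also have "\<dots> \<le> 1 / 4 + 3 / 2 * \<bar>\<tau>\<bar> - 2 / 5 * \<tau>\<^sup>2" using A T I by linarith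
  finally show ?thesis .
qed

text \<open>
  For \<open>w = 2\<pi>z\<^sub>0\<^sup>2\<close> the saddle point of \<open>pker w\<close> is \<open>z\<^sub>0\<close>, and the derivative of the exponent along the
  segment \<open>u \<mapsto> z\<^sub>0 + uv\<close> is \<open>2\<pi>uv\<^sup>2(1 + z\<^sub>0/(z\<^sub>0 + uv))\<close>.
\<close>

lemma saddle_exponent:
  fixes z0 :: complex
  assumes z0: "2 \<le> Re z0" "\<bar>Im z0\<bar> \<le> Re z0" and d: "\<bar>d\<bar> \<le> 1 / 4"
  shows "norm (pker (2 * pi * z0\<^sup>2) (z0 + Complex d \<tau>))
     \<le> norm (pker (2 * pi * z0\<^sup>2) z0) * exp (pi * (1 / 4 + 3 / 2 * \<bar>\<tau>\<bar> - 2 / 5 * \<tau>\<^sup>2))"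
proof -
  define v where "v = Complex d \<tau>"
  define B where "B = 1 / 4 + 3 / 2 * \<bar>\<tau>\<bar> - 2 / 5 * \<tau>\<^sup>2"
  define f where "f u = - (2 * pi * z0\<^sup>2) * Ln (z0 + of_real u * v) + pi * (z0 + of_real u * v)\<^sup>2" for u :: real
  have Re_y: "7 / 8 * Re z0 \<le> Re (z0 + of_real u * v)" if "0 \<le> u" "u \<le> 1" for u
  proof -
    have "\<bar>u * d\<bar> \<le> 1 * (1 / 4)" unfolding abs_mult using that d by (intro mult_mono) auto
    then have "- (1 / 4) \<le> u * d" by (simp add: abs_le_iff)
    then show ?thesis using z0 by (simp add: v_def)
  qed
  \<comment> \<open>The saddle is a critical point, so the derivative of \<open>Re (f u)\<close> has
    a factor u. Subtracting the quadratic with coefficient \<open>pi * B\<close> makes the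
    difference decrease from u = 0 to u = 1.\<close>
  have deriv: "((\<lambda>u. Re (f u) - pi * u\<^sup>2 * B) has_real_derivative
      Re (2 * pi * u * (v\<^sup>2 * (1 + z0 / (z0 + of_real u * v)))) - 2 * pi * u * B) (at u)"
    if u: "0 \<le> u" "u \<le> 1" for u
  proof -
    define y where "y = z0 + of_real u * v"
    have y: "Re y > 0" using Re_y[OF u] z0 by (simp add: y_def)
    then have y': "y \<notin> \<real>\<^sub>\<le>\<^sub>0" "y \<noteq> 0" by (auto simp: complex_nonpos_Reals_iff)
    have "((\<lambda>x. - (2 * pi * z0\<^sup>2) * Ln (z0 + x * v) + pi * (z0 + x * v)\<^sup>2) has_field_derivative
       - (2 * pi * z0\<^sup>2) * (v / y) + pi * (2 * y * v)) (at (of_real u))"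
      using y' unfolding y_def by (auto intro!: derivative_eq_intros simp: field_simps)
    then have "(f has_vector_derivative - (2 * pi * z0\<^sup>2) * (v / y) + pi * (2 * y * v)) (at u)"
      unfolding f_def[abs_def] by (rule has_vector_derivative_real_field)
    then have "((\<lambda>u. Re (f u)) has_real_derivative Re (- (2 * pi * z0\<^sup>2) * (v / y) + pi * (2 * y * v))) (at u)"
      unfolding has_real_derivative_iff_has_vector_derivative
      by (rule bounded_linear.has_vector_derivative[OF bounded_linear_Re])
    also have "- (2 * pi * z0\<^sup>2) * (v / y) + pi * (2 * y * v) = 2 * pi * u * (v\<^sup>2 * (1 + z0 / y))"
    proof -
      have "y - z0 = of_real u * v" by (simp add: y_def)
      then have "2 * pi * u * (v\<^sup>2 * (1 + z0 / y)) = 2 * pi * v * ((y - z0) * (1 + z0 / y))"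
        by (simp add: power2_eq_square)
      also have "\<dots> = - (2 * pi * z0\<^sup>2) * (v / y) + pi * (2 * y * v)"
        using y'(2) by (simp add: power2_eq_square field_simps)
      finally show ?thesis by simp
    qed
    finally have "((\<lambda>u. Re (f u)) has_real_derivative Re (2 * pi * u * (v\<^sup>2 * (1 + z0 / y)))) (at u)" .
    moreover have "((\<lambda>u. pi * u\<^sup>2 * B) has_real_derivative 2 * pi * u * B) (at u)"
      by (auto intro!: derivative_eq_intros)
    ultimately show ?thesis unfolding y_def by (rule DERIV_diff)
  qed
  have "Re (f 1) - pi * 1\<^sup>2 * B \<le> Re (f 0) - pi * 0\<^sup>2 * B"
  proof (rule DERIV_nonpos_imp_nonincreasing[where f = "\<lambda>u. Re (f u) - pi * u\<^sup>2 * B" and a = 0 and b = 1])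
    fix u :: real assume u: "0 \<le> u" "u \<le> 1"
    have "Re (v\<^sup>2 * (1 + z0 / (z0 + of_real u * v))) \<le> B"
      unfolding v_def B_def
      by (intro saddle_quadratic saddle_quotient z0 d Re_y[OF u, unfolded v_def])
    then have "2 * pi * u * Re (v\<^sup>2 * (1 + z0 / (z0 + of_real u * v))) \<le> 2 * pi * u * B"
      using u by (intro mult_left_mono) auto
    moreover have "Re (2 * pi * u * (v\<^sup>2 * (1 + z0 / (z0 + of_real u * v))))
       = 2 * pi * u * Re (v\<^sup>2 * (1 + z0 / (z0 + of_real u * v)))"
    proof -
      have "2 * pi * u * (v\<^sup>2 * (1 + z0 / (z0 + of_real u * v)))
         = of_real (2 * pi * u) * (v\<^sup>2 * (1 + z0 / (z0 + of_real u * v)))" by simp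
      then show ?thesis by (simp only: times_complex.sel Re_complex_of_real Im_complex_of_real)
    qed
    ultimately show "\<exists>y. ((\<lambda>u. Re (f u) - pi * u\<^sup>2 * B) has_real_derivative y) (at u) \<and> y \<le> 0"
      using deriv[OF u] by (intro exI conjI) auto
  qed simp
  then have le: "Re (f 1) \<le> Re (f 0) + pi * B" by simp
  have pk: "norm (pker (2 * pi * z0\<^sup>2) (z0 + of_real u * v)) = exp (Re (f u) + Re (- (2 * pi * z0\<^sup>2) * (pi / 4 * \<i>)))"
    if u: "0 \<le> u" "u \<le> 1" for u
  proof -
    have "Re (z0 + of_real u * v) > 0" using Re_y[OF u] z0 by linarith
    then have "- (2 * pi * z0\<^sup>2) * Ln (kap * (z0 + of_real u * v)) + of_real pi * (z0 + of_real u * v)\<^sup>2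
       = f u + - (2 * pi * z0\<^sup>2) * (pi / 4 * \<i>)"
      by (simp only: Ln_kap_mult f_def) (simp add: algebra_simps)
    then show ?thesis unfolding pker_def norm_exp_eq_Re by (simp only: plus_complex.sel)
  qed
  show ?thesis using pk[of 0] pk[of 1] le by (simp add: v_def B_def flip: exp_add)
qed

text \<open>A line that crosses the real axis at distance at least 1/4 from the integers has a
  kernel of size at least 1.\<close>

lemma sin_quarter_ge:
  fixes x :: real and m :: int
  assumes "m + 1 / 4 \<le> x" "x \<le> m + 3 / 4"
  shows "1 \<le> sqrt 2 * \<bar>sin (pi * x)\<bar>"
proof -
  define y where "y = pi * (x - m)"
  have "pi * (1 / 4) \<le> y" "y \<le> pi * (3 / 4)"
    unfolding y_def using assms by (auto intro!: mult_left_mono)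
  then have y: "pi / 4 \<le> y" "y \<le> pi - pi / 4" by auto
  have "sqrt 2 / 2 \<le> sin y"
  proof (cases "y \<le> pi / 2")
    case True
    then have "sin (pi / 4) \<le> sin y" using y by (intro sin_monotone_2pi_le) auto
    then show ?thesis by (simp add: sin_45)
  next
    case False
    then have "sin (pi / 4) \<le> sin (pi - y)" using y by (intro sin_monotone_2pi_le) auto
    then show ?thesis by (simp add: sin_45)
  qed
  moreover have "\<bar>sin (pi * x)\<bar> = \<bar>sin y\<bar>"
  proof -
    have "pi * x = y + of_int m * pi" by (simp add: y_def algebra_simps)
    then have "sin (pi * x) = sin y * cos (of_int m * pi)" by (simp add: sin_add sin_times_pi_eq_0)
    moreover have "\<bar>cos (of_int m * pi)\<bar> = 1"
    proof -
      have "sin (real_of_int m * pi) = 0" by (simp add: sin_times_pi_eq_0)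
      then have "(cos (real_of_int m * pi))\<^sup>2 = 1" using sin_cos_squared_add[of "real_of_int m * pi"] by simp
      then show ?thesis by (simp only: abs_square_eq_1)
    qed
    ultimately show ?thesis by (simp add: abs_mult)
  qed
  ultimately have "sqrt 2 * (sqrt 2 / 2) \<le> sqrt 2 * \<bar>sin (pi * x)\<bar>" by (intro mult_left_mono) auto
  then show ?thesis by simp
qed

text \<open>Translating t by \<open>Im z0\<close> centres the Gaussian at the saddle; the resulting
  bound is free of \<open>z0\<close>, which is the uniformity behind O(1).\<close>

lemma saddle_integral_bound:
  fixes z0 :: complex
  assumes z0: "2 \<le> Re z0" "\<bar>Im z0\<bar> \<le> Re z0" and d: "\<bar>d\<bar> \<le> 1 / 4"
    and peak: "norm (pker (2 * pi * z0\<^sup>2) z0) \<le> 1"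
    and line: "real_of_int m + 1 / 4 \<le> sqrt 2 * (Re z0 + d)" "sqrt 2 * (Re z0 + d) \<le> real_of_int m + 3 / 4"
  shows "norm (kint (pker (2 * pi * z0\<^sup>2)) (Re z0 + d))
     \<le> (\<integral>t. exp (pi * (1 / 4 + 3 / 2 * \<bar>t\<bar> - 2 / 5 * t\<^sup>2)) \<partial>lborel)"
proof -
  define w where "w = 2 * pi * z0\<^sup>2"
  define b where "b = Re z0 + d"
  define g where "g t = exp (pi * (1 / 4 + 3 / 2 * \<bar>t\<bar> - 2 / 5 * t\<^sup>2))" for t :: real
  have g_int: "integrable lborel g"
  proof -
    have "integrable lborel (\<lambda>t. exp (pi / 4) * exp ((3 / 2 * pi) * \<bar>t\<bar> - (2 / 5 * pi) * t\<^sup>2))"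
      by (intro integrable_mult_right integrable_gaussian_abs) auto
    also have "(\<lambda>t. exp (pi / 4) * exp ((3 / 2 * pi) * \<bar>t\<bar> - (2 / 5 * pi) * t\<^sup>2)) = g"
      by (auto simp: g_def algebra_simps simp flip: exp_add)
    finally show ?thesis .
  qed
  have g0: "0 \<le> g t" for t by (simp add: g_def)
  have g_shift: "integrable lborel (\<lambda>t. g (- Im z0 + 1 * t))"
    by (rule lborel_integrable_real_affine[OF g_int]) simp
  have bound: "norm (pker w (Complex b t) / kern (kap * Complex b t) * (kap * \<i>)) \<le> g (- Im z0 + 1 * t)" for t
  proof -
    have "Complex b t = z0 + Complex d (- Im z0 + 1 * t)" by (simp add: b_def complex_eq_iff)
    then have "norm (pker w (Complex b t)) \<le> norm (pker w z0) * g (- Im z0 + 1 * t)"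
      using saddle_exponent[OF z0 d] by (simp only: w_def g_def)
    also have "\<dots> \<le> 1 * g (- Im z0 + 1 * t)"
      using peak by (intro mult_right_mono) (auto simp: w_def g_def)
    finally have 1: "norm (pker w (Complex b t)) \<le> g (- Im z0 + 1 * t)" by simp
    have "1 \<le> sqrt 2 * \<bar>sin (pi * (sqrt 2 * b))\<bar>" using sin_quarter_ge[OF line] by (simp add: b_def)
    also have "\<dots> \<le> norm (kern (kap * Complex b t))" by (rule norm_kern_line)
    finally have 2: "1 \<le> norm (kern (kap * Complex b t))" .
    have "norm (pker w (Complex b t) / kern (kap * Complex b t) * (kap * \<i>))
        = norm (pker w (Complex b t)) / norm (kern (kap * Complex b t))"
      by (simp add: norm_mult norm_divide)
    also have "\<dots> \<le> norm (pker w (Complex b t)) / 1" using 2 by (intro divide_left_mono) auto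
    finally show ?thesis using 1 by simp
  qed
  have "norm (kint (pker w) b) \<le> (\<integral>t. norm (pker w (Complex b t) / kern (kap * Complex b t) * (kap * \<i>)) \<partial>lborel)"
    unfolding kint_def by (rule integral_norm_bound)
  also have "\<dots> \<le> (\<integral>t. g (- Im z0 + 1 * t) \<partial>lborel)"
    by (rule integral_mono_AE'[OF g_shift]) (use bound g0 in auto)
  also have "\<dots> = (\<integral>t. g t \<partial>lborel)"
    using lborel_integral_real_affine[of 1 g "- Im z0"] by simp
  finally show ?thesis by (simp add: g_def w_def b_def)
qed

text \<open>
  Up to a positive factor the left-hand side is the exponent at the saddle point, where
  \<open>\<theta> = arg(s - 1) - \<pi>/2\<close> and \<open>L = log(|s - 1|/2\<pi>)\<close>.
\<close>

lemma saddle_peak_nonpos: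
  assumes L: "1 \<le> L" and \<theta>: "0 \<le> \<theta>" "\<theta> \<le> 2 * arctan (sqrt L)"
  shows "sin \<theta> * (1 - L) - \<theta> * cos \<theta> \<le> (0::real)"
proof -
  have at: "2 * arctan (sqrt L) < pi" using arctan_ubound[of "sqrt L"] by simp
  have s0: "0 \<le> sin \<theta>" using \<theta> at by (intro sin_ge_zero) auto
  show ?thesis
  proof (cases "\<theta> \<le> pi / 2")
    case True
    then have "0 \<le> cos \<theta>" using \<theta> by (intro cos_ge_zero) auto
    then have "0 \<le> \<theta> * cos \<theta>" using \<theta> by simp
    moreover have "0 \<le> sin \<theta> * (L - 1)" using s0 L by simp
    ultimately show ?thesis by (simp add: algebra_simps)
  next
    case False
    \<comment> \<open>In the half angle the arctangent bound reads tan(x)^2 <= L.\<close>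
    define x where "x = \<theta> / 2"
    have x: "pi / 4 \<le> x" "x < pi / 2" "\<theta> = 2 * x" "0 < x" using False \<theta> at pi_gt_zero by (auto simp: x_def)
    have c: "cos x > 0" using x by (intro cos_gt_zero) auto
    have "tan x \<le> tan (arctan (sqrt L))"
    proof -
      have "x \<le> arctan (sqrt L)" using \<theta> by (simp add: x_def)
      then show ?thesis using x arctan_ubound[of "sqrt L"] by (intro tan_mono_le) auto
    qed
    then have "tan x \<le> sqrt L" by (simp add: tan_arctan)
    then have "sin x \<le> sqrt L * cos x" using c by (simp add: tan_def pos_divide_le_eq)
    moreover have sx: "0 \<le> sin x" using x by (intro sin_ge_zero) auto
    ultimately have "(sin x)\<^sup>2 \<le> (sqrt L * cos x)\<^sup>2" by (intro power_mono) auto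
    then have Lc: "(sin x)\<^sup>2 \<le> L * (cos x)\<^sup>2" using L by (simp add: power_mult_distrib)
    have cs: "(cos x)\<^sup>2 \<le> (sin x)\<^sup>2"
    proof (intro power_mono)
      have "cos x \<le> cos (pi / 4)" using x by (intro cos_monotone_0_pi_le) auto
      moreover have "sin (pi / 4) \<le> sin x" using x by (intro sin_monotone_2pi_le) auto
      ultimately show "cos x \<le> sin x" by (simp add: sin_45 cos_45)
    qed (use c in simp)
    have tx: "x * cos x \<le> sin x"
    proof -
      have "arctan (tan x) \<le> tan x"
        using arctan_le_self[of "tan x"] c sx by (simp add: tan_def)
      moreover have "arctan (tan x) = x" using x by (intro arctan_tan) auto
      ultimately show ?thesis using c by (simp add: tan_def pos_le_divide_eq)
    qed
    have "0 \<le> ((sin x)\<^sup>2 - (cos x)\<^sup>2) * (2 * (sin x - x * cos x))" using cs tx by (intro mult_nonneg_nonneg) auto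
    moreover have "0 \<le> 2 * sin x * (L * (cos x)\<^sup>2 - (sin x)\<^sup>2)" using Lc sx by (intro mult_nonneg_nonneg) auto
    \<comment> \<open>After multiplication by cos x the quantity splits into two nonnegative parts:
      one by x <= tan x and x >= pi/4, the other by tan(x)^2 <= L.\<close>
    moreover have "cos x * (sin \<theta> * (L - 1) + \<theta> * cos \<theta>)
      = ((sin x)\<^sup>2 - (cos x)\<^sup>2) * (2 * (sin x - x * cos x)) + 2 * sin x * (L * (cos x)\<^sup>2 - (sin x)\<^sup>2)"
      unfolding x(3) sin_double cos_double by (simp add: power2_eq_square algebra_simps)
    ultimately have "0 \<le> cos x * (sin \<theta> * (L - 1) + \<theta> * cos \<theta>)" by linarith
    then have "0 \<le> sin \<theta> * (L - 1) + \<theta> * cos \<theta>" using c by (simp add: zero_le_mult_iff)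
    then show ?thesis by (simp add: algebra_simps)
  qed
qed

section \<open>The main theorem\<close>

lemma riemann_R_eq_Rstar:
  assumes c: "0 < c" "c < 1"
  shows "riemann_R c s = cnj (Rstar (cnj s))"
proof -
  define a where "a = c / sqrt 2"
  have a: "0 < a" "sqrt 2 * a < 1" using c by (auto simp: a_def)
  define F where "F t = pker (cnj s) (Complex a t) / kern (kap * Complex a t) * (kap * \<i>)" for t
  have dir: "cnj (cis (- 3 * pi / 4)) = kap * \<i>"
  proof -
    have "3 * pi / 4 = pi / 4 + pi / 2" by simp
    then have "cis (3 * pi / 4) = kap * \<i>" by (simp only: cis_mult[symmetric] kap_def cis_pi_half)
    then show ?thesis by (simp add: cis_cnj)
  qed
  \<comment> \<open>The crossing point c equals \<open>kap\<close> times a(1 - i), hence the shift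
    of t by \<open>- a\<close>.\<close>
  have integrand: "R_integrand s (of_real c + of_real t * cis (- 3 * pi / 4)) * cis (- 3 * pi / 4)
       = cnj (F (- a + 1 * t))" for t
  proof -
    define z where "z = Complex a (- a + 1 * t)"
    define x where "x = of_real c + of_real t * cis (- 3 * pi / 4)"
    have Re_z: "Re z > 0" using a by (simp add: z_def)
    have xz: "cnj x = kap * z"
    proof -
      have "cnj x = of_real c + of_real t * (kap * \<i>)" by (simp only: x_def complex_cnj_add complex_cnj_mult complex_cnj_complex_of_real dir)
      also have "\<dots> = kap * z"
        by (simp add: z_def a_def kap_eq complex_eq_iff field_simps)
      finally show ?thesis .
    qed
    then have x: "x = cnj (kap * z)" by (metis complex_cnj_cnj)
    have np: "kap * z \<notin> \<real>\<^sub>\<le>\<^sub>0" by (rule kap_mult_not_nonpos[OF Re_z])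
    have Ln: "Ln x = cnj (Ln (kap * z))" unfolding x by (rule cnj_Ln[OF np, symmetric])
    have "exp (pi * \<i> * x\<^sup>2) = cnj (exp (of_real pi * z\<^sup>2))"
    proof -
      have "pi * \<i> * x\<^sup>2 = cnj (- (pi * \<i> * (kap\<^sup>2 * z\<^sup>2)))" unfolding x by (simp add: power_mult_distrib)
      also have "- (pi * \<i> * (kap\<^sup>2 * z\<^sup>2)) = of_real pi * z\<^sup>2" unfolding kap_square by (simp add: mult.assoc)
      finally show ?thesis by (simp only: exp_cnj)
    qed
    moreover have "exp (- s * Ln x) = cnj (exp (- cnj s * Ln (kap * z)))"
      unfolding Ln by (simp add: exp_cnj)
    moreover have "exp (pi * \<i> * x) - exp (- pi * \<i> * x) = cnj (kern (kap * z))"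
      unfolding x kern_def by (simp add: exp_cnj)
    moreover have "cis (- 3 * pi / 4) = cnj (kap * \<i>)" using dir by (metis complex_cnj_cnj)
    ultimately have "R_integrand s x * cis (- 3 * pi / 4) =
       cnj (exp (- cnj s * Ln (kap * z))) * cnj (exp (of_real pi * z\<^sup>2)) / cnj (kern (kap * z)) * cnj (kap * \<i>)"
      by (simp only: R_integrand_def)
    also have "\<dots> = cnj (F (- a + 1 * t))"
      by (simp only: F_def pker_def exp_add z_def[symmetric] complex_cnj_mult complex_cnj_divide)
    finally show ?thesis by (simp only: x_def)
  qed
  have "riemann_R c s = cnj (\<integral>t. F (- a + 1 * t) \<partial>lborel)"
    unfolding riemann_R_def integrand by simp
  also have "(\<integral>t. F (- a + 1 * t) \<partial>lborel) = (\<integral>t. F t \<partial>lborel)"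
    using lborel_integral_real_affine[of 1 F "- a"] by simp
  also have "\<dots> = Rstar (cnj s)"
    using kint_pker_const[OF a half_line(1,2), of "cnj s"] by (simp add: F_def Rstar_def kint_def)
  finally show ?thesis .
qed

text \<open>The sector condition on \<open>z0\<close>, rotated by pi/4, puts \<open>kap * z0\<close>
  into the closed first quadrant, while the window for \<open>Arg\<close> is the half-plane Re + Im
  > 0, which excludes the opposite root.\<close>

lemma eta_eq:
  fixes s z0 :: complex
  assumes z0: "0 < Re z0" "\<bar>Im z0\<bar> \<le> Re z0" and s: "1 - s = 2 * pi * z0\<^sup>2"
  shows "eta s = kap * z0"
  unfolding eta_def
proof (rule the_equality)
  have arg_iff: "0 < Re w + Im w" if "- pi / 4 < Arg w" "Arg w < 3 * pi / 4" "w \<noteq> 0" for w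
  proof -
    have "0 < cos (Arg w - pi / 4)" using that by (intro cos_gt_zero_pi) auto
    also have "cos (Arg w - pi / 4) = (cos (Arg w) + sin (Arg w)) * (sqrt 2 / 2)"
      by (simp add: cos_diff cos_45 sin_45 algebra_simps)
    finally have "0 < cos (Arg w) + sin (Arg w)" by (simp add: zero_less_mult_iff)
    then have "0 < norm w * (cos (Arg w) + sin (Arg w))" using that by simp
    also have "norm w * (cos (Arg w) + sin (Arg w)) = Re w + Im w"
    proof -
      have "w = rcis (norm w) (Arg w)" using that(3) by (simp add: rcis_cmod_Arg)
      then have "Re w = norm w * cos (Arg w)" "Im w = norm w * sin (Arg w)"
        by (metis Re_rcis, metis Im_rcis)
      then show ?thesis by (simp only: distrib_left)
    qed
    finally show ?thesis .
  qed
  have ne: "z0 \<noteq> 0" using z0 by auto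
  have sq: "(kap * z0)\<^sup>2 = (s - 1) / (2 * pi * \<i>)"
  proof -
    have "s - 1 = - (2 * pi * z0\<^sup>2)" using s by (simp add: algebra_simps)
    then show ?thesis by (simp add: power_mult_distrib kap_square)
  qed
  have pos: "0 \<le> Re (kap * z0)" "0 \<le> Im (kap * z0)"
    unfolding Re_kap_mult Im_kap_mult using z0 by auto
  have "0 \<le> Arg (kap * z0)" using pos(2) by (simp only: Arg_less_0)
  moreover have "Arg (kap * z0) \<le> pi / 2"
    using Arg_Re_nonneg[of "kap * z0"] pos(1) by linarith
  ultimately have "- pi / 4 < Arg (kap * z0)" "Arg (kap * z0) < 3 * pi / 4" using pi_gt_zero by linarith+
  then show "(kap * z0)\<^sup>2 = (s - 1) / (2 * pi * \<i>) \<and> - pi / 4 < Arg (kap * z0) \<and> Arg (kap * z0) < 3 * pi / 4"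
    using sq by blast
  fix w assume w: "w\<^sup>2 = (s - 1) / (2 * pi * \<i>) \<and> - pi / 4 < Arg w \<and> Arg w < 3 * pi / 4"
  then have "w\<^sup>2 = (kap * z0)\<^sup>2" using sq by simp
  then consider "w = kap * z0" | "w = - (kap * z0)" by (auto simp: power2_eq_iff)
  then show "w = kap * z0"
  proof cases
    case 2
    then have "w \<noteq> 0" using ne by simp
    then have "0 < Re w + Im w" using arg_iff w by auto
    moreover have "Re w + Im w = - (Re (kap * z0) + Im (kap * z0))" unfolding 2 by simp
    ultimately show ?thesis using pos by linarith
  qed
qed

text \<open>Thus m counts the positive integers up to the crossing point of the line through the
  saddle.\<close>

lemma m_index_eq:
  fixes s z0 :: complex
  assumes "0 < Re z0" "\<bar>Im z0\<bar> \<le> Re z0" "1 - s = 2 * pi * z0\<^sup>2"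
  shows "m_index s = \<lfloor>sqrt 2 * Re z0\<rfloor>"
proof -
  have "Re (kap * z0) + Im (kap * z0) = sqrt 2 * Re z0"
    unfolding Re_kap_mult Im_kap_mult by (simp add: field_simps)
  then show ?thesis unfolding m_index_def eta_eq[OF assms] by (simp only:)
qed

text \<open>Everything the region is used for: \<open>\<theta>\<close> in [0, pi) places the square
  root \<open>z0\<close> in the sector of the saddle estimates and gives Re s <= 1, and the
  arctangent bound makes the peak at most 1.\<close>

lemma G_region_saddle:
  fixes s :: complex
  assumes s: "s \<in> G_region" and big: "16 * pi \<le> norm (s - 1)"
  obtains z0 :: complex where "2 \<le> Re z0" "\<bar>Im z0\<bar> \<le> Re z0" "1 - s = 2 * pi * z0\<^sup>2"
    "norm (pker (1 - s) z0) \<le> 1" "Re s \<le> 1"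
proof -
  define r where "r = norm (s - 1)"
  define L where "L = ln (r / (2 * pi))"
  define \<theta> where "\<theta> = Arg2pi (s - 1) - pi / 2"
  \<comment> \<open>The argument of \<open>z0\<close>: half of \<open>\<theta>\<close> - pi/2, which
    is the argument of 1 - s.\<close>
  define \<phi> where "\<phi> = \<theta> / 2 - pi / 4"
  define \<rho> where "\<rho> = sqrt (r / (2 * pi))"
  define z0 where "z0 = of_real \<rho> * cis \<phi>"
  have r: "2 * pi * exp 1 < r" "16 * pi \<le> r" using s big by (auto simp: G_region_def r_def)
  have \<theta>: "0 \<le> \<theta>" "\<theta> \<le> 2 * arctan (sqrt L)" using s by (auto simp: G_region_def \<theta>_def L_def r_def)
  have \<theta>pi: "\<theta> < pi" using \<theta> arctan_ubound[of "sqrt L"] by linarith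
  have r0: "0 < r" using r(2) pi_gt_zero by linarith
  have L1: "1 \<le> L"
  proof -
    have "exp 1 \<le> r / (2 * pi)" using r(1) by (simp add: field_simps)
    then have "ln (exp 1) \<le> L" unfolding L_def using r0 by (subst ln_le_cancel_iff) auto
    then show ?thesis by simp
  qed
  have \<phi>: "- (pi / 4) \<le> \<phi>" "\<phi> \<le> pi / 4" using \<theta> \<theta>pi by (auto simp: \<phi>_def)
  \<comment> \<open>The threshold 16 pi is chosen for this: with cos \<open>\<phi>\<close> >= sqrt
    2/2 it yields Re z0 >= 2.\<close>
  have \<rho>: "sqrt 8 \<le> \<rho>" unfolding \<rho>_def using r(2) by (intro real_sqrt_le_mono) (simp add: pos_le_divide_eq)
  have \<rho>0: "0 < \<rho>" using r0 by (simp add: \<rho>_def)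
  have cosphi: "sqrt 2 / 2 \<le> cos \<phi>"
  proof -
    have "cos (pi / 4) \<le> cos \<bar>\<phi>\<bar>" using \<phi> by (intro cos_monotone_0_pi_le) auto
    then show ?thesis by (simp add: cos_45)
  qed
  have sinphi: "\<bar>sin \<phi>\<bar> \<le> sqrt 2 / 2"
  proof -
    have "sin \<phi> \<le> sin (pi / 4)" by (rule sin_monotone_2pi_le) (use \<phi> in auto)
    moreover have "sin (- (pi / 4)) \<le> sin \<phi>" by (rule sin_monotone_2pi_le) (use \<phi> in auto)
    ultimately show ?thesis by (simp add: sin_45 abs_le_iff)
  qed
  have 1: "2 \<le> Re z0"
  proof -
    have "sqrt 8 * (sqrt 2 / 2) \<le> \<rho> * cos \<phi>" using \<rho> \<rho>0 cosphi by (intro mult_mono) auto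
    moreover have "sqrt 8 * (sqrt 2 / 2) = 2"
    proof -
      have "sqrt 8 * sqrt 2 = sqrt (4\<^sup>2)" by (simp flip: real_sqrt_mult)
      also have "\<dots> = 4" by (simp only: real_sqrt_abs)
      finally show ?thesis by simp
    qed
    ultimately show ?thesis by (simp add: z0_def)
  qed
  have 2: "\<bar>Im z0\<bar> \<le> Re z0"
  proof -
    have "\<rho> * \<bar>sin \<phi>\<bar> \<le> \<rho> * cos \<phi>" using \<rho>0 sinphi cosphi by (intro mult_left_mono) auto
    then show ?thesis using \<rho>0 by (simp add: z0_def abs_mult)
  qed
  have s_polar: "1 - s = of_real r * cis (2 * \<phi>)"
  proof -
    have "s - 1 = of_real r * exp (\<i> * of_real (Arg2pi (s - 1)))" unfolding r_def by (rule Arg2pi_eq)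
    also have "exp (\<i> * of_real (Arg2pi (s - 1))) = cis (2 * \<phi> + pi)"
    proof -
      have "2 * \<phi> + pi = Arg2pi (s - 1)" by (simp add: \<phi>_def \<theta>_def field_simps)
      then show ?thesis by (simp only: cis_conv_exp)
    qed
    also have "\<dots> = - cis (2 * \<phi>)" by (simp flip: cis_mult)
    finally show ?thesis by (simp add: algebra_simps)
  qed
  have 3: "1 - s = 2 * pi * z0\<^sup>2"
  proof -
    have "z0\<^sup>2 = of_real (\<rho>\<^sup>2) * cis (2 * \<phi>)"
      by (simp add: z0_def power_mult_distrib power2_eq_square cis_mult)
    moreover have "\<rho>\<^sup>2 = r / (2 * pi)" using r0 by (simp add: \<rho>_def)
    ultimately show ?thesis using s_polar by simp
  qed
  have cs: "cos (2 * \<phi>) = sin \<theta>" "sin (2 * \<phi>) = - cos \<theta>"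
  proof -
    have "2 * \<phi> = \<theta> - pi / 2" by (simp add: \<phi>_def)
    then show "cos (2 * \<phi>) = sin \<theta>" "sin (2 * \<phi>) = - cos \<theta>" by (simp_all add: cos_diff sin_diff)
  qed
  have 4: "norm (pker (1 - s) z0) \<le> 1"
  proof -
    have m: "\<phi> \<in> {-pi<..pi}" unfolding greaterThanAtMost_iff using \<phi> pi_gt_zero by linarith
    have "Ln z0 = of_real (ln \<rho>) + Ln (cis \<phi>)"
      unfolding z0_def using \<rho>0 by (simp add: Ln_times_of_real Ln_of_real)
    also have "Ln (cis \<phi>) = of_real \<phi> * \<i>" by (rule Ln_cis[OF m])
    also have "ln \<rho> = L / 2" unfolding \<rho>_def L_def using r0 by (simp add: ln_sqrt)
    finally have Ln_z0: "Ln (kap * z0) = of_real (L / 2) + of_real \<phi> * \<i> + pi / 4 * \<i>"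
      using Ln_kap_mult[of z0] 1 by simp
    have "of_real pi * z0\<^sup>2 = (1 - s) / 2" unfolding 3 by simp
    then have "norm (pker (1 - s) z0) = exp (Re (- (1 - s) * (of_real (L / 2) + of_real \<phi> * \<i> + pi / 4 * \<i>) + (1 - s) / 2))"
      by (simp only: pker_def Ln_z0 norm_exp_eq_Re)
    also have "Re (- (1 - s) * (of_real (L / 2) + of_real \<phi> * \<i> + pi / 4 * \<i>) + (1 - s) / 2)
       = Re (1 - s) * (1 - L) / 2 + Im (1 - s) * (\<phi> + pi / 4)"
      by (simp add: field_simps)
    also have "\<dots> = r / 2 * (sin \<theta> * (1 - L) - \<theta> * cos \<theta>)"
      unfolding s_polar by (simp add: cs) (simp add: \<phi>_def field_simps)
    also have "\<dots> \<le> 0"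
      using saddle_peak_nonpos[OF L1 \<theta>] r0 by (simp add: mult_le_0_iff)
    finally show ?thesis by simp
  qed
  have 5: "Re s \<le> 1"
  proof -
    have "0 \<le> sin \<theta>" using \<theta> \<theta>pi by (intro sin_ge_zero) auto
    then have "0 \<le> Re (1 - s)" unfolding s_polar using r0 by (simp add: cs)
    then show ?thesis by simp
  qed
  show ?thesis by (rule that[OF 1 2 3 4 5])
qed

definition remainder_bound :: real where
  "remainder_bound = (\<integral>t. exp (pi * (1 / 4 + 3 / 2 * \<bar>t\<bar> - 2 / 5 * t\<^sup>2)) \<partial>lborel)"

text \<open>Moving the line to the saddle collects the terms up to m; a small displacement keeps it
  clear of the poles without changing that count.\<close>

lemma Rstar_partial_sum:
  fixes s z0 :: complex
  assumes z0: "2 \<le> Re z0" "\<bar>Im z0\<bar> \<le> Re z0" and s: "1 - s = 2 * pi * z0\<^sup>2"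
    and peak: "norm (pker (1 - s) z0) \<le> 1"
  shows "norm ((\<Sum>n = 1..m_index s. of_int n powr (s - 1)) - Rstar (1 - s)) \<le> remainder_bound"
proof -
  define m where "m = m_index s"
  define p where "p = sqrt 2 * Re z0"
  have m: "m = \<lfloor>p\<rfloor>" unfolding m_def p_def using z0 s by (intro m_index_eq) auto
  have mp: "real_of_int m \<le> p" "p < real_of_int m + 1" unfolding m by linarith+
  \<comment> \<open>The crossing point p is clamped to the middle half of its unit interval. It
    moves by at most 1/4 and passes no integer, except that it steps off m to the right when p = m,
    so the term n = m is counted.\<close>
  define p' where "p' = min (max p (real_of_int m + 1 / 4)) (real_of_int m + 3 / 4)"
  have p': "real_of_int m + 1 / 4 \<le> p'" "p' \<le> real_of_int m + 3 / 4" "\<bar>p' - p\<bar> \<le> 1 / 4"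
    using mp by (auto simp: p'_def min_def max_def abs_le_iff)
  define d where "d = (p' - p) / sqrt 2"
  have s2: "1 \<le> sqrt 2" by simp
  have "\<bar>d\<bar> = \<bar>p' - p\<bar> / sqrt 2" by (simp add: d_def)
  also have "\<dots> \<le> \<bar>p' - p\<bar> / 1" using s2 by (intro divide_left_mono) auto
  finally have d: "\<bar>d\<bar> \<le> 1 / 4" using p'(3) by simp
  have b: "sqrt 2 * (Re z0 + d) = p'" by (simp add: d_def p_def distrib_left)
  have nonint: "sqrt 2 * (Re z0 + d) \<notin> \<int>"
  proof
    assume "sqrt 2 * (Re z0 + d) \<in> \<int>"
    then obtain k :: int where k: "p' = of_int k" unfolding b by (auto elim: Ints_cases)
    then have "real_of_int m < real_of_int k" "real_of_int k < real_of_int (m + 1)" using p' by auto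
    then have "m < k" "k < m + 1" by (simp_all only: of_int_less_iff)
    then show False by linarith
  qed
  have "Rstar (1 - s) = (\<Sum>n | sqrt 2 * (1/2) < real n \<and> real n < sqrt 2 * (Re z0 + d). of_nat n powr (- (1 - s)))
      + kint (pker (1 - s)) (Re z0 + d)"
    unfolding Rstar_def
    by (rule kint_pker_shift) (use z0 d half_line nonint in auto)
  also have "(\<Sum>n | sqrt 2 * (1/2) < real n \<and> real n < sqrt 2 * (Re z0 + d). of_nat n powr (- (1 - s)))
     = (\<Sum>n = 1..m. of_int n powr (s - 1))"
  proof (rule sum.reindex_bij_witness[of _ nat int])
    fix n :: nat assume n: "n \<in> {n. sqrt 2 * (1/2) < real n \<and> real n < sqrt 2 * (Re z0 + d)}"
    have "0 < sqrt 2 * (1/2::real)" by simp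
    moreover have "sqrt 2 * (1/2) < real n" using n by (simp only: mem_Collect_eq)
    ultimately have "0 < real n" by linarith
    moreover have "real n < real_of_int (m + 1)" using n p' unfolding b by auto
    then have "real_of_int (int n) < real_of_int (m + 1)" by simp
    then have "int n < m + 1" by (simp only: of_int_less_iff)
    ultimately show "int n \<in> {1..m}" by auto
  next
    fix k assume k: "k \<in> {1..m}"
    then have "real_of_int k \<le> real_of_int m" by simp
    moreover have "1 \<le> real_of_int k" using k by simp
    then have "sqrt 2 * (1/2) < real_of_int k" using half_line(2) by linarith
    ultimately show "nat k \<in> {n. sqrt 2 * (1/2) < real n \<and> real n < sqrt 2 * (Re z0 + d)}"
      using k p' unfolding b by auto
  qed auto
  finally have "(\<Sum>n = 1..m. of_int n powr (s - 1)) - Rstar (1 - s) = - kint (pker (1 - s)) (Re z0 + d)"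
    by simp
  moreover have "norm (kint (pker (2 * pi * z0\<^sup>2)) (Re z0 + d)) \<le> remainder_bound"
    unfolding remainder_bound_def
    using peak p' by (intro saddle_integral_bound[OF z0 d, of m]) (auto simp: s b)
  ultimately show ?thesis by (simp add: m_def s)
qed

theorem theorem22:
  fixes c :: real
  assumes "0 < c" and "c < 1"
  shows "\<exists>E :: complex \<Rightarrow> complex.
           E \<in> O[inf at_infinity (principal G_region)](\<lambda>_. 1) \<and>
           (\<forall>\<^sub>F s in inf at_infinity (principal G_region).
              riemann_R c s =
                chi s * (zeta (1 - s) - (\<Sum>n = 1..m_index s. of_int n powr (s - 1)) + E s))"
proof (intro exI conjI)
  let ?F = "inf at_infinity (principal G_region)"
  \<comment> \<open>With this error term the partial sums cancel and the required equation is
    exactly Riemann's identity.\<close>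
  let ?E = "\<lambda>s. (\<Sum>n = 1..m_index s. of_int n powr (s - 1)) - Rstar (1 - s)"
  have ev: "eventually (\<lambda>s. s \<in> G_region \<and> 16 * pi \<le> norm (s - 1)) ?F"
    unfolding eventually_inf_principal eventually_at_infinity
  proof (intro exI allI impI)
    fix s :: complex assume "16 * pi + 1 \<le> norm s"
    moreover have "norm s \<le> norm (s - 1) + 1" using norm_triangle_ineq[of "s - 1" 1] by simp
    ultimately have "16 * pi \<le> norm (s - 1)" by linarith
    moreover assume "s \<in> G_region"
    ultimately show "s \<in> G_region \<and> 16 * pi \<le> norm (s - 1)" by blast
  qed
  show "?E \<in> O[?F](\<lambda>_. 1)"
  proof (rule bigoI)
    show "eventually (\<lambda>s. norm (?E s) \<le> remainder_bound * norm (1 :: complex)) ?F"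
      using ev
    proof eventually_elim
      case (elim s)
      then have "s \<in> G_region" "16 * pi \<le> norm (s - 1)" by auto
      then obtain z0 :: complex where "2 \<le> Re z0" "\<bar>Im z0\<bar> \<le> Re z0" "1 - s = 2 * pi * z0\<^sup>2"
        "norm (pker (1 - s) z0) \<le> 1" by (rule G_region_saddle)
      from Rstar_partial_sum[OF this] show ?case by simp
    qed
  qed
  show "\<forall>\<^sub>F s in ?F. riemann_R c s =
      chi s * (zeta (1 - s) - (\<Sum>n = 1..m_index s. of_int n powr (s - 1)) + ?E s)"
    using ev
  proof eventually_elim
    case (elim s)
    then have "s \<in> G_region" "16 * pi \<le> norm (s - 1)" by auto
    then have Re: "Re s \<le> 1" by (rule G_region_saddle)
    \<comment> \<open>This excludes s = 0, which corresponds to the pole of zeta at 1 - s = 1, and s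
      = 1, the pole of chi.\<close>
    have "norm (s - 1) > 1" using elim pi_ge_two by linarith
    then have "s \<noteq> 0" "s \<noteq> 1" by auto
    then have "cnj (Rstar (1 - cnj (1 - s))) = chi (1 - (1 - s)) * (zeta (1 - s) - Rstar (1 - s))"
      using Re by (intro functional_equation) auto
    then show ?case by (simp add: riemann_R_eq_Rstar[OF assms])
  qed
qed

end
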